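(* Let $l\ge 3$ be an odd integer, $q=e^{2\pi i/l}\in\mathbb C$, and let $\Phi_2:\mathcal H_n(q^2)\to Tl_n(q)$ be the surjective $\mathbb C$-algebra homomorphism determined by $T_i\mapsto -qU_i-1$ for $1\le i\le n-1$. Then $\mathcal I_n:=\ker\Phi_2$ is a graded ideal of $\mathcal H_n(q^2)$ with respect to the Brundan--Kleshchev $\mathbb Z$-grading on $\mathcal H_n(q^2)$. Hence $Tl_n(q)\cong\mathcal H_n(q^2)/\mathcal I_n$ is a $\mathbb Z$-graded algebra, with the grading induced from the one on $\mathcal H_n(q^2)$.
   Context: All algebras are associative, unital, over $\mathbb C$. $[2]=q+q^{-1}$. Temperley--Lieb algebra $Tl_n(q)$: generators $U_1,\dots,U_{n-1}$, relations $U_i^2=-[2]U_i$; $U_iU_jU_i=U_i$ if $|i-j|=1$; $U_iU_j=U_jU_i$ if $|i-j|>1$. Hecke algebra $\mathcal H_n(q^2)$ (type $A_{n-1}$): generators $T_1,\dots,T_{n-1}$, relations $(T_i-q^2)(T_i+1)=0$; $T_iT_{i+1}T_i=T_{i+1}T_iT_{i+1}$; $T_iT_j=T_jT_i$ if $|i-j|>1$. Put $L_1=1$ and $L_{r+1}=q^{-2}T_rL_rT_r$ (Jucys--Murphy elements). Brundan--Kleshchev grading. Let $I=\mathbb Z/l\mathbb Z$. Every finite dimensional $\mathcal H_n(q^2)$-module $M$ is the direct sum of its generalized weight spaces $M_{\mathbf i}=\{v\in M: (L_r-q^{2i_r})^Nv=0 \text{ for all } r \text{ and } N\gg0\}$,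 $\mathbf i\in I^n$; let $\{e(\mathbf i)\}_{\mathbf i\in I^n}\subset\mathcal H_n(q^2)$ be the system of mutually orthogonal idempotents (some possibly zero) with $e(\mathbf i)M=M_{\mathbf i}$ for all $M$. Let $y_r=\sum_{\mathbf i}(1-q^{-2i_r}L_r)e(\mathbf i)$ (nilpotent) and $\psi_r=\sum_{\mathbf i}(T_r+P_r(\mathbf i))Q_r(\mathbf i)^{-1}e(\mathbf i)$, where, writing $X=q^{2i_r}(1-y_r)$, $Y=q^{2i_{r+1}}(1-y_{r+1})$, the power series $P_r(\mathbf i),Q_r(\mathbf i)\in\mathbb C[[y_r,y_{r+1}]]$ are: $P_r(\mathbf i)=1$ if $i_r=i_{r+1}$, and $P_r(\mathbf i)=(1-q^2)(1-XY^{-1})^{-1}$ otherwise; $Q_r(\mathbf i)=1-q^2+q^2y_{r+1}-y_r$ if $i_r=i_{r+1}$, $Q_r(\mathbf i)=(X-q^2Y)/(X-Y)^2$ if $i_{r+1}=i_r+1$, $Q_r(\mathbf i)=q^{2i_r}$ if $i_{r+1}=i_r-1$, and $Q_r(\mathbf i)=(X-q^2Y)/(X-Y)$ in all other cases. By a theorem of Brundan and Kleshchev the elements $e(\mathbf i),y_r,\psi_s$ generate $\mathcal H_n(q^2)$ and there is a unique $\mathbb Z$-grading on $\mathcal H_n(q^2)$ with $\deg e(\mathbf i)=0$, $\deg y_r=2$, $\deg\psi_se(\mathbf i)=-a_{i_s,i_{s+1}}$, where $a_{ij}=2$ if $i=j$, $a_{ij}=-1$ if $i=j\pm1$ in $I$,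 and $a_{ij}=0$ otherwise. An ideal $J$ of a $\mathbb Z$-graded algebra $A=\bigoplus_nA_n$ is graded if $J=\bigoplus_n(J\cap A_n)$. *)

theory Defs
  imports
    Complex_Main
    "HOL-Library.Poly_Mapping"
    "HOL-Library.FuncSet"
    "HOL-Algebra.QuotRing"
    "HOL-Algebra.Module"
    "Jordan_Normal_Form.Matrix"
begin

section \<open>Associative unital complex algebras\<close>

text \<open>The library locale \<open>algebra\<close> is restricted to commutative algebras.  We keep its record
  type and drop commutativity.\<close>

locale calgebra = ring A for A :: "(complex, 'a) module" (structure) +
  assumes smult_closed: "x \<in> carrier A \<Longrightarrow> c \<odot> x \<in> carrier A"
    and smult_l_distr: "x \<in> carrier A \<Longrightarrow> (c + d) \<odot> x = c \<odot> x \<oplus> d \<odot> x"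
    and smult_r_distr: "x \<in> carrier A \<Longrightarrow> y \<in> carrier A \<Longrightarrow> c \<odot> (x \<oplus> y) = c \<odot> x \<oplus> c \<odot> y"
    and smult_assoc: "x \<in> carrier A \<Longrightarrow> (c * d) \<odot> x = c \<odot> (d \<odot> x)"
    and smult_one: "x \<in> carrier A \<Longrightarrow> 1 \<odot> x = x"
    and smult_mult_left: "x \<in> carrier A \<Longrightarrow> y \<in> carrier A \<Longrightarrow> (c \<odot> x) \<otimes> y = c \<odot> (x \<otimes> y)"
    and smult_mult_right: "x \<in> carrier A \<Longrightarrow> y \<in> carrier A \<Longrightarrow> x \<otimes> (c \<odot> y) = c \<odot> (x \<otimes> y)"

definition calg_hom :: "(complex, 'a) module \<Rightarrow> (complex, 'b) module \<Rightarrow> ('a \<Rightarrow> 'b) set" where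
  "calg_hom A B = {f \<in> Ring.ring_hom A B. \<forall>c. \<forall>x\<in>carrier A. f (c \<odot>\<^bsub>A\<^esub> x) = c \<odot>\<^bsub>B\<^esub> f x}"

definition calg_iso :: "(complex, 'a) module \<Rightarrow> (complex, 'b) module \<Rightarrow> ('a \<Rightarrow> 'b) set" where
  "calg_iso A B = {f \<in> calg_hom A B. bij_betw f (carrier A) (carrier B)}"

definition quot_alg :: "(complex, 'a) module \<Rightarrow> 'a set \<Rightarrow> (complex, 'a set) module" where
  "quot_alg A J = ring.extend (A Quot J)
     (module.fields (\<lambda>c X. \<Union>x\<in>X. J +>\<^bsub>A\<^esub> (c \<odot>\<^bsub>A\<^esub> x)))"

definition csubspace_of :: "(complex, 'a) module \<Rightarrow> 'a set \<Rightarrow> bool" where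
  "csubspace_of A V \<longleftrightarrow> subgroup V (add_monoid A) \<and> (\<forall>c. \<forall>v\<in>V. c \<odot>\<^bsub>A\<^esub> v \<in> V)"


section \<open>Gradings\<close>

definition is_direct_sum :: "(complex, 'a) module \<Rightarrow> (int \<Rightarrow> 'a set) \<Rightarrow> 'a set \<Rightarrow> bool" where
  "is_direct_sum A G V \<longleftrightarrow>
     csubspace_of A V \<and> (\<forall>k. csubspace_of A (G k) \<and> G k \<subseteq> V) \<and>
     (\<forall>x\<in>V. \<exists>!f. (\<forall>k. f k \<in> G k) \<and> finite {k. f k \<noteq> \<zero>\<^bsub>A\<^esub>} \<and>
               x = (\<Oplus>\<^bsub>A\<^esub>k\<in>{k. f k \<noteq> \<zero>\<^bsub>A\<^esub>}. f k))"

definition graded_algebra :: "(complex, 'a) module \<Rightarrow> (int \<Rightarrow> 'a set) \<Rightarrow> bool" where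
  "graded_algebra A G \<longleftrightarrow>
     calgebra A \<and> is_direct_sum A G (carrier A) \<and>
     (\<forall>j k. \<forall>x\<in>G j. \<forall>y\<in>G k. x \<otimes>\<^bsub>A\<^esub> y \<in> G (j + k))"

definition graded_ideal :: "(complex, 'a) module \<Rightarrow> (int \<Rightarrow> 'a set) \<Rightarrow> 'a set \<Rightarrow> bool" where
  "graded_ideal A G J \<longleftrightarrow> ideal J A \<and> is_direct_sum A (\<lambda>k. J \<inter> G k) J"

definition quot_grading :: "(complex, 'a) module \<Rightarrow> 'a set \<Rightarrow> (int \<Rightarrow> 'a set) \<Rightarrow> int \<Rightarrow> 'a set set" where
  "quot_grading A J G k = (\<lambda>x. J +>\<^bsub>A\<^esub> x) ` G k"


section \<open>Free algebras and algebras given by generators and relations\<close>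

datatype 'x free_monoid = Fmon (letters: "'x list")

instantiation free_monoid :: (type) monoid_add
begin

definition "0 = Fmon []"
definition "u + v = Fmon (letters u @ letters v)"

instance
  by standard (simp_all add: zero_free_monoid_def plus_free_monoid_def)

end

text \<open>Noncommutative polynomials in indeterminates indexed by \<open>nat\<close>: multiplication is
  convolution over the free monoid of words.\<close>

type_synonym ncpoly = "nat free_monoid \<Rightarrow>\<^sub>0 complex"

definition ncvar :: "nat \<Rightarrow> ncpoly" where
  "ncvar i = Poly_Mapping.single (Fmon [i]) 1"

definition ncconst :: "complex \<Rightarrow> ncpoly" where
  "ncconst c = Poly_Mapping.single 0 c"

definition free_alg :: "nat set \<Rightarrow> (complex, ncpoly) module" where
  "free_alg X =
     \<lparr>carrier = {p. \<forall>w\<in>Poly_Mapping.keys p. set (letters w) \<subseteq> X},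
      monoid.mult = (*), one = 1, zero = 0, add = (+), smult = (\<lambda>c p. ncconst c * p)\<rparr>"

definition presented_alg :: "nat set \<Rightarrow> ncpoly set \<Rightarrow> (complex, ncpoly set) module" where
  "presented_alg X R = quot_alg (free_alg X) (Idl\<^bsub>free_alg X\<^esub> R)"

definition presented_gen :: "nat set \<Rightarrow> ncpoly set \<Rightarrow> nat \<Rightarrow> ncpoly set" where
  "presented_gen X R i = (Idl\<^bsub>free_alg X\<^esub> R) +>\<^bsub>free_alg X\<^esub> ncvar i"

lemma ncconst_central: "ncconst c * p = p * ncconst c"
proof (induction p rule: update_induct)
  case const
  then show ?case by simp
next
  case (update f k v)
  then have "Poly_Mapping.update k v f = f + Poly_Mapping.single k v"
    by (intro poly_mapping_eqI)
      (auto simp: lookup_update lookup_add lookup_single in_keys_iff when_def)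
  with update show ?case
    by (simp add: distrib_left distrib_right ncconst_def mult_single mult.commute)
qed

lemma ncconst_simps:
  "ncconst (c + d) = ncconst c + ncconst d" "ncconst (c * d) = ncconst c * ncconst d"
  "ncconst 1 = 1"
  by (simp_all add: ncconst_def single_add mult_single)

lemma calgebra_free_alg: "calgebra (free_alg X)"
proof -
  let ?C = "{p :: ncpoly. \<forall>w\<in>Poly_Mapping.keys p. set (letters w) \<subseteq> X}"
  have mult: "p * r \<in> ?C" if "p \<in> ?C" "r \<in> ?C" for p r
  proof (rule CollectI, rule ballI)
    fix w assume "w \<in> Poly_Mapping.keys (p * r)"
    then obtain u v where "u \<in> Poly_Mapping.keys p" "v \<in> Poly_Mapping.keys r" "w = u + v"
      using keys_mult[of p r] by blast
    with that show "set (letters w) \<subseteq> X"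
      by (simp add: plus_free_monoid_def)
  qed
  have add: "p + r \<in> ?C" if "p \<in> ?C" "r \<in> ?C" for p r
    using that Poly_Mapping.keys_add[of p r] by blast
  have const: "ncconst c \<in> ?C" for c
    by (simp add: ncconst_def zero_free_monoid_def)
  have one: "1 \<in> ?C" using const[of 1] by (simp add: ncconst_simps)
  have sel: "carrier (free_alg X) = ?C" "monoid.mult (free_alg X) = (*)" "one (free_alg X) = 1"
    "zero (free_alg X) = 0" "add (free_alg X) = (+)"
    "smult (free_alg X) = (\<lambda>c p. ncconst c * p)"
    by (simp_all add: free_alg_def)
  have "abelian_group (free_alg X)"
  proof (rule abelian_groupI, unfold sel, goal_cases)
    case (1 p r)
    then show ?case by (rule add)
  next
    case (6 p)
    then have "- p \<in> ?C" by simp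
    then show ?case by (rule bexI[rotated]) simp
  qed (simp_all add: add_ac)
  moreover have "monoid (free_alg X)"
  proof (rule monoidI, unfold sel, goal_cases)
    case (1 p r)
    then show ?case by (rule mult)
  next
    case 2
    show ?case by (rule one)
  qed (simp_all add: mult.assoc)
  ultimately have "ring (free_alg X)"
    by (rule ringI) (simp_all add: sel distrib_left distrib_right)
  moreover have "calgebra_axioms (free_alg X)"
  proof (unfold_locales, unfold sel, goal_cases)
    case (1 x c)
    then show ?case by (rule mult[OF const])
  next
    case (7 x y c)
    show ?case by (metis ncconst_central mult.assoc)
  qed (simp_all add: ncconst_simps distrib_left distrib_right mult.assoc)
  ultimately show ?thesis by (rule calgebra.intro)
qed

lemma calgebra_quot_alg:
  assumes A: "calgebra A" and J: "ideal J A"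
  shows "calgebra (quot_alg A J)"
proof -
  interpret calgebra A by fact
  interpret J: ideal J A by fact
  have flds: "carrier (quot_alg A J) = carrier (A Quot J)"
    "monoid.mult (quot_alg A J) = monoid.mult (A Quot J)"
    "one (quot_alg A J) = one (A Quot J)" "zero (quot_alg A J) = zero (A Quot J)"
    "add (quot_alg A J) = add (A Quot J)"
    "smult (quot_alg A J) = (\<lambda>c X. \<Union>x\<in>X. J +>\<^bsub>A\<^esub> (c \<odot>\<^bsub>A\<^esub> x))"
    by (simp_all add: quot_alg_def FactRing_def ring.extend_def module.fields_def)
  have rngQ: "ring (A Quot J)" by (rule J.quotient_is_ring)
  have J_smult: "c \<odot>\<^bsub>A\<^esub> x \<in> J" if "x \<in> J" for c x
    using that J.I_l_closed[OF that smult_closed[OF one_closed, of c]]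
    by (simp add: smult_mult_left J.Icarr)
  have sm: "(\<Union>x'\<in>J +>\<^bsub>A\<^esub> x. J +>\<^bsub>A\<^esub> (c \<odot>\<^bsub>A\<^esub> x')) = J +>\<^bsub>A\<^esub> (c \<odot>\<^bsub>A\<^esub> x)"
    if x: "x \<in> carrier A" for c x
  proof -
    have "J +>\<^bsub>A\<^esub> (c \<odot>\<^bsub>A\<^esub> x') = J +>\<^bsub>A\<^esub> (c \<odot>\<^bsub>A\<^esub> x)" if "x' \<in> J +>\<^bsub>A\<^esub> x" for x'
    proof -
      from that obtain h where h: "h \<in> J" "x' = h \<oplus>\<^bsub>A\<^esub> x"
        by (auto simp: a_r_coset_def')
      then have "c \<odot>\<^bsub>A\<^esub> x' = c \<odot>\<^bsub>A\<^esub> h \<oplus>\<^bsub>A\<^esub> c \<odot>\<^bsub>A\<^esub> x"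
        using x by (simp add: smult_r_distr J.Icarr)
      then have "c \<odot>\<^bsub>A\<^esub> x' \<in> J +>\<^bsub>A\<^esub> (c \<odot>\<^bsub>A\<^esub> x)"
        using J_smult[OF h(1)] by (auto simp: a_r_coset_def')
      then show ?thesis
        using a_repr_independence smult_closed[OF x] J.a_subgroup by metis
    qed
    moreover have "x \<in> J +>\<^bsub>A\<^esub> x" using x by (rule J.a_rcos_self)
    ultimately show ?thesis by blast
  qed
  have smQ: "c \<odot>\<^bsub>quot_alg A J\<^esub> (J +>\<^bsub>A\<^esub> x) = J +>\<^bsub>A\<^esub> (c \<odot>\<^bsub>A\<^esub> x)"
    if "x \<in> carrier A" for c x
    using sm[OF that] by (simp only: flds)
  have addQ: "(J +>\<^bsub>A\<^esub> x) \<oplus>\<^bsub>A Quot J\<^esub> (J +>\<^bsub>A\<^esub> y) = J +>\<^bsub>A\<^esub> (x \<oplus>\<^bsub>A\<^esub> y)"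
    if "x \<in> carrier A" "y \<in> carrier A" for x y
    using that by (simp add: FactRing_def J.a_rcos_sum)
  have multQ: "(J +>\<^bsub>A\<^esub> x) \<otimes>\<^bsub>A Quot J\<^esub> (J +>\<^bsub>A\<^esub> y) = J +>\<^bsub>A\<^esub> (x \<otimes>\<^bsub>A\<^esub> y)"
    if "x \<in> carrier A" "y \<in> carrier A" for x y
    using that by (simp add: FactRing_def J.rcoset_mult_add)
  have car: "\<exists>x\<in>carrier A. X = J +>\<^bsub>A\<^esub> x" if "X \<in> carrier (A Quot J)" for X
    using that by (auto simp: FactRing_def A_RCOSETS_def')
  have carI: "J +>\<^bsub>A\<^esub> x \<in> carrier (A Quot J)" if "x \<in> carrier A" for x
    using that by (auto simp: FactRing_def A_RCOSETS_def')
  have "ring (quot_alg A J)"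
  proof -
    interpret Q: ring "A Quot J" by (rule rngQ)
    have "abelian_group (quot_alg A J)"
    proof (rule abelian_groupI, goal_cases)
      case (6 x)
      then show ?case
        by (intro bexI[of _ "\<ominus>\<^bsub>A Quot J\<^esub> x"]) (auto simp: flds Q.l_neg)
    qed (auto simp: flds Q.a_ac)
    moreover have "monoid (quot_alg A J)"
      by (rule monoidI) (auto simp: flds Q.m_assoc)
    ultimately show ?thesis
      by (rule ringI) (auto simp: flds Q.l_distr Q.r_distr)
  qed
  moreover have "calgebra_axioms (quot_alg A J)"
  proof (unfold_locales, unfold flds(1-5), goal_cases)
    case (1 X c)
    then show ?case using car[of X] by (auto simp: smQ carI[OF smult_closed])
  next
    case (2 X c d)
    then show ?case using car[of X] by (auto simp: smQ addQ smult_closed smult_l_distr)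
  next
    case (3 X Y c)
    then show ?case using car[of X] car[of Y] by (auto simp: smQ addQ smult_closed smult_r_distr)
  next
    case (4 X c d)
    then show ?case using car[of X] by (auto simp: smQ smult_closed smult_assoc)
  next
    case (5 X)
    then show ?case using car[of X] by (auto simp: smQ smult_one)
  next
    case (6 X Y c)
    then show ?case using car[of X] car[of Y]
      by (auto simp: smQ multQ smult_closed smult_mult_left)
  next
    case (7 X Y c)
    then show ?case using car[of X] car[of Y]
      by (auto simp: smQ multQ smult_closed smult_mult_right)
  qed
  ultimately show ?thesis by (rule calgebra.intro)
qed

lemma calgebra_presented_alg:
  assumes "R \<subseteq> carrier (free_alg X)"
  shows "calgebra (presented_alg X R)"
  unfolding presented_alg_def
  by (intro calgebra_quot_alg calgebra_free_alg ring.genideal_ideal assms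
      calgebra.axioms(1)[OF calgebra_free_alg])


section \<open>Temperley--Lieb and Hecke algebras\<close>

text \<open>In the relations an equation \<open>a = b\<close> is encoded as the element \<open>a - b\<close>.\<close>

definition tl_rels :: "nat \<Rightarrow> complex \<Rightarrow> ncpoly set" where
  "tl_rels n q =
     {ncvar i * ncvar i + ncconst (q + inverse q) * ncvar i | i. i \<in> {1..<n}} \<union>
     {ncvar i * ncvar j * ncvar i - ncvar i | i j.
        i \<in> {1..<n} \<and> j \<in> {1..<n} \<and> (j = i + 1 \<or> i = j + 1)} \<union>
     {ncvar i * ncvar j - ncvar j * ncvar i | i j.
        i \<in> {1..<n} \<and> j \<in> {1..<n} \<and> (j > i + 1 \<or> i > j + 1)}"

definition tl_alg :: "nat \<Rightarrow> complex \<Rightarrow> (complex, ncpoly set) module" where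
  "tl_alg n q = presented_alg {1..<n} (tl_rels n q)"

definition tl_U :: "nat \<Rightarrow> complex \<Rightarrow> nat \<Rightarrow> ncpoly set" where
  "tl_U n q = presented_gen {1..<n} (tl_rels n q)"

text \<open>The parameter \<open>t\<close> is the one written \<open>q\<^sup>2\<close> in the quadratic relation
  \<open>(T\<^sub>i - q\<^sup>2) (T\<^sub>i + 1) = 0\<close>.\<close>

definition hecke_rels :: "nat \<Rightarrow> complex \<Rightarrow> ncpoly set" where
  "hecke_rels n t =
     {(ncvar i - ncconst t) * (ncvar i + 1) | i. i \<in> {1..<n}} \<union>
     {ncvar i * ncvar (i + 1) * ncvar i - ncvar (i + 1) * ncvar i * ncvar (i + 1) | i.
        i \<in> {1..<n} \<and> i + 1 \<in> {1..<n}} \<union>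
     {ncvar i * ncvar j - ncvar j * ncvar i | i j.
        i \<in> {1..<n} \<and> j \<in> {1..<n} \<and> (j > i + 1 \<or> i > j + 1)}"

definition hecke_alg :: "nat \<Rightarrow> complex \<Rightarrow> (complex, ncpoly set) module" where
  "hecke_alg n t = presented_alg {1..<n} (hecke_rels n t)"

definition hecke_T :: "nat \<Rightarrow> complex \<Rightarrow> nat \<Rightarrow> ncpoly set" where
  "hecke_T n t = presented_gen {1..<n} (hecke_rels n t)"

text \<open>Indices start at 1; the value at 0 is a dummy.\<close>

fun jucys_murphy :: "nat \<Rightarrow> complex \<Rightarrow> nat \<Rightarrow> ncpoly set" where
  "jucys_murphy n q 0 = \<one>\<^bsub>hecke_alg n (q\<^sup>2)\<^esub>"
| "jucys_murphy n q (Suc 0) = \<one>\<^bsub>hecke_alg n (q\<^sup>2)\<^esub>"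
| "jucys_murphy n q (Suc (Suc r)) =
     inverse (q\<^sup>2) \<odot>\<^bsub>hecke_alg n (q\<^sup>2)\<^esub>
       (hecke_T n (q\<^sup>2) (Suc r) \<otimes>\<^bsub>hecke_alg n (q\<^sup>2)\<^esub> jucys_murphy n q (Suc r)
          \<otimes>\<^bsub>hecke_alg n (q\<^sup>2)\<^esub> hecke_T n (q\<^sup>2) (Suc r))"

text \<open>The homomorphism determined by \<open>T\<^sub>i \<mapsto> - q U\<^sub>i - 1\<close>; membership in \<open>extensional\<close> only fixes
  the irrelevant values outside the carrier.\<close>

definition hecke_to_tl :: "nat \<Rightarrow> complex \<Rightarrow> ncpoly set \<Rightarrow> ncpoly set" where
  "hecke_to_tl n q =
     (THE \<Phi>. \<Phi> \<in> calg_hom (hecke_alg n (q\<^sup>2)) (tl_alg n q) \<and>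
        \<Phi> \<in> extensional (carrier (hecke_alg n (q\<^sup>2))) \<and>
        (\<forall>i\<in>{1..<n}. \<Phi> (hecke_T n (q\<^sup>2) i) =
           (- q) \<odot>\<^bsub>tl_alg n q\<^esub> tl_U n q i \<ominus>\<^bsub>tl_alg n q\<^esub> \<one>\<^bsub>tl_alg n q\<^esub>))"


section \<open>The Brundan--Kleshchev grading\<close>

text \<open>\<open>I = \<int>/l\<int>\<close> is represented by \<open>{0..<l}\<close>, and \<open>I\<^sup>n\<close> by functions on \<open>{1..n}\<close>.\<close>

definition residue_seqs :: "nat \<Rightarrow> nat \<Rightarrow> (nat \<Rightarrow> nat) set" where
  "residue_seqs l n = {1..n} \<rightarrow>\<^sub>E {0..<l}"

text \<open>A finite dimensional module is \<open>\<complex>\<^sup>d\<close> with action given by an algebra homomorphism \<open>\<rho>\<close>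
  into the algebra of \<open>d \<times> d\<close> matrices.\<close>

definition weight_space ::
  "complex \<Rightarrow> nat \<Rightarrow> nat \<Rightarrow> (ncpoly set \<Rightarrow> complex mat) \<Rightarrow> (nat \<Rightarrow> nat) \<Rightarrow> complex vec set" where
  "weight_space q n d \<rho> i =
     {v \<in> carrier_vec d. \<exists>N0::nat. \<forall>N\<ge>N0. \<forall>r\<in>{1..n}.
        \<rho> ((jucys_murphy n q r \<ominus>\<^bsub>hecke_alg n (q\<^sup>2)\<^esub>
              (q ^ (2 * i r)) \<odot>\<^bsub>hecke_alg n (q\<^sup>2)\<^esub> \<one>\<^bsub>hecke_alg n (q\<^sup>2)\<^esub>) [^]\<^bsub>hecke_alg n (q\<^sup>2)\<^esub> N)
          *\<^sub>v v = 0\<^sub>v d}"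

text \<open>The weight spaces of every finite dimensional module span it, so exactly one system
  \<open>e\<close> (up to its values outside \<open>I\<^sup>n\<close>) satisfies the following predicate.\<close>

definition weight_idempotents ::
  "complex \<Rightarrow> nat \<Rightarrow> nat \<Rightarrow> ((nat \<Rightarrow> nat) \<Rightarrow> ncpoly set) \<Rightarrow> bool" where
  "weight_idempotents q l n e \<longleftrightarrow>
     (\<forall>i\<in>residue_seqs l n. e i \<in> carrier (hecke_alg n (q\<^sup>2))) \<and>
     (\<forall>i\<in>residue_seqs l n. \<forall>j\<in>residue_seqs l n.
        e i \<otimes>\<^bsub>hecke_alg n (q\<^sup>2)\<^esub> e j = (if i = j then e i else \<zero>\<^bsub>hecke_alg n (q\<^sup>2)\<^esub>)) \<and>
     (\<forall>d. \<forall>\<rho>\<in>calg_hom (hecke_alg n (q\<^sup>2)) (module_mat TYPE(complex) d d).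
        \<forall>i\<in>residue_seqs l n. (\<lambda>v. \<rho> (e i) *\<^sub>v v) ` carrier_vec d = weight_space q n d \<rho> i)"

definition bk_y ::
  "complex \<Rightarrow> nat \<Rightarrow> nat \<Rightarrow> ((nat \<Rightarrow> nat) \<Rightarrow> ncpoly set) \<Rightarrow> nat \<Rightarrow> ncpoly set" where
  "bk_y q l n e r =
    (let H = hecke_alg n (q\<^sup>2) in
     \<Oplus>\<^bsub>H\<^esub>i\<in>residue_seqs l n.
       (\<one>\<^bsub>H\<^esub> \<ominus>\<^bsub>H\<^esub> inverse (q ^ (2 * i r)) \<odot>\<^bsub>H\<^esub> jucys_murphy n q r) \<otimes>\<^bsub>H\<^esub> e i)"

text \<open>\<open>bk_X q l n e i r\<close> is \<open>q\<^bsup>2i\<^sub>r\<^esup> (1 - y\<^sub>r)\<close>, so that \<open>X\<close> and \<open>Y\<close> are its values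
  at \<open>r\<close> and \<open>r + 1\<close>.\<close>

definition bk_X ::
  "complex \<Rightarrow> nat \<Rightarrow> nat \<Rightarrow> ((nat \<Rightarrow> nat) \<Rightarrow> ncpoly set) \<Rightarrow> (nat \<Rightarrow> nat) \<Rightarrow> nat \<Rightarrow> ncpoly set" where
  "bk_X q l n e i r =
    (let H = hecke_alg n (q\<^sup>2) in (q ^ (2 * i r)) \<odot>\<^bsub>H\<^esub> (\<one>\<^bsub>H\<^esub> \<ominus>\<^bsub>H\<^esub> bk_y q l n e r))"

text \<open>The power series \<open>P\<^sub>r(\<^bold>i)\<close> and \<open>Q\<^sub>r(\<^bold>i)\<close> are evaluated at the commuting nilpotent elements
  \<open>y\<^sub>r, y\<^sub>r\<^sub>+\<^sub>1\<close>.  Every series inverted below has nonzero constant term, and evaluation is a unital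
  ring homomorphism, so it carries inverses of series to inverses in the Hecke algebra.\<close>

definition bk_P ::
  "complex \<Rightarrow> nat \<Rightarrow> nat \<Rightarrow> ((nat \<Rightarrow> nat) \<Rightarrow> ncpoly set) \<Rightarrow> nat \<Rightarrow> (nat \<Rightarrow> nat) \<Rightarrow> ncpoly set" where
  "bk_P q l n e r i =
    (let H = hecke_alg n (q\<^sup>2); X = bk_X q l n e i r; Y = bk_X q l n e i (r + 1) in
     if i r = i (r + 1) then \<one>\<^bsub>H\<^esub>
     else (1 - q\<^sup>2) \<odot>\<^bsub>H\<^esub> inv\<^bsub>H\<^esub> (\<one>\<^bsub>H\<^esub> \<ominus>\<^bsub>H\<^esub> X \<otimes>\<^bsub>H\<^esub> inv\<^bsub>H\<^esub> Y))"

definition bk_Q ::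
  "complex \<Rightarrow> nat \<Rightarrow> nat \<Rightarrow> ((nat \<Rightarrow> nat) \<Rightarrow> ncpoly set) \<Rightarrow> nat \<Rightarrow> (nat \<Rightarrow> nat) \<Rightarrow> ncpoly set" where
  "bk_Q q l n e r i =
    (let H = hecke_alg n (q\<^sup>2); X = bk_X q l n e i r; Y = bk_X q l n e i (r + 1) in
     if i r = i (r + 1) then
       ((1 - q\<^sup>2) \<odot>\<^bsub>H\<^esub> \<one>\<^bsub>H\<^esub> \<oplus>\<^bsub>H\<^esub> q\<^sup>2 \<odot>\<^bsub>H\<^esub> bk_y q l n e (r + 1)) \<ominus>\<^bsub>H\<^esub> bk_y q l n e r
     else if i (r + 1) = (i r + 1) mod l then
       (X \<ominus>\<^bsub>H\<^esub> q\<^sup>2 \<odot>\<^bsub>H\<^esub> Y) \<otimes>\<^bsub>H\<^esub> inv\<^bsub>H\<^esub> ((X \<ominus>\<^bsub>H\<^esub> Y) [^]\<^bsub>H\<^esub> (2::nat))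
     else if i r = (i (r + 1) + 1) mod l then (q ^ (2 * i r)) \<odot>\<^bsub>H\<^esub> \<one>\<^bsub>H\<^esub>
     else (X \<ominus>\<^bsub>H\<^esub> q\<^sup>2 \<odot>\<^bsub>H\<^esub> Y) \<otimes>\<^bsub>H\<^esub> inv\<^bsub>H\<^esub> (X \<ominus>\<^bsub>H\<^esub> Y))"

definition bk_psi ::
  "complex \<Rightarrow> nat \<Rightarrow> nat \<Rightarrow> ((nat \<Rightarrow> nat) \<Rightarrow> ncpoly set) \<Rightarrow> nat \<Rightarrow> ncpoly set" where
  "bk_psi q l n e r =
    (let H = hecke_alg n (q\<^sup>2) in
     \<Oplus>\<^bsub>H\<^esub>i\<in>residue_seqs l n.
       (hecke_T n (q\<^sup>2) r \<oplus>\<^bsub>H\<^esub> bk_P q l n e r i) \<otimes>\<^bsub>H\<^esub> inv\<^bsub>H\<^esub> (bk_Q q l n e r i) \<otimes>\<^bsub>H\<^esub> e i)"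

definition cartan :: "nat \<Rightarrow> nat \<Rightarrow> nat \<Rightarrow> int" where
  "cartan l i j =
     (if i = j then 2 else if i = (j + 1) mod l \<or> j = (i + 1) mod l then -1 else 0)"

text \<open>For odd \<open>l \<ge> 3\<close> and \<open>q = exp (2\<pi>\<i>/l)\<close>, Brundan and Kleshchev show that exactly one \<open>G\<close>
  satisfies the following predicate.\<close>

definition bk_grading ::
  "complex \<Rightarrow> nat \<Rightarrow> nat \<Rightarrow> ((nat \<Rightarrow> nat) \<Rightarrow> ncpoly set) \<Rightarrow> (int \<Rightarrow> ncpoly set set) \<Rightarrow> bool" where
  "bk_grading q l n e G \<longleftrightarrow>
     graded_algebra (hecke_alg n (q\<^sup>2)) G \<and>
     (\<forall>i\<in>residue_seqs l n. e i \<in> G 0) \<and>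
     (\<forall>r\<in>{1..n}. bk_y q l n e r \<in> G 2) \<and>
     (\<forall>s\<in>{1..<n}. \<forall>i\<in>residue_seqs l n.
        bk_psi q l n e s \<otimes>\<^bsub>hecke_alg n (q\<^sup>2)\<^esub> e i \<in> G (- cartan l (i s) (i (s + 1))))"

end

theory Submission
  imports Defs "HOL-Computational_Algebra.Polynomial"
begin

text \<open>Write \<open>t = q\<^sup>2\<close>.  The kernel of \<open>\<Phi>\<close> is generated by \<open>x\<close>, the sum of the \<open>T\<^sub>w\<close> over the symmetric
  group on three letters, so it suffices to show that \<open>x\<close> is homogeneous.  Put \<open>p = T\<^sub>1 + 1\<close>, a multiple
  of the sum of the \<open>e(\<^bold>i)\<close> with \<open>i\<^sub>2 = 1\<close>; it has degree 0.  Then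
  \<open>(L\<^sub>3 - t\<^sup>-\<^sup>1) p = t\<^sup>-\<^sup>1 (t - 1) x\<close> and \<open>(L\<^sub>3 - t\<^sup>2) x = 0\<close>.  If \<open>l \<noteq> 3\<close>, the eigenvalues \<open>t\<^sup>-\<^sup>1\<close> and \<open>t\<^sup>2\<close>
  differ, and \<open>x\<close> is a multiple of the sum of the \<open>e(\<^bold>i)\<close> with \<open>i\<^sub>2 = 1\<close>, \<open>i\<^sub>3 = 2\<close>, of degree 0.  If
  \<open>l = 3\<close>, they coincide and \<open>x\<close> is a multiple of \<open>y\<^sub>3 p\<close>, of degree 2.

  Both arguments need that the \<open>e(\<^bold>i)\<close> sum to 1.  The commuting elements \<open>L\<^sub>r\<close> have nilpotent
  \<open>L\<^sub>r\<^sup>l - 1\<close>: an intertwiner \<open>\<phi>\<close> with \<open>\<phi> L\<^sub>r = L\<^sub>r\<^sub>+\<^sub>1 \<phi>\<close> and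
  \<open>\<phi>\<^sup>2 = (t L\<^sub>r\<^sub>+\<^sub>1 - L\<^sub>r) (t L\<^sub>r - L\<^sub>r\<^sub>+\<^sub>1)\<close> passes this property from \<open>L\<^sub>r\<close> to \<open>L\<^sub>r\<^sub>+\<^sub>1\<close>.  Hence 1 is a sum of
  weight vectors, and these are fixed by the \<open>e(\<^bold>i)\<close> because the Hecke algebra is finite dimensional
  and so has a faithful matrix representation.\<close>

section \<open>Evaluating noncommutative polynomials\<close>

text \<open>The element x is read off from the Temperley-Lieb relations: after substituting
  \<open>U_i = - q^-1 (T_i + 1)\<close>, the relation \<open>U_i U_j U_i = U_i\<close> becomes, up
  to a power of q and a quadratic Hecke relation, the vanishing of the sum of the
  \<open>T_w\<close>. Modulo x all Temperley-Lieb relations therefore hold, and the resulting map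
  back from the Temperley-Lieb algebra bounds the kernel from above without a dimension count. One
  generator suffices because the corresponding sums for other adjacent pairs are conjugate to x. The
  residues come from \<open>T_1\<close>: its eigenvalues t and -1 give
  \<open>L_2 = t^-1 T_1^2\<close> the eigenvalues t and t^-1, and these differ because t is a
  primitive l-th root of unity with l at least 3. The obstacle is that the idempotents are specified
  through their action on modules, whereas the argument needs identities inside the algebra; this is
  why nilpotency and a faithful representation are established. Noncommutative identities are
  certified in the free algebra, as explicit combinations of relations, and only then
  evaluated.\<close>

lemma ncpoly_induct [case_names zero single add]:
  fixes p :: ncpoly
  assumes "P 0" "\<And>w c. P (Poly_Mapping.single w c)" "\<And>p r. P p \<Longrightarrow> P r \<Longrightarrow> P (p + r)"
  shows "P p"
proof (induction p rule: update_induct)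
  case const
  then show ?case by (rule assms(1))
next
  case (update f k v)
  then have "Poly_Mapping.update k v f = f + Poly_Mapping.single k v"
    by (intro poly_mapping_eqI)
      (auto simp: lookup_update lookup_add lookup_single in_keys_iff when_def)
  with update assms show ?case by simp
qed

context calgebra
begin

lemma scalar_zero: "x \<in> carrier A \<Longrightarrow> 0 \<odot> x = \<zero>"
  using smult_l_distr[of x 0 0] smult_closed[of x 0] by simp

lemma scalar_minus_one: "x \<in> carrier A \<Longrightarrow> (- 1) \<odot> x = \<ominus> x"
  using smult_l_distr[of x "-1" 1] smult_closed[of x "-1"] smult_one[of x] scalar_zero[of x]
  by (simp add: minus_equality)

lemma smult_zero: "c \<odot> \<zero> = \<zero>"
  using smult_r_distr[of \<zero> \<zero> c] smult_closed[of \<zero> c] by simp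

lemma smult_minus: "x \<in> carrier A \<Longrightarrow> c \<odot> (\<ominus> x) = \<ominus> (c \<odot> x)"
  using smult_assoc[of x c "-1"] smult_assoc[of x "-1" c] smult_closed[of x c]
  by (simp add: scalar_minus_one[symmetric])

lemma minus_smult: "x \<in> carrier A \<Longrightarrow> (- c) \<odot> x = \<ominus> (c \<odot> x)"
  using smult_assoc[of x "-1" c] smult_closed[of x c] by (simp add: scalar_minus_one[symmetric])

lemma smult_finsum:
  assumes "f \<in> S \<rightarrow> carrier A"
  shows "c \<odot> (\<Oplus>i\<in>S. f i) = (\<Oplus>i\<in>S. c \<odot> f i)"
  using assms
proof (induction S rule: infinite_finite_induct)
  case (insert x F)
  then show ?case by (simp add: Pi_iff smult_closed smult_r_distr)
qed (simp_all add: smult_zero)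

lemma commute_mult:
  assumes "y \<in> carrier A" "u \<in> carrier A" "v \<in> carrier A" "y \<otimes> u = u \<otimes> y" "y \<otimes> v = v \<otimes> y"
  shows "y \<otimes> (u \<otimes> v) = (u \<otimes> v) \<otimes> y"
  using assms by (metis m_assoc)

definition monomial :: "(nat \<Rightarrow> 'a) \<Rightarrow> nat list \<Rightarrow> 'a" where
  "monomial \<sigma> w = foldr (\<lambda>i x. \<sigma> i \<otimes> x) w \<one>"

definition ncev :: "(nat \<Rightarrow> 'a) \<Rightarrow> ncpoly \<Rightarrow> 'a" where
  "ncev \<sigma> p = (\<Oplus>w\<in>Poly_Mapping.keys p. Poly_Mapping.lookup p w \<odot> monomial \<sigma> (letters w))"

end

text \<open>The assignment takes values in the carrier at every natural number, not only at the
  generators in use. Evaluation is then a homomorphism on all of \<open>ncpoly\<close> and its rules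
  carry no membership conditions; concrete assignments are padded accordingly.\<close>

locale calgebra_assignment = calgebra A for A :: "(complex, 'a) module" (structure) +
  fixes \<sigma> :: "nat \<Rightarrow> 'a"
  assumes assignment_closed [simp, intro]: "\<sigma> i \<in> carrier A"
begin

lemma monomial_closed [simp, intro]: "monomial \<sigma> w \<in> carrier A"
  by (induction w) (simp_all add: monomial_def)

lemma monomial_append: "monomial \<sigma> (u @ v) = monomial \<sigma> u \<otimes> monomial \<sigma> v"
  by (induction u) (simp_all add: monomial_def[of _ "_ # _"] monomial_def[of _ "[]"] m_assoc
    flip: monomial_def)

lemma ncev_closed [simp, intro]: "ncev \<sigma> p \<in> carrier A"
  unfolding ncev_def by (auto intro!: finsum_closed smult_closed)

lemma ncev_superset:
  assumes "finite W" "Poly_Mapping.keys p \<subseteq> W"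
  shows "ncev \<sigma> p = (\<Oplus>w\<in>W. Poly_Mapping.lookup p w \<odot> monomial \<sigma> (letters w))"
  unfolding ncev_def using assms
  by (intro add.finprod_mono_neutral_cong_left)
    (auto simp: in_keys_iff scalar_zero smult_closed)

lemma ncev_add: "ncev \<sigma> (p + r) = ncev \<sigma> p \<oplus> ncev \<sigma> r"
proof -
  let ?W = "Poly_Mapping.keys p \<union> Poly_Mapping.keys r"
  have "ncev \<sigma> s = (\<Oplus>w\<in>?W. Poly_Mapping.lookup s w \<odot> monomial \<sigma> (letters w))"
    if "Poly_Mapping.keys s \<subseteq> ?W" for s
    by (rule ncev_superset[OF _ that]) simp
  moreover have "Poly_Mapping.keys (p + r) \<subseteq> ?W" by (rule Poly_Mapping.keys_add)
  ultimately show ?thesis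
    by (simp add: lookup_add smult_l_distr finsum_addf smult_closed Pi_iff)
qed

lemma ncev_single: "ncev \<sigma> (Poly_Mapping.single w c) = c \<odot> monomial \<sigma> (letters w)"
  by (subst ncev_superset[of "{w}"]) (simp_all add: smult_closed)

lemma ncev_zero [simp]: "ncev \<sigma> 0 = \<zero>"
  by (simp add: ncev_def)

lemma ncev_mult: "ncev \<sigma> (p * r) = ncev \<sigma> p \<otimes> ncev \<sigma> r"
proof (induction p rule: ncpoly_induct)
  case (single u c)
  show ?case
  proof (induction r rule: ncpoly_induct)
    case (single v d)
    show ?case
      by (simp add: mult_single ncev_single plus_free_monoid_def monomial_append smult_closed
          smult_mult_left smult_mult_right smult_assoc[symmetric] mult.commute)
  next
    case (add p r)
    then show ?case by (simp add: ncev_add distrib_left r_distr)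
  qed simp
next
  case (add p r)
  then show ?case by (simp add: ncev_add distrib_right l_distr)
qed simp

lemma ncev_const: "ncev \<sigma> (ncconst c) = c \<odot> \<one>"
  by (simp add: ncconst_def ncev_single zero_free_monoid_def monomial_def)

lemma ncev_one [simp]: "ncev \<sigma> 1 = \<one>"
  using ncev_const[of 1] by (simp add: ncconst_simps smult_one)

lemma ncev_var [simp]: "ncev \<sigma> (ncvar i) = \<sigma> i"
  by (simp add: ncvar_def ncev_single monomial_def smult_one)

lemma ncev_uminus: "ncev \<sigma> (- p) = \<ominus> ncev \<sigma> p"
  using ncev_add[of "- p" p] by (simp add: minus_equality)

lemma ncev_diff: "ncev \<sigma> (p - r) = ncev \<sigma> p \<ominus> ncev \<sigma> r"
  using ncev_add[of p "- r"] by (simp add: ncev_uminus a_minus_def)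

lemma ncev_power: "ncev \<sigma> (p ^ k) = ncev \<sigma> p [^] k"
  by (induction k) (simp_all add: ncev_mult power_Suc2 del: power_Suc)

lemmas ncev_simps = ncev_add ncev_diff ncev_uminus ncev_const ncev_mult ncev_power

end

lemma free_alg_simps [simp]:
  "monoid.mult (free_alg X) = (*)" "one (free_alg X) = 1"
  "zero (free_alg X) = 0" "add (free_alg X) = (+)"
  "module.smult (free_alg X) = (\<lambda>c p. ncconst c * p)"
  by (simp_all add: free_alg_def)

section \<open>Homomorphisms and quotients\<close>

lemma (in abelian_group) eq_of_minus_eq_zero:
  "x \<in> carrier G \<Longrightarrow> y \<in> carrier G \<Longrightarrow> x \<ominus> y = \<zero> \<Longrightarrow> x = y"
  unfolding a_minus_def by (metis add.inv_closed minus_equality minus_minus)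

locale calg_homomorphism = A: calgebra A + B: calgebra B
  for A :: "(complex, 'a) module" and B :: "(complex, 'b) module" +
  fixes f :: "'a \<Rightarrow> 'b"
  assumes hom: "f \<in> calg_hom A B"
begin

lemma f_closed [simp]: "x \<in> carrier A \<Longrightarrow> f x \<in> carrier B"
  using hom by (auto simp: calg_hom_def Ring.ring_hom_def)

lemma f_add: "x \<in> carrier A \<Longrightarrow> y \<in> carrier A \<Longrightarrow> f (x \<oplus>\<^bsub>A\<^esub> y) = f x \<oplus>\<^bsub>B\<^esub> f y"
  using hom by (auto simp: calg_hom_def Ring.ring_hom_def)

lemma f_mult: "x \<in> carrier A \<Longrightarrow> y \<in> carrier A \<Longrightarrow> f (x \<otimes>\<^bsub>A\<^esub> y) = f x \<otimes>\<^bsub>B\<^esub> f y"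
  using hom by (auto simp: calg_hom_def Ring.ring_hom_def)

lemma f_one: "f \<one>\<^bsub>A\<^esub> = \<one>\<^bsub>B\<^esub>"
  using hom by (auto simp: calg_hom_def Ring.ring_hom_def)

lemma f_smult: "x \<in> carrier A \<Longrightarrow> f (c \<odot>\<^bsub>A\<^esub> x) = c \<odot>\<^bsub>B\<^esub> f x"
  using hom by (auto simp: calg_hom_def)

lemma f_zero: "f \<zero>\<^bsub>A\<^esub> = \<zero>\<^bsub>B\<^esub>"
  using f_smult[of "\<zero>\<^bsub>A\<^esub>" 0] by (simp add: A.smult_zero B.scalar_zero)

lemma f_uminus: "x \<in> carrier A \<Longrightarrow> f (\<ominus>\<^bsub>A\<^esub> x) = \<ominus>\<^bsub>B\<^esub> f x"
  using f_smult[of x "- 1"] by (simp add: A.scalar_minus_one B.scalar_minus_one)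

lemma f_diff: "x \<in> carrier A \<Longrightarrow> y \<in> carrier A \<Longrightarrow> f (x \<ominus>\<^bsub>A\<^esub> y) = f x \<ominus>\<^bsub>B\<^esub> f y"
  by (simp add: a_minus_def f_add f_uminus)

lemma f_pow: "x \<in> carrier A \<Longrightarrow> f (x [^]\<^bsub>A\<^esub> (k::nat)) = f x [^]\<^bsub>B\<^esub> k"
  by (induction k) (simp_all add: f_one f_mult)

lemma f_finsum:
  assumes "finite S" "g \<in> S \<rightarrow> carrier A"
  shows "f (\<Oplus>\<^bsub>A\<^esub>i\<in>S. g i) = (\<Oplus>\<^bsub>B\<^esub>i\<in>S. f (g i))"
  using assms by induction (simp_all add: f_zero f_add Pi_iff)

lemmas f_simps = f_add f_mult f_one f_smult f_zero f_uminus f_diff f_pow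

lemma mem_kernel: "x \<in> a_kernel A B f \<longleftrightarrow> x \<in> carrier A \<and> f x = \<zero>\<^bsub>B\<^esub>"
  by (simp add: a_kernel_def' )

lemma kernel_ideal: "ideal (a_kernel A B f) A"
proof (rule ring_hom_ring.kernel_is_ideal, rule ring_hom_ringI2)
  show "ring A" "ring B" by unfold_locales
  show "f \<in> Ring.ring_hom A B" using hom by (simp add: calg_hom_def)
qed

end

lemma calg_homomorphismI:
  "calgebra A \<Longrightarrow> calgebra B \<Longrightarrow> f \<in> calg_hom A B \<Longrightarrow> calg_homomorphism A B f"
  by (simp add: calg_homomorphism_def calg_homomorphism_axioms_def)

lemma calg_homI:
  assumes "\<And>x. x \<in> carrier A \<Longrightarrow> f x \<in> carrier B"
    "\<And>x y. x \<in> carrier A \<Longrightarrow> y \<in> carrier A \<Longrightarrow> f (x \<oplus>\<^bsub>A\<^esub> y) = f x \<oplus>\<^bsub>B\<^esub> f y"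
    "\<And>x y. x \<in> carrier A \<Longrightarrow> y \<in> carrier A \<Longrightarrow> f (x \<otimes>\<^bsub>A\<^esub> y) = f x \<otimes>\<^bsub>B\<^esub> f y"
    "f \<one>\<^bsub>A\<^esub> = \<one>\<^bsub>B\<^esub>"
    "\<And>c x. x \<in> carrier A \<Longrightarrow> f (c \<odot>\<^bsub>A\<^esub> x) = c \<odot>\<^bsub>B\<^esub> f x"
  shows "f \<in> calg_hom A B"
  using assms by (auto simp: calg_hom_def Ring.ring_hom_def)

lemma calg_hom_compose:
  assumes "f \<in> calg_hom A B" "g \<in> calg_hom B C"
  shows "(\<lambda>x. g (f x)) \<in> calg_hom A C"
  using assms by (auto simp: calg_hom_def Ring.ring_hom_def Pi_iff)

locale calgebra_ideal = calgebra A + ideal J A for A :: "(complex, 'a) module" (structure) and J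
begin

lemma coset_eq_iff:
  "x \<in> carrier A \<Longrightarrow> y \<in> carrier A \<Longrightarrow> J +> x = J +> y \<longleftrightarrow> x \<ominus> y \<in> J"
  using quotient_eq_iff_same_a_r_cos[OF is_ideal] by blast

lemma quot_carrier: "carrier (quot_alg A J) = (\<lambda>x. J +> x) ` carrier A"
  by (auto simp: quot_alg_def FactRing_def A_RCOSETS_def' ring.extend_def module.fields_def)

lemma quot_calgebra: "calgebra (quot_alg A J)"
  by (rule calgebra_quot_alg) unfold_locales

lemma ideal_smult: "x \<in> J \<Longrightarrow> c \<odot> x \<in> J"
  using I_l_closed[of x "c \<odot> \<one>"] by (simp add: smult_closed smult_mult_left Icarr)

lemma quot_smult:
  assumes x: "x \<in> carrier A"
  shows "c \<odot>\<^bsub>quot_alg A J\<^esub> (J +> x) = J +> (c \<odot> x)"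
proof -
  have "J +> (c \<odot> x') = J +> (c \<odot> x)" if "x' \<in> J +> x" for x'
  proof -
    have x': "x' \<in> carrier A"
      using a_r_coset_subset_G[OF a_subset x] that by blast
    have x'x: "x' \<ominus> x \<in> J"
      using a_rcos_module_imp[OF x that] by (simp add: a_minus_def)
    show ?thesis using x x' ideal_smult[OF x'x, of c]
      by (simp add: coset_eq_iff smult_closed a_minus_def smult_r_distr smult_minus)
  qed
  moreover have "x \<in> J +> x" using x by (rule a_rcos_self)
  ultimately have "(\<Union>x'\<in>J +> x. J +> (c \<odot> x')) = J +> (c \<odot> x)" by blast
  then show ?thesis
    by (simp add: quot_alg_def ring.extend_def module.fields_def)
qed

lemma quot_proj_hom: "(\<lambda>x. J +> x) \<in> calg_hom A (quot_alg A J)"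
proof (rule calg_homI)
  fix x y assume "x \<in> carrier A" "y \<in> carrier A"
  then show "J +> (x \<oplus> y) = (J +> x) \<oplus>\<^bsub>quot_alg A J\<^esub> (J +> y)"
    "J +> (x \<otimes> y) = (J +> x) \<otimes>\<^bsub>quot_alg A J\<^esub> (J +> y)"
    by (simp_all add: quot_alg_def FactRing_def ring.extend_def module.fields_def
        a_rcos_sum rcoset_mult_add)
next
  show "J +> \<one> = \<one>\<^bsub>quot_alg A J\<^esub>"
    by (simp add: quot_alg_def FactRing_def ring.extend_def module.fields_def)
qed (simp_all add: quot_carrier quot_smult)

sublocale proj: calg_homomorphism A "quot_alg A J" "\<lambda>x. J +> x"
  by (intro calg_homomorphismI calgebra_axioms quot_calgebra quot_proj_hom)

lemma proj_eq_zero_iff: "x \<in> carrier A \<Longrightarrow> J +> x = \<zero>\<^bsub>quot_alg A J\<^esub> \<longleftrightarrow> x \<in> J"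
  using coset_eq_iff[of x \<zero>] proj.f_zero by (simp add: a_minus_def)

lemma quot_factor:
  assumes B: "calgebra B" and f: "f \<in> calg_hom A B" and J: "\<And>x. x \<in> J \<Longrightarrow> f x = \<zero>\<^bsub>B\<^esub>"
  obtains g where "g \<in> calg_hom (quot_alg A J) B" "\<And>x. x \<in> carrier A \<Longrightarrow> g (J +> x) = f x"
proof -
  interpret B: calgebra B by fact
  interpret f: calg_homomorphism A B f
    by (intro calg_homomorphismI calgebra_axioms B f)
  \<comment> \<open>Any representative will do: \<open>f\<close> vanishes on \<open>J\<close>, so
    its value depends on the coset alone.\<close>
  define g where "g X = f (SOME x. x \<in> carrier A \<and> X = J +> x)" for X
  have g: "g (J +> x) = f x" if x: "x \<in> carrier A" for x
  proof -
    let ?y = "SOME y. y \<in> carrier A \<and> J +> x = J +> y"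
    have y: "?y \<in> carrier A \<and> J +> x = J +> ?y"
      by (rule someI[of _ x]) (use x in simp)
    then have "x \<ominus> ?y \<in> J" using x coset_eq_iff by blast
    then have "f x \<ominus>\<^bsub>B\<^esub> f ?y = \<zero>\<^bsub>B\<^esub>" using x y J[of "x \<ominus> ?y"] by (simp add: f.f_diff)
    then show ?thesis using x y B.eq_of_minus_eq_zero[of "f x" "f ?y"] by (simp add: g_def)
  qed
  have "g \<in> calg_hom (quot_alg A J) B"
  proof (rule calg_homI, unfold quot_carrier)
    show "g \<one>\<^bsub>quot_alg A J\<^esub> = \<one>\<^bsub>B\<^esub>"
      using g[of \<one>] proj.f_one f.f_one by simp
  next
    fix X Y assume "X \<in> (+>) J ` carrier A" "Y \<in> (+>) J ` carrier A"
    then obtain x y where xy: "x \<in> carrier A" "y \<in> carrier A" "X = J +> x" "Y = J +> y" by blast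
    show "g (X \<oplus>\<^bsub>quot_alg A J\<^esub> Y) = g X \<oplus>\<^bsub>B\<^esub> g Y"
      using g[of "x \<oplus> y"] g[of x] g[of y] xy proj.f_add[of x y] f.f_add[of x y] by simp
    show "g (X \<otimes>\<^bsub>quot_alg A J\<^esub> Y) = g X \<otimes>\<^bsub>B\<^esub> g Y"
      using g[of "x \<otimes> y"] g[of x] g[of y] xy proj.f_mult[of x y] f.f_mult[of x y] by simp
  next
    fix X c assume "X \<in> (+>) J ` carrier A"
    then obtain x where x: "x \<in> carrier A" "X = J +> x" by blast
    show "g X \<in> carrier B" using g[of x] x by simp
    show "g (c \<odot>\<^bsub>quot_alg A J\<^esub> X) = c \<odot>\<^bsub>B\<^esub> g X"
      using g[of "c \<odot> x"] g[of x] x quot_smult[of x c] f.f_smult[of x c] smult_closed[of x c] by simp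
  qed
  with g show thesis using that by blast
qed

end

lemma (in calgebra) calgebra_idealI: "ideal J A \<Longrightarrow> calgebra_ideal A J"
  by (simp add: calgebra_ideal_def calgebra_axioms)

section \<open>Graded ideals and graded images\<close>

context calgebra
begin

lemma csubspaceI:
  assumes "V \<subseteq> carrier A" "\<zero> \<in> V" "\<And>x y. x \<in> V \<Longrightarrow> y \<in> V \<Longrightarrow> x \<oplus> y \<in> V"
    "\<And>c x. x \<in> V \<Longrightarrow> c \<odot> x \<in> V"
  shows "csubspace_of A V"
  unfolding csubspace_of_def
proof (intro conjI allI ballI)
  show "subgroup V (add_monoid A)"
  proof (rule add.subgroupI)
    show "V \<subseteq> carrier A" "V \<noteq> {}" using assms by blast+
    show "\<ominus> x \<in> V" if "x \<in> V" for x
      using assms(1) assms(4)[OF that, of "-1"] that by (auto simp: scalar_minus_one)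
  qed (rule assms(3))
qed (rule assms(4))

lemma csubspaceD:
  assumes "csubspace_of A V"
  shows "V \<subseteq> carrier A" "\<zero> \<in> V" "x \<in> V \<Longrightarrow> y \<in> V \<Longrightarrow> x \<oplus> y \<in> V" "x \<in> V \<Longrightarrow> c \<odot> x \<in> V"
    "x \<in> V \<Longrightarrow> \<ominus> x \<in> V"
proof -
  have s: "subgroup V (add_monoid A)" using assms by (simp add: csubspace_of_def)
  show "V \<subseteq> carrier A" "\<zero> \<in> V" "x \<in> V \<Longrightarrow> y \<in> V \<Longrightarrow> x \<oplus> y \<in> V"
    using subgroup.subset[OF s] subgroup.one_closed[OF s] subgroup.m_closed[OF s] by simp_all
  show "x \<in> V \<Longrightarrow> c \<odot> x \<in> V" using assms by (simp add: csubspace_of_def)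
  show "x \<in> V \<Longrightarrow> \<ominus> x \<in> V"
    using subgroup.m_inv_closed[OF s] by (simp add: a_inv_def)
qed

lemma csubspace_finsum:
  assumes V: "csubspace_of A V" and "\<And>i. i \<in> K \<Longrightarrow> f i \<in> V"
  shows "(\<Oplus>i\<in>K. f i) \<in> V"
  using assms(2)
proof (induction K rule: infinite_finite_induct)
  case (insert x F)
  then have "(\<Oplus>i\<in>insert x F. f i) = f x \<oplus> (\<Oplus>i\<in>F. f i)"
    using csubspaceD(1)[OF V] by (intro finsum_insert) auto
  with insert csubspaceD(3)[OF V] show ?case by simp
qed (simp_all add: csubspaceD(2)[OF V])

definition family_of :: "(int \<Rightarrow> 'a set) \<Rightarrow> (int \<Rightarrow> 'a) \<Rightarrow> bool" where
  "family_of G f \<longleftrightarrow> (\<forall>k. f k \<in> G k) \<and> finite {k. f k \<noteq> \<zero>}"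

definition total :: "(int \<Rightarrow> 'a) \<Rightarrow> 'a" where
  "total f = (\<Oplus>k\<in>{k. f k \<noteq> \<zero>}. f k)"

lemma total_superset:
  assumes "finite K" "{k. f k \<noteq> \<zero>} \<subseteq> K" "\<And>k. f k \<in> carrier A"
  shows "total f = (\<Oplus>k\<in>K. f k)"
  unfolding total_def using assms by (intro add.finprod_mono_neutral_cong_left) auto

lemma total_closed: "(\<And>k. f k \<in> carrier A) \<Longrightarrow> total f \<in> carrier A"
  unfolding total_def by (rule finsum_closed) auto

lemma total_add:
  assumes f: "finite {k. f k \<noteq> \<zero>}" "\<And>k. f k \<in> carrier A"
    and g: "finite {k. g k \<noteq> \<zero>}" "\<And>k. g k \<in> carrier A"
  shows "total (\<lambda>k. f k \<oplus> g k) = total f \<oplus> total g"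
proof -
  let ?K = "{k. f k \<noteq> \<zero>} \<union> {k. g k \<noteq> \<zero>}"
  have "total h = (\<Oplus>k\<in>?K. h k)" if "h \<in> {f, g, \<lambda>k. f k \<oplus> g k}" for h
    using that f g by (intro total_superset) auto
  then show ?thesis using f g by (simp add: finsum_addf Pi_iff)
qed

lemma total_smult:
  assumes f: "finite {k. f k \<noteq> \<zero>}" "\<And>k. f k \<in> carrier A"
  shows "total (\<lambda>k. c \<odot> f k) = c \<odot> total f"
proof -
  have "total (\<lambda>k. c \<odot> f k) = (\<Oplus>k\<in>{k. f k \<noteq> \<zero>}. c \<odot> f k)"
    using f by (intro total_superset) (auto simp: smult_closed smult_zero)
  then show ?thesis using f by (simp add: total_def smult_finsum Pi_iff)
qed

lemma family_of_add:
  assumes "\<And>k. csubspace_of A (G k)" "family_of G f" "family_of G g"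
  shows "family_of G (\<lambda>k. f k \<oplus> g k)"
proof -
  have "finite ({k. f k \<noteq> \<zero>} \<union> {k. g k \<noteq> \<zero>})" using assms by (simp add: family_of_def)
  then have "finite {k. f k \<oplus> g k \<noteq> \<zero>}" by (rule finite_subset[rotated]) auto
  then show ?thesis using assms csubspaceD(3) by (simp add: family_of_def)
qed

lemma family_of_smult:
  assumes "\<And>k. csubspace_of A (G k)" "family_of G f"
  shows "family_of G (\<lambda>k. c \<odot> f k)"
proof -
  have "finite {k. f k \<noteq> \<zero>}" using assms by (simp add: family_of_def)
  then have "finite {k. c \<odot> f k \<noteq> \<zero>}" by (rule finite_subset[rotated]) (auto simp: smult_zero)
  then show ?thesis using assms csubspaceD(4) by (simp add: family_of_def)
qed

lemma family_of_single:
  assumes "\<And>k. csubspace_of A (G k)" "x \<in> G m"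
  shows "family_of G (\<lambda>k. if k = m then x else \<zero>)" "total (\<lambda>k. if k = m then x else \<zero>) = x"
proof -
  have x: "x \<in> carrier A" using assms csubspaceD(1) by blast
  have "{k. (if k = m then x else \<zero>) \<noteq> \<zero>} \<subseteq> {m}" by auto
  then show "family_of G (\<lambda>k. if k = m then x else \<zero>)"
    using assms csubspaceD(2) by (auto simp: family_of_def intro: finite_subset)
  show "total (\<lambda>k. if k = m then x else \<zero>) = x"
    using x by (subst total_superset[of "{m}"]) auto
qed

lemma is_direct_sum_alt:
  "is_direct_sum A G V \<longleftrightarrow> csubspace_of A V \<and> (\<forall>k. csubspace_of A (G k) \<and> G k \<subseteq> V) \<and>
    (\<forall>x\<in>V. \<exists>!f. family_of G f \<and> x = total f)"
  unfolding is_direct_sum_def family_of_def total_def by (simp only: conj_assoc)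

text \<open>Two decompositions of one element differ by a decomposition of zero, so unique existence
  splits into existence and independence. The two halves are easier to transport separately.\<close>

lemma is_direct_sum_iff:
  "is_direct_sum A G V \<longleftrightarrow> csubspace_of A V \<and> (\<forall>k. csubspace_of A (G k) \<and> G k \<subseteq> V) \<and>
    (\<forall>x\<in>V. \<exists>f. family_of G f \<and> x = total f) \<and>
    (\<forall>f. family_of G f \<longrightarrow> total f = \<zero> \<longrightarrow> (\<forall>k. f k = \<zero>))"
proof
  assume d: "is_direct_sum A G V"
  then have sub: "csubspace_of A V" "\<And>k. csubspace_of A (G k)" "\<And>k. G k \<subseteq> V"
    and un: "\<And>x. x \<in> V \<Longrightarrow> \<exists>!f. family_of G f \<and> x = total f"
    unfolding is_direct_sum_alt by blast+
  have "f k = \<zero>" if "family_of G f" "total f = \<zero>" for f k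
  proof -
    have "family_of G (\<lambda>k. \<zero>)" "total (\<lambda>k. \<zero>) = \<zero>"
      using csubspaceD(2)[OF sub(2)] by (simp_all add: family_of_def total_def)
    then have "f = (\<lambda>k. \<zero>)" using un[OF csubspaceD(2)[OF sub(1)]] that by metis
    then show ?thesis by simp
  qed
  with sub un show "csubspace_of A V \<and> (\<forall>k. csubspace_of A (G k) \<and> G k \<subseteq> V) \<and>
    (\<forall>x\<in>V. \<exists>f. family_of G f \<and> x = total f) \<and>
    (\<forall>f. family_of G f \<longrightarrow> total f = \<zero> \<longrightarrow> (\<forall>k. f k = \<zero>))" by blast
next
  assume r: "csubspace_of A V \<and> (\<forall>k. csubspace_of A (G k) \<and> G k \<subseteq> V) \<and>
    (\<forall>x\<in>V. \<exists>f. family_of G f \<and> x = total f) \<and>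
    (\<forall>f. family_of G f \<longrightarrow> total f = \<zero> \<longrightarrow> (\<forall>k. f k = \<zero>))"
  have subG: "csubspace_of A (G k)" for k using r by blast
  have car: "f k \<in> carrier A" if "family_of G f" for f k
    using subsetD[OF csubspaceD(1)[OF subG[of k]]] that by (simp add: family_of_def)
  have fin: "finite {k. f k \<noteq> \<zero>}" if "family_of G f" for f
    using that by (simp add: family_of_def)
  have "f = g" if f: "family_of G f" and g: "family_of G g" and eq: "total f = total g" for f g
  proof
    fix k
    let ?h = "\<lambda>k. f k \<oplus> (-1) \<odot> g k"
    have fam: "family_of G ?h" using f g by (intro family_of_add family_of_smult subG)
    have "total ?h = total f \<oplus> total (\<lambda>k. (-1) \<odot> g k)"
      by (intro total_add fin car f g family_of_smult subG smult_closed)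
    also have "total (\<lambda>k. (-1) \<odot> g k) = (-1) \<odot> total g"
      by (intro total_smult fin car g)
    finally have "total ?h = \<zero>"
      using total_closed[of g] car[OF g] eq by (simp add: scalar_minus_one r_neg)
    then have "f k \<oplus> (-1) \<odot> g k = \<zero>" using r fam by blast
    then show "f k = g k"
      using car[OF f] car[OF g] by (simp add: scalar_minus_one eq_of_minus_eq_zero a_minus_def)
  qed
  then have "\<exists>!f. family_of G f \<and> x = total f" if "x \<in> V" for x
    using r that by metis
  then show "is_direct_sum A G V"
    using r unfolding is_direct_sum_alt by blast
qed

text \<open>The elements that are sums of homogeneous members of \<open>Idl S\<close> form an ideal
  themselves, because products of homogeneous elements are homogeneous. This ideal contains
  \<open>S\<close>, hence all of \<open>Idl S\<close>.\<close>

lemma genideal_graded: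
  assumes G: "graded_algebra A G" and S: "\<And>z. z \<in> S \<Longrightarrow> \<exists>k. z \<in> G k"
  shows "graded_ideal A G (Idl S)"
proof -
  from G have subG: "\<And>k. csubspace_of A (G k)"
    and GA: "\<And>x. x \<in> carrier A \<Longrightarrow> \<exists>f. family_of G f \<and> x = total f"
    and uniq: "\<And>f k. family_of G f \<Longrightarrow> total f = \<zero> \<Longrightarrow> f k = \<zero>"
    and Gmult: "\<And>y z i j. y \<in> G i \<Longrightarrow> z \<in> G j \<Longrightarrow> y \<otimes> z \<in> G (i + j)"
    unfolding graded_algebra_def is_direct_sum_iff by blast+
  have Gcar: "x \<in> carrier A" if "x \<in> G k" for x k
    using csubspaceD(1)[OF subG[of k]] that by blast
  have "S \<subseteq> carrier A" using S Gcar by blast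
  then have J: "ideal (Idl S) A" and SJ: "S \<subseteq> Idl S"
    by (simp_all add: genideal_ideal genideal_self)
  interpret J: calgebra_ideal A "Idl S" using J by (rule calgebra_idealI)
  let ?J = "\<lambda>k. Idl S \<inter> G k"
  have subI: "csubspace_of A (Idl S)"
    by (rule csubspaceI) (auto simp: J.ideal_smult J.a_subset)
  have subJ: "csubspace_of A (?J k)" for k
    by (rule csubspaceI)
      (use csubspaceD[OF subI] csubspaceD[OF subG[of k]] in \<open>simp_all add: le_infI2\<close>)
  have famJG: "family_of G f" if "family_of ?J f" for f
    using that by (simp add: family_of_def)
  define K where "K = {x. \<exists>f. family_of ?J f \<and> x = total f}"
  have carJ: "f k \<in> carrier A" if "family_of ?J f" for f k
    using that Gcar[of "f k" k] by (simp add: family_of_def)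
  have finJ: "finite {k. f k \<noteq> \<zero>}" if "family_of ?J f" for f
    using that by (simp add: family_of_def)
  have homK: "x \<in> K" if "x \<in> Idl S" "x \<in> G k" for x k
  proof -
    have "x \<in> ?J k" using that by simp
    note single = family_of_single[of ?J x k, OF subJ this]
    show ?thesis unfolding K_def using single(1) single(2)[symmetric] by blast
  qed
  have K: "csubspace_of A K"
  proof (rule csubspaceI)
    show "K \<subseteq> carrier A" unfolding K_def using total_closed carJ by blast
    show "\<zero> \<in> K" using homK[of \<zero> 0] csubspaceD(2)[OF subG] by simp
  next
    fix x y assume "x \<in> K" "y \<in> K"
    then obtain f g where fg: "family_of ?J f" "x = total f" "family_of ?J g" "y = total g"
      by (auto simp: K_def)
    then have "x \<oplus> y = total (\<lambda>k. f k \<oplus> g k)"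
      by (simp add: total_add finJ carJ)
    then show "x \<oplus> y \<in> K" using family_of_add[OF subJ fg(1,3)] by (auto simp: K_def)
  next
    fix x c assume "x \<in> K"
    then obtain f where f: "family_of ?J f" "x = total f" by (auto simp: K_def)
    then have "c \<odot> x = total (\<lambda>k. c \<odot> f k)"
      by (simp add: total_smult finJ carJ)
    then show "c \<odot> x \<in> K" using family_of_smult[OF subJ f(1)] by (auto simp: K_def)
  qed
  have "ideal K A"
  proof (rule idealI)
    show "ring A" by unfold_locales
    show "subgroup K (add_monoid A)" using K by (simp add: csubspace_of_def)
    fix x a assume "x \<in> K" and a: "a \<in> carrier A"
    then obtain f where f: "family_of ?J f" "x = total f" by (auto simp: K_def)
    obtain g where g: "family_of G g" "a = total g" using GA[OF a] by blast
    have fk: "f k \<in> Idl S" "f k \<in> G k" "f k \<in> carrier A"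
      and gk: "g k \<in> G k" "g k \<in> carrier A" for k
      using f(1) g(1) carJ[OF f(1)] Gcar[of "g k" k] by (simp_all add: family_of_def)
    have fin: "finite {k. f k \<noteq> \<zero>}" "finite {k. g k \<noteq> \<zero>}"
      using f(1) g(1) by (simp_all add: family_of_def)
    \<comment> \<open>Expanded into products of components, every summand is homogeneous and lies in
      \<open>Idl S\<close>, so \<open>homK\<close> applies to it.\<close>
    have "a \<otimes> x = (\<Oplus>k\<in>{k. f k \<noteq> \<zero>}. \<Oplus>j\<in>{k. g k \<noteq> \<zero>}. g j \<otimes> f k)"
      using fin gk(2) fk(3) unfolding g(2) f(2) total_def
      by (simp add: finsum_ldistr finsum_rdistr Pi_iff)
    also have "\<dots> \<in> K"
      by (intro csubspace_finsum[OF K] homK[OF J.I_l_closed Gmult[OF gk(1) fk(2)]] fk gk)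
    finally show "a \<otimes> x \<in> K" .
    have "x \<otimes> a = (\<Oplus>k\<in>{k. g k \<noteq> \<zero>}. \<Oplus>j\<in>{k. f k \<noteq> \<zero>}. f j \<otimes> g k)"
      using fin gk(2) fk(3) unfolding g(2) f(2) total_def
      by (simp add: finsum_ldistr finsum_rdistr Pi_iff)
    also have "\<dots> \<in> K"
      by (intro csubspace_finsum[OF K] homK[OF J.I_r_closed Gmult[OF fk(2) gk(1)]] fk gk)
    finally show "x \<otimes> a \<in> K" .
  qed
  moreover have "S \<subseteq> K" using S SJ homK by blast
  ultimately have "Idl S \<subseteq> K" by (rule genideal_minimal)
  then have "\<exists>f. family_of ?J f \<and> x = total f" if "x \<in> Idl S" for x
    using that unfolding K_def by blast
  then have "is_direct_sum A ?J (Idl S)"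
    unfolding is_direct_sum_iff using subI subJ famJG uniq by blast
  with J show ?thesis by (simp add: graded_ideal_def)
qed

end

context calg_homomorphism
begin

lemma f_total:
  assumes "finite {k. g k \<noteq> \<zero>\<^bsub>A\<^esub>}" "\<And>k. g k \<in> carrier A"
  shows "f (A.total g) = B.total (\<lambda>k. f (g k))"
proof -
  have "f (A.total g) = (\<Oplus>\<^bsub>B\<^esub>k\<in>{k. g k \<noteq> \<zero>\<^bsub>A\<^esub>}. f (g k))"
    unfolding A.total_def using assms by (intro f_finsum) auto
  also have "\<dots> = B.total (\<lambda>k. f (g k))"
    using assms by (intro B.total_superset[symmetric]) (auto simp: f_zero)
  finally show ?thesis .
qed

lemma csubspace_image:
  assumes "csubspace_of A V"
  shows "csubspace_of B (f ` V)"
proof (rule B.csubspaceI)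
  note V = A.csubspaceD[OF assms]
  show "f ` V \<subseteq> carrier B" using V(1) by auto
  show "\<zero>\<^bsub>B\<^esub> \<in> f ` V" using V(2) f_zero by force
  fix x assume "x \<in> f ` V"
  then obtain x' where x: "x' \<in> V" "x = f x'" by blast
  then show "c \<odot>\<^bsub>B\<^esub> x \<in> f ` V" for c using V(1,4) f_smult[of x' c] by (metis imageI subsetD)
  fix y assume "y \<in> f ` V"
  then obtain y' where "y' \<in> V" "y = f y'" by blast
  then show "x \<oplus>\<^bsub>B\<^esub> y \<in> f ` V" using x V(1,3) f_add[of x' y'] by (metis imageI subsetD)
qed

text \<open>Components of an image are images of components. Independence is where the kernel has to
  be graded: a relation among images lifts to an element of the kernel, whose components must then
  lie in the kernel as well.\<close>

lemma graded_image:
  assumes surj: "f ` carrier A = carrier B" and G: "graded_algebra A G"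
    and J: "graded_ideal A G (a_kernel A B f)"
  shows "graded_algebra B (\<lambda>k. f ` G k)"
  unfolding graded_algebra_def B.is_direct_sum_iff
proof (intro conjI allI ballI impI)
  from G have subG: "\<And>k. csubspace_of A (G k)" and GA: "\<And>x. x \<in> carrier A \<Longrightarrow> \<exists>g. A.family_of G g \<and> x = A.total g"
    and uniq: "\<And>g k. A.family_of G g \<Longrightarrow> A.total g = \<zero>\<^bsub>A\<^esub> \<Longrightarrow> g k = \<zero>\<^bsub>A\<^esub>"
    and Gmult: "\<And>y z i j. y \<in> G i \<Longrightarrow> z \<in> G j \<Longrightarrow> y \<otimes>\<^bsub>A\<^esub> z \<in> G (i + j)"
    unfolding graded_algebra_def A.is_direct_sum_iff by blast+
  have car: "x \<in> carrier A" if "x \<in> G k" for x k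
    using A.csubspaceD(1)[OF subG[of k]] that by blast
  show "calgebra B" by unfold_locales
  show "csubspace_of B (carrier B)"
    by (rule B.csubspaceI) (simp_all add: B.smult_closed)
  show "csubspace_of B (f ` G k)" for k by (rule csubspace_image[OF subG])
  show "f ` G k \<subseteq> carrier B" for k using car by auto
  show "x \<otimes>\<^bsub>B\<^esub> y \<in> f ` G (j + k)" if "x \<in> f ` G j" "y \<in> f ` G k" for x y j k
  proof -
    from that obtain x' y' where "x' \<in> G j" "x = f x'" "y' \<in> G k" "y = f y'" by blast
    then show ?thesis using f_mult[of x' y'] car Gmult[of x' j y' k] by (metis imageI)
  qed
  show "\<exists>h. B.family_of (\<lambda>k. f ` G k) h \<and> x = B.total h" if "x \<in> carrier B" for x
  proof -
    from that have "x \<in> f ` carrier A" unfolding surj .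
    then obtain x' where x': "x' \<in> carrier A" "x = f x'" by blast
    obtain g where g: "A.family_of G g" "x' = A.total g" using GA[OF x'(1)] by blast
    have fin: "finite {k. g k \<noteq> \<zero>\<^bsub>A\<^esub>}" and gk: "g k \<in> G k" for k
      using g(1) by (simp_all add: A.family_of_def)
    from fin have "finite {k. f (g k) \<noteq> \<zero>\<^bsub>B\<^esub>}"
      by (rule finite_subset[rotated]) (auto simp: f_zero)
    then have "B.family_of (\<lambda>k. f ` G k) (\<lambda>k. f (g k))"
      using gk by (simp add: B.family_of_def)
    moreover have "f x' = B.total (\<lambda>k. f (g k))"
      unfolding g(2) by (intro f_total fin car[OF gk])
    ultimately show ?thesis using x'(2) by blast
  qed
  show "h k = \<zero>\<^bsub>B\<^esub>" if h: "B.family_of (\<lambda>k. f ` G k) h" "B.total h = \<zero>\<^bsub>B\<^esub>" for h k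
  proof -
    have hk: "h k \<in> f ` G k" and fin: "finite {k. h k \<noteq> \<zero>\<^bsub>B\<^esub>}" for k
      using h(1) by (simp_all add: B.family_of_def)
    \<comment> \<open>Zero is lifted to zero, which keeps the support of the lifted family
      finite.\<close>
    define g where "g k = (if h k = \<zero>\<^bsub>B\<^esub> then \<zero>\<^bsub>A\<^esub> else SOME y. y \<in> G k \<and> h k = f y)" for k
    have g: "g k \<in> G k \<and> h k = f (g k)" for k
    proof (cases "h k = \<zero>\<^bsub>B\<^esub>")
      case False
      then show ?thesis using someI_ex[of "\<lambda>y. y \<in> G k \<and> h k = f y"] hk[of k] by (auto simp: g_def)
    qed (simp add: g_def f_zero A.csubspaceD(2)[OF subG])
    then have gc: "g k \<in> carrier A" for k using car by blast
    from fin have fin: "finite {k. g k \<noteq> \<zero>\<^bsub>A\<^esub>}"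
      by (rule finite_subset[rotated]) (auto simp: g_def)
    with g have fam: "A.family_of G g" by (simp add: A.family_of_def)
    have "h = (\<lambda>k. f (g k))" using g by blast
    then have "f (A.total g) = B.total h"
      using f_total[OF fin gc] by simp
    then have "A.total g \<in> a_kernel A B f"
      using h(2) A.total_closed[OF gc] by (simp add: mem_kernel)
    \<comment> \<open>The components \<open>j\<close> taken inside the kernel also form a
      decomposition with respect to \<open>G\<close>, so uniqueness identifies them with
      \<open>g\<close>.\<close>
    then obtain j where j: "A.family_of (\<lambda>k. a_kernel A B f \<inter> G k) j" "A.total g = A.total j"
      using J unfolding graded_ideal_def A.is_direct_sum_iff by blast
    have "\<forall>x\<in>carrier A. \<exists>!f'. A.family_of G f' \<and> x = A.total f'"
      using G unfolding graded_algebra_def A.is_direct_sum_alt by (elim conjE)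
    then have "\<exists>!f'. A.family_of G f' \<and> A.total g = A.total f'"
      using A.total_closed[OF gc] by (rule bspec)
    moreover have "A.family_of G j" using j by (simp add: A.family_of_def)
    ultimately have "g = j" using fam j(2) by blast
    then have "g k \<in> a_kernel A B f" using j(1) by (simp add: A.family_of_def)
    then show ?thesis using g[of k] by (simp add: mem_kernel)
  qed
qed

end

section \<open>Algebras given by generators and relations\<close>

lemma free_alg_closed [simp, intro]:
  "0 \<in> carrier (free_alg X)" "1 \<in> carrier (free_alg X)" "ncconst c \<in> carrier (free_alg X)"
  "i \<in> X \<Longrightarrow> ncvar i \<in> carrier (free_alg X)"
  "p \<in> carrier (free_alg X) \<Longrightarrow> r \<in> carrier (free_alg X) \<Longrightarrow> p + r \<in> carrier (free_alg X)"
  "p \<in> carrier (free_alg X) \<Longrightarrow> r \<in> carrier (free_alg X) \<Longrightarrow> p * r \<in> carrier (free_alg X)"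
  "p \<in> carrier (free_alg X) \<Longrightarrow> r \<in> carrier (free_alg X) \<Longrightarrow> p - r \<in> carrier (free_alg X)"
proof -
  interpret F: calgebra "free_alg X" by (rule calgebra_free_alg)
  show "0 \<in> carrier (free_alg X)" using F.zero_closed by simp
  show one: "1 \<in> carrier (free_alg X)" using F.one_closed by simp
  show "ncconst c \<in> carrier (free_alg X)" using F.smult_closed[OF F.one_closed, of c] by simp
  show "ncvar i \<in> carrier (free_alg X)" if "i \<in> X"
    using that by (simp add: free_alg_def ncvar_def)
  fix p r assume p: "p \<in> carrier (free_alg X)" and r: "r \<in> carrier (free_alg X)"
  show "p + r \<in> carrier (free_alg X)" using F.a_closed[OF p r] by simp
  show "p * r \<in> carrier (free_alg X)" using F.m_closed[OF p r] by simp
  have "- r = ncconst (-1) * r"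
    by (simp add: ncconst_def single_uminus)
  then have "- r \<in> carrier (free_alg X)" using F.smult_closed[OF r, of "-1"] by simp
  then show "p - r \<in> carrier (free_alg X)" using F.a_closed[OF p] by force
qed

lemma free_alg_single: "set w \<subseteq> X \<Longrightarrow> Poly_Mapping.single (Fmon w) c \<in> carrier (free_alg X)"
  by (simp add: free_alg_def)

lemma free_alg_induct [consumes 1, case_names zero single add]:
  assumes p: "p \<in> carrier (free_alg X)"
    and "P 0" "\<And>w c. set w \<subseteq> X \<Longrightarrow> P (Poly_Mapping.single (Fmon w) c)"
    and "\<And>p r. p \<in> carrier (free_alg X) \<Longrightarrow> r \<in> carrier (free_alg X) \<Longrightarrow> P p \<Longrightarrow> P r \<Longrightarrow> P (p + r)"
  shows "P p"
  using p
proof (induction p rule: update_induct)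
  case const
  then show ?case using assms(2) by simp
next
  case (update f k v)
  then have eq: "Poly_Mapping.update k v f = f + Poly_Mapping.single k v"
    by (intro poly_mapping_eqI)
      (auto simp: lookup_update lookup_add lookup_single in_keys_iff when_def)
  have keys: "Poly_Mapping.keys (Poly_Mapping.update k v f) = insert k (Poly_Mapping.keys f)"
    using update by (auto simp: keys_update)
  have f: "f \<in> carrier (free_alg X)" and k: "set (letters k) \<subseteq> X"
    using update.prems keys by (auto simp: free_alg_def)
  from k have "P (Poly_Mapping.single k v)" "Poly_Mapping.single k v \<in> carrier (free_alg X)"
    using assms(3)[of "letters k"] free_alg_single[of "letters k" X v] by simp_all
  then show ?case unfolding eq using assms(4) f update.IH by blast
qed

lemma (in calgebra_assignment) ncev_hom: "ncev \<sigma> \<in> calg_hom (free_alg X) A"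
  by (rule calg_homI) (simp_all add: ncev_simps smult_mult_left)

locale presentation =
  fixes X :: "nat set" and R :: "ncpoly set"
  assumes rels: "R \<subseteq> carrier (free_alg X)"
begin

sublocale F: calgebra "free_alg X" by (rule calgebra_free_alg)

sublocale F: calgebra_ideal "free_alg X" "Idl\<^bsub>free_alg X\<^esub> R"
  by (intro F.calgebra_idealI F.genideal_ideal rels)

abbreviation PA where "PA \<equiv> presented_alg X R"
abbreviation gen where "gen \<equiv> presented_gen X R"
abbreviation cls where "cls p \<equiv> (Idl\<^bsub>free_alg X\<^esub> R) +>\<^bsub>free_alg X\<^esub> p"

lemma PA_quot: "PA = quot_alg (free_alg X) (Idl\<^bsub>free_alg X\<^esub> R)"
  by (simp add: presented_alg_def)

sublocale PA: calgebra "presented_alg X R"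
  unfolding PA_quot by (rule F.quot_calgebra)

lemma gen_closed: "i \<in> X \<Longrightarrow> gen i \<in> carrier PA"
  unfolding PA_quot presented_gen_def by (simp add: F.quot_carrier)

text \<open>The kernel of evaluation is an ideal containing the relations, hence it contains the
  ideal they generate, and evaluation descends to the quotient.\<close>

lemma presented_universal:
  assumes B: "calgebra B" and \<sigma>: "\<And>i. \<sigma> i \<in> carrier B"
    and R: "\<And>r. r \<in> R \<Longrightarrow> calgebra.ncev B \<sigma> r = \<zero>\<^bsub>B\<^esub>"
  obtains f where "f \<in> calg_hom PA B" "\<And>i. i \<in> X \<Longrightarrow> f (gen i) = \<sigma> i"
proof -
  interpret B: calgebra_assignment B \<sigma>
    using B \<sigma> by (simp add: calgebra_assignment_def calgebra_assignment_axioms_def)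
  interpret ev: calg_homomorphism "free_alg X" B "B.ncev \<sigma>"
    by (intro calg_homomorphismI F.calgebra_axioms B B.ncev_hom)
  have "Idl\<^bsub>free_alg X\<^esub> R \<subseteq> a_kernel (free_alg X) B (B.ncev \<sigma>)"
    using rels R by (intro F.genideal_minimal ev.kernel_ideal) (auto simp: ev.mem_kernel)
  then obtain g where "g \<in> calg_hom PA B"
    "\<And>p. p \<in> carrier (free_alg X) \<Longrightarrow> g (cls p) = B.ncev \<sigma> p"
    using F.quot_factor[OF B B.ncev_hom] unfolding PA_quot
    by (metis (no_types, lifting) ev.mem_kernel subsetD)
  then show thesis using that by (simp add: presented_gen_def)
qed

lemma cls_single_append:
  "set w \<subseteq> X \<Longrightarrow> i \<in> X \<Longrightarrow> cls (Poly_Mapping.single (Fmon (w @ [i])) c) =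
    cls (Poly_Mapping.single (Fmon w) c) \<otimes>\<^bsub>PA\<^esub> gen i"
  using F.proj.f_mult[of "Poly_Mapping.single (Fmon w) c" "ncvar i"]
  by (simp add: free_alg_single PA_quot presented_gen_def ncvar_def mult_single
      plus_free_monoid_def)

lemma cls_const: "cls (Poly_Mapping.single (Fmon []) c) = c \<odot>\<^bsub>PA\<^esub> \<one>\<^bsub>PA\<^esub>"
  using F.proj.f_smult[of 1 c] F.proj.f_one
  by (simp add: PA_quot ncconst_def zero_free_monoid_def)

text \<open>Every class is a linear combination of words, and a word is built from the unit by
  appending generators on the right.\<close>

lemma presented_induct [consumes 1, case_names one smult add mult]:
  assumes x: "x \<in> carrier PA"
    and one: "P \<one>\<^bsub>PA\<^esub>"
    and smult: "\<And>c x. x \<in> carrier PA \<Longrightarrow> P x \<Longrightarrow> P (c \<odot>\<^bsub>PA\<^esub> x)"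
    and add: "\<And>x y. x \<in> carrier PA \<Longrightarrow> y \<in> carrier PA \<Longrightarrow> P x \<Longrightarrow> P y \<Longrightarrow> P (x \<oplus>\<^bsub>PA\<^esub> y)"
    and mult: "\<And>x i. x \<in> carrier PA \<Longrightarrow> i \<in> X \<Longrightarrow> P x \<Longrightarrow> P (x \<otimes>\<^bsub>PA\<^esub> gen i)"
  shows "P x"
proof -
  from x obtain p where p: "p \<in> carrier (free_alg X)" "x = cls p"
    by (auto simp: PA_quot F.quot_carrier)
  have cls_closed: "cls p \<in> carrier PA" if "p \<in> carrier (free_alg X)" for p
    using that by (simp add: PA_quot)
  have "P (cls p)"
    using p(1)
  proof (induction p rule: free_alg_induct)
    case zero
    have "cls 0 = 0 \<odot>\<^bsub>PA\<^esub> \<one>\<^bsub>PA\<^esub>"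
      using F.proj.f_zero by (simp add: PA.scalar_zero) (simp add: PA_quot)
    then show ?case using smult[OF _ one] by simp
  next
    case (single w c)
    then show ?case
    proof (induction w rule: rev_induct)
      case Nil
      show ?case unfolding cls_const by (rule smult) (simp_all add: one)
    next
      case (snoc i w)
      then show ?case
        using mult[of "cls (Poly_Mapping.single (Fmon w) c)" i]
        by (simp add: cls_single_append cls_closed free_alg_single)
    qed
  next
    case (add p r)
    then show ?case
      using assms(4)[of "cls p" "cls r"] F.proj.f_add[of p r] cls_closed
      by (simp add: PA_quot)
  qed
  with p show ?thesis by simp
qed

text \<open>Evaluating at the classes of the generators is the same as projecting to the quotient,
  and a relation projects to zero. Relations between polynomials thereby become equations in the
  presented algebra.\<close>

lemma presented_rel:
  assumes \<sigma>: "\<And>i. \<sigma> i \<in> carrier PA" "\<And>i. i \<in> X \<Longrightarrow> \<sigma> i = gen i" and r: "r \<in> R"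
  shows "PA.ncev \<sigma> r = \<zero>\<^bsub>PA\<^esub>"
proof -
  interpret ev: calgebra_assignment PA \<sigma>
    using \<sigma> by unfold_locales
  have "PA.ncev \<sigma> p = cls p" if "p \<in> carrier (free_alg X)" for p
    using that
  proof (induction p rule: free_alg_induct)
    case zero
    then show ?case using F.proj.f_zero by simp (simp add: PA_quot)
  next
    case (single w c)
    then show ?case
    proof (induction w rule: rev_induct)
      case Nil
      then show ?case unfolding cls_const by (simp add: ev.ncev_single PA.monomial_def)
    next
      case (snoc i w)
      then have "PA.monomial \<sigma> [i] = gen i"
        using \<sigma>(2)[of i] gen_closed[of i] by (simp add: PA.monomial_def)
      with snoc show ?case
        using PA.smult_mult_left[of "PA.monomial \<sigma> w" "gen i" c] gen_closed[of i]
        by (simp add: cls_single_append ev.ncev_single ev.monomial_append)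
    qed
  next
    case (add p r)
    then show ?case
      using F.proj.f_add[of p r, folded PA_quot] by (simp add: ev.ncev_add)
  qed
  then have "PA.ncev \<sigma> r = cls r" using r rels by blast
  also have "\<dots> = \<zero>\<^bsub>PA\<^esub>"
    using F.genideal_self[OF rels] r rels F.proj_eq_zero_iff[of r] by (auto simp: PA_quot)
  finally show ?thesis .
qed

lemma presented_hom_eqI:
  assumes B: "calgebra B" and f: "f \<in> calg_hom PA B" and g: "g \<in> calg_hom PA B"
    and eq: "\<And>i. i \<in> X \<Longrightarrow> f (gen i) = g (gen i)" and x: "x \<in> carrier PA"
  shows "f x = g x"
proof -
  interpret f: calg_homomorphism PA B f
    by (intro calg_homomorphismI PA.calgebra_axioms B f)
  interpret g: calg_homomorphism PA B g
    by (intro calg_homomorphismI PA.calgebra_axioms B g)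
  show ?thesis using x
    by (induction x rule: presented_induct)
      (simp_all add: f.f_simps g.f_simps eq gen_closed)
qed

end

section \<open>Hecke and Temperley-Lieb relations, and the substitutions between them\<close>

lemma ncconst_diff: "ncconst (c - d) = ncconst c - ncconst d"
  by (simp add: ncconst_def single_diff)

lemma ncvar_const_comm:
  "ncvar i * ncconst c = ncconst c * ncvar i"
  "ncvar i * (ncconst c * p) = ncconst c * (ncvar i * p)"
  by (metis ncconst_central) (metis ncconst_central mult.assoc)

lemma hecke_rels_mem:
  "i \<in> {1..<n} \<Longrightarrow> (ncvar i - ncconst t) * (ncvar i + 1) \<in> hecke_rels n t"
  "i \<in> {1..<n} \<Longrightarrow> i + 1 \<in> {1..<n} \<Longrightarrow>
    ncvar i * ncvar (i + 1) * ncvar i - ncvar (i + 1) * ncvar i * ncvar (i + 1) \<in> hecke_rels n t"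
  "i \<in> {1..<n} \<Longrightarrow> j \<in> {1..<n} \<Longrightarrow> j > i + 1 \<or> i > j + 1 \<Longrightarrow>
    ncvar i * ncvar j - ncvar j * ncvar i \<in> hecke_rels n t"
  unfolding hecke_rels_def by blast+

lemma tl_rels_mem:
  "i \<in> {1..<n} \<Longrightarrow> ncvar i * ncvar i + ncconst (q + inverse q) * ncvar i \<in> tl_rels n q"
  "i \<in> {1..<n} \<Longrightarrow> j \<in> {1..<n} \<Longrightarrow> j = i + 1 \<or> i = j + 1 \<Longrightarrow>
    ncvar i * ncvar j * ncvar i - ncvar i \<in> tl_rels n q"
  "i \<in> {1..<n} \<Longrightarrow> j \<in> {1..<n} \<Longrightarrow> j > i + 1 \<or> i > j + 1 \<Longrightarrow>
    ncvar i * ncvar j - ncvar j * ncvar i \<in> tl_rels n q"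
  unfolding tl_rels_def by blast+

text \<open>Hides the cosets of the presentation behind the relations, the quadratic one solved for
  the square, and behind generation in the form of an induction principle.\<close>

locale hecke = calgebra A for A :: "(complex, 'a) module" (structure) +
  fixes n :: nat and t :: complex and T :: "nat \<Rightarrow> 'a"
  assumes T_closed [simp]: "i \<in> {1..<n} \<Longrightarrow> T i \<in> carrier A"
    and quad: "i \<in> {1..<n} \<Longrightarrow> T i \<otimes> T i = (t - 1) \<odot> T i \<oplus> t \<odot> \<one>"
    and braid: "i \<in> {1..<n} \<Longrightarrow> i + 1 \<in> {1..<n} \<Longrightarrow>
      T i \<otimes> T (i + 1) \<otimes> T i = T (i + 1) \<otimes> T i \<otimes> T (i + 1)"
    and far_comm: "i \<in> {1..<n} \<Longrightarrow> j \<in> {1..<n} \<Longrightarrow> j > i + 1 \<or> i > j + 1 \<Longrightarrow> T i \<otimes> T j = T j \<otimes> T i"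
    and generated: "x \<in> carrier A \<Longrightarrow> P \<one> \<Longrightarrow>
      (\<And>c x. x \<in> carrier A \<Longrightarrow> P x \<Longrightarrow> P (c \<odot> x)) \<Longrightarrow>
      (\<And>x y. x \<in> carrier A \<Longrightarrow> y \<in> carrier A \<Longrightarrow> P x \<Longrightarrow> P y \<Longrightarrow> P (x \<oplus> y)) \<Longrightarrow>
      (\<And>x i. x \<in> carrier A \<Longrightarrow> i \<in> {1..<n} \<Longrightarrow> P x \<Longrightarrow> P (x \<otimes> T i)) \<Longrightarrow> P x"

locale hecke_presentation =
  fixes n :: nat and t :: complex
begin

sublocale presentation "{1..<n}" "hecke_rels n t"
  by unfold_locales (auto simp: hecke_rels_def)

lemma PA_eq: "PA = hecke_alg n t"
  by (simp add: hecke_alg_def)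

lemma gen_eq: "gen = hecke_T n t"
  by (simp add: hecke_T_def)

sublocale hecke "hecke_alg n t" n t "hecke_T n t"
proof -
  define \<sigma> where "\<sigma> i = (if i \<in> {1..<n} then gen i else \<zero>\<^bsub>PA\<^esub>)" for i
  have \<sigma>: "\<sigma> i \<in> carrier PA" "i \<in> {1..<n} \<Longrightarrow> \<sigma> i = gen i" for i
    by (simp_all add: \<sigma>_def gen_closed del: One_nat_def)
  interpret ev: calgebra_assignment PA \<sigma> using \<sigma> by unfold_locales
  have rel: "PA.ncev \<sigma> r = \<zero>\<^bsub>PA\<^esub>" if "r \<in> hecke_rels n t" for r
    by (rule presented_rel[OF \<sigma>(1) \<sigma>(2) that])
  have "hecke PA n t gen"
  proof (unfold_locales, goal_cases)
    case (1 i)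
    then show ?case by (rule gen_closed)
  next
    case (2 i)
    \<comment> \<open>The square is written as the relation plus the desired right side, so that
      evaluation removes the relation.\<close>
    have "ncvar i * ncvar i = (ncvar i - ncconst t) * (ncvar i + 1)
        + ncconst (t - 1) * ncvar i + ncconst t"
      by (simp add: ncconst_diff ncconst_simps algebra_simps)
    then have "PA.ncev \<sigma> (ncvar i * ncvar i) = PA.ncev \<sigma> ((ncvar i - ncconst t) * (ncvar i + 1)
        + ncconst (t - 1) * ncvar i + ncconst t)" by simp
    also have "\<dots> = PA.ncev \<sigma> (ncconst (t - 1) * ncvar i) \<oplus>\<^bsub>PA\<^esub> PA.ncev \<sigma> (ncconst t)"
      unfolding ev.ncev_add using rel[OF hecke_rels_mem(1)[OF 2]]
      by (simp del: One_nat_def)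
    finally show ?case using 2 \<sigma>(2)[of i] gen_closed[of i]
      by (simp add: ev.ncev_simps PA.smult_mult_left del: One_nat_def)
  next
    case (3 i)
    have "PA.ncev \<sigma> (ncvar i * ncvar (i + 1) * ncvar i -
        ncvar (i + 1) * ncvar i * ncvar (i + 1)) = \<zero>\<^bsub>PA\<^esub>"
      using 3 by (intro rel hecke_rels_mem(2))
    then have "PA.ncev \<sigma> (ncvar i * ncvar (i + 1) * ncvar i) =
        PA.ncev \<sigma> (ncvar (i + 1) * ncvar i * ncvar (i + 1))"
      unfolding ev.ncev_diff by (rule PA.eq_of_minus_eq_zero[OF ev.ncev_closed ev.ncev_closed])
    then show ?case using 3 \<sigma>(2)[of i] \<sigma>(2)[of "i + 1"]
      by (simp add: ev.ncev_simps del: One_nat_def)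
  next
    case (4 i j)
    have "PA.ncev \<sigma> (ncvar i * ncvar j - ncvar j * ncvar i) = \<zero>\<^bsub>PA\<^esub>"
      using 4 by (intro rel hecke_rels_mem(3))
    then have "PA.ncev \<sigma> (ncvar i * ncvar j) = PA.ncev \<sigma> (ncvar j * ncvar i)"
      unfolding ev.ncev_diff by (rule PA.eq_of_minus_eq_zero[OF ev.ncev_closed ev.ncev_closed])
    then show ?case using 4 \<sigma>(2)[of i] \<sigma>(2)[of j]
      by (simp add: ev.ncev_simps del: One_nat_def)
  next
    case (5 x P)
    then show ?case by (rule presented_induct)
  qed
  then show "hecke (hecke_alg n t) n t (hecke_T n t)" by (simp only: PA_eq gen_eq)
qed

end

locale tl_presentation =
  fixes n :: nat and q :: complex
begin

sublocale presentation "{1..<n}" "tl_rels n q"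
  by unfold_locales (auto simp: tl_rels_def)

lemma PA_eq: "PA = tl_alg n q"
  by (simp add: tl_alg_def)

lemma gen_eq: "gen = tl_U n q"
  by (simp add: tl_U_def)

end

text \<open>\<open>Q\<close> and \<open>Qi\<close> stand for the central elements \<open>q \<cdot> 1\<close> and \<open>q\<^sup>-\<^sup>1 \<cdot> 1\<close> of the free algebra.  Each right
  side is a combination of relations of the target algebra.\<close>

lemma hecke_quad_in_tl:
  fixes u Q Qi :: "'a :: ring_1"
  assumes "u * Q = Q * u" "u * Qi = Qi * u" "Q * Qi = 1" "Qi * Q = 1"
  shows "(- (Q * u) - 1 - Q * Q) * (- (Q * u) - 1 + 1) = Q * Q * (u * u + (Q + Qi) * u)"
proof -
  have "u * (Q * z) = Q * (u * z)" "u * (Qi * z) = Qi * (u * z)" "Q * (Qi * z) = z" "Qi * (Q * z) = z"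
    for z using assms by (metis mult.assoc mult_1)+
  with assms show ?thesis by (simp add: algebra_simps)
qed

lemma hecke_braid_in_tl:
  fixes u v Q Qi :: "'a :: ring_1"
  assumes "u * Q = Q * u" "u * Qi = Qi * u" "v * Q = Q * v" "v * Qi = Qi * v" "Q * Qi = 1" "Qi * Q = 1"
  shows "(- (Q * u) - 1) * (- (Q * v) - 1) * (- (Q * u) - 1)
      - (- (Q * v) - 1) * (- (Q * u) - 1) * (- (Q * v) - 1) =
    Q * Q * Q * ((v * u * v - v) - (u * v * u - u))
      + Q * Q * ((v * v + (Q + Qi) * v) - (u * u + (Q + Qi) * u))"
proof -
  have "u * (Q * z) = Q * (u * z)" "u * (Qi * z) = Qi * (u * z)" "Q * (Qi * z) = z" "Qi * (Q * z) = z"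
    "v * (Q * z) = Q * (v * z)" "v * (Qi * z) = Qi * (v * z)"
    for z using assms by (metis mult.assoc mult_1)+
  with assms show ?thesis by (simp add: algebra_simps)
qed

lemma hecke_comm_in_tl:
  fixes u v Q :: "'a :: ring_1"
  assumes "u * Q = Q * u" "v * Q = Q * v"
  shows "(- (Q * u) - 1) * (- (Q * v) - 1) - (- (Q * v) - 1) * (- (Q * u) - 1) =
    Q * Q * (u * v - v * u)"
proof -
  have "u * (Q * z) = Q * (u * z)" "v * (Q * z) = Q * (v * z)"
    for z using assms by (metis mult.assoc)+
  with assms show ?thesis by (simp add: algebra_simps)
qed

lemma hecke_sym3_in_tl:
  fixes u v Q Qi :: "'a :: ring_1"
  assumes "u * Q = Q * u" "u * Qi = Qi * u" "v * Q = Q * v" "v * Qi = Qi * v" "Q * Qi = 1" "Qi * Q = 1"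
  shows "(- (Q * u) - 1) * (- (Q * v) - 1) * (- (Q * u) - 1) + (- (Q * u) - 1) * (- (Q * v) - 1)
      + (- (Q * v) - 1) * (- (Q * u) - 1) + (- (Q * u) - 1) + (- (Q * v) - 1) + 1 =
    - (Q * Q * Q * (u * v * u - u)) - Q * Q * (u * u + (Q + Qi) * u)"
proof -
  have "u * (Q * z) = Q * (u * z)" "u * (Qi * z) = Qi * (u * z)" "Q * (Qi * z) = z" "Qi * (Q * z) = z"
    "v * (Q * z) = Q * (v * z)" "v * (Qi * z) = Qi * (v * z)"
    for z using assms by (metis mult.assoc mult_1)+
  with assms show ?thesis by (simp add: algebra_simps)
qed

lemma tl_quad_in_hecke:
  fixes a Q Qi :: "'a :: ring_1"
  assumes "a * Q = Q * a" "a * Qi = Qi * a" "Q * Qi = 1" "Qi * Q = 1"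
  shows "(- (Qi * (a + 1))) * (- (Qi * (a + 1))) + (Q + Qi) * (- (Qi * (a + 1))) =
    Qi * Qi * ((a - Q * Q) * (a + 1))"
proof -
  have "a * (Q * z) = Q * (a * z)" "a * (Qi * z) = Qi * (a * z)" "Q * (Qi * z) = z" "Qi * (Q * z) = z"
    for z using assms by (metis mult.assoc mult_1)+
  with assms show ?thesis by (simp add: algebra_simps)
qed

text \<open>The first bracket is the sum of the \<open>T_w\<close> over the symmetric group on three
  letters. Read in the Hecke algebra, the cubic Temperley-Lieb relation is this sum up to a unit and
  a quadratic relation; this is where the generator of the kernel comes from.\<close>

lemma tl_cubic_in_hecke:
  fixes a b Q Qi :: "'a :: ring_1"
  assumes "a * Q = Q * a" "a * Qi = Qi * a" "b * Q = Q * b" "b * Qi = Qi * b" "Q * Qi = 1" "Qi * Q = 1"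
  shows "(- (Qi * (a + 1))) * (- (Qi * (b + 1))) * (- (Qi * (a + 1))) - (- (Qi * (a + 1))) =
    - (Qi * Qi * Qi * ((a * b * a + a * b + b * a + a + b + 1) + (a - Q * Q) * (a + 1)))"
proof -
  have "a * (Q * z) = Q * (a * z)" "a * (Qi * z) = Qi * (a * z)" "Q * (Qi * z) = z" "Qi * (Q * z) = z"
    "b * (Q * z) = Q * (b * z)" "b * (Qi * z) = Qi * (b * z)"
    for z using assms by (metis mult.assoc mult_1)+
  with assms show ?thesis by (simp add: algebra_simps)
qed

lemma tl_comm_in_hecke:
  fixes a b Qi :: "'a :: ring_1"
  assumes "a * Qi = Qi * a" "b * Qi = Qi * b"
  shows "(- (Qi * (a + 1))) * (- (Qi * (b + 1))) - (- (Qi * (b + 1))) * (- (Qi * (a + 1))) =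
    Qi * Qi * (a * b - b * a)"
proof -
  have "a * (Qi * z) = Qi * (a * z)" "b * (Qi * z) = Qi * (b * z)"
    for z using assms by (metis mult.assoc)+
  with assms show ?thesis by (simp add: algebra_simps)
qed

section \<open>The kernel of the homomorphism to the Temperley--Lieb algebra\<close>

context calg_homomorphism
begin

lemma f_ncev:
  assumes "\<And>i. \<sigma> i \<in> carrier A"
  shows "f (A.ncev \<sigma> p) = B.ncev (\<lambda>i. f (\<sigma> i)) p"
proof -
  interpret a: calgebra_assignment A \<sigma> using assms by unfold_locales
  interpret b: calgebra_assignment B "\<lambda>i. f (\<sigma> i)" using assms by unfold_locales simp
  have "f (A.monomial \<sigma> w) = B.monomial (\<lambda>i. f (\<sigma> i)) w" for w
    by (induction w) (simp_all add: A.monomial_def[of _ "_ # _"] A.monomial_def[of _ "[]"]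
      B.monomial_def[of _ "_ # _"] B.monomial_def[of _ "[]"] f_simps
      flip: A.monomial_def B.monomial_def)
  then show ?thesis
    by (induction p rule: ncpoly_induct)
      (simp_all add: f_zero a.ncev_single b.ncev_single f_smult f_add a.ncev_add b.ncev_add)
qed

end

section \<open>The symmetrizer on three letters\<close>

context hecke
begin

text \<open>For adjacent \<open>i\<close> and \<open>j\<close> this is the sum of \<open>T_w\<close>
  over the group generated by the two transpositions; \<open>sym3 1 2\<close> is the x of the
  overview.\<close>

definition sym3 :: "nat \<Rightarrow> nat \<Rightarrow> 'a" where
  "sym3 i j = T i \<otimes> T j \<otimes> T i \<oplus> T i \<otimes> T j \<oplus> T j \<otimes> T i \<oplus> T i \<oplus> T j \<oplus> \<one>"

lemma sym3_closed [simp]: "i \<in> {1..<n} \<Longrightarrow> j \<in> {1..<n} \<Longrightarrow> sym3 i j \<in> carrier A"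
  by (simp add: sym3_def del: atLeastLessThan_iff)

lemma sym3_commute:
  assumes "i \<in> {1..<n}" "i + 1 \<in> {1..<n}"
  shows "sym3 (i + 1) i = sym3 i (i + 1)"
  using assms T_closed[OF assms(1)] T_closed[OF assms(2)] braid[OF assms]
  by (simp add: sym3_def a_ac)

lemma T_inverse:
  assumes "t \<noteq> 0" and i: "i \<in> {1..<n}"
  shows "T i \<otimes> (inverse t \<odot> (T i \<ominus> (t - 1) \<odot> \<one>)) = \<one>"
proof -
  have "T i \<otimes> (T i \<ominus> (t - 1) \<odot> \<one>) = t \<odot> \<one>"
    using T_closed[OF i] quad[OF i]
    by (simp add: a_minus_def r_distr r_minus smult_closed smult_mult_right a_ac r_neg r_neg2)
  with assms T_closed[OF i] show ?thesis
    by (simp add: smult_mult_right smult_closed smult_one flip: smult_assoc)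
qed

text \<open>Conjugation by \<open>T\<^sub>i T\<^sub>i\<^sub>+\<^sub>1 T\<^sub>i\<^sub>+\<^sub>2\<close> shifts the indices by one.\<close>

lemma sym3_in_ideal:
  assumes J: "ideal J A" and t: "t \<noteq> 0" and base: "3 \<le> n \<Longrightarrow> sym3 1 2 \<in> J"
    and "1 \<le> i" "i + 1 < n"
  shows "sym3 i (i + 1) \<in> J"
  using assms(4,5)
proof (induction i rule: nat_induct_at_least)
  case base
  then show ?case using assms(3) by (simp add: numeral_2_eq_2)
next
  case (Suc i)
  interpret J: ideal J A by fact
  have i: "i \<in> {1..<n}" "i + 1 \<in> {1..<n}" "i + 2 \<in> {1..<n}" using Suc by auto
  define a b c where abc: "a = T i" "b = T (i + 1)" "c = T (i + 2)"
  have [simp]: "a \<in> carrier A" "b \<in> carrier A" "c \<in> carrier A"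
    unfolding abc by (rule T_closed, rule i)+
  have ab: "a \<otimes> (b \<otimes> a) = b \<otimes> (a \<otimes> b)"
    using braid[OF i(1,2), folded abc] by (simp add: m_assoc)
  have i2: "i + 1 + 1 = i + 2" by simp
  have bc: "b \<otimes> (c \<otimes> b) = c \<otimes> (b \<otimes> c)"
    using braid[OF i(2), unfolded i2, OF i(3), folded abc] by (simp add: m_assoc)
  have ac: "c \<otimes> a = a \<otimes> c" using far_comm[of i "i + 2"] i unfolding abc by simp
  define u where "u = a \<otimes> (b \<otimes> c)"
  define inv' where "inv' z = inverse t \<odot> (z \<ominus> (t - 1) \<odot> \<one>)" for z
  have inv'_closed [simp]: "inv' z \<in> carrier A" if "z \<in> carrier A" for z
    using that by (simp add: inv'_def smult_closed)
  have inv': "z \<otimes> (inv' z \<otimes> w) = w" if "z \<in> {a, b, c}" "w \<in> carrier A" for z w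
  proof -
    have "z \<otimes> inv' z = \<one>"
      using that(1) T_inverse[OF t i(1)] T_inverse[OF t i(2)] T_inverse[OF t i(3)]
      unfolding abc inv'_def by blast
    moreover have "z \<in> carrier A" using that(1) by auto
    ultimately show ?thesis using that(2) m_assoc[of z "inv' z" w] by simp
  qed
  \<comment> \<open>A right inverse of \<open>u\<close>: from \<open>u s = s' u\<close> and
    \<open>u v = 1\<close> follows \<open>s' = u s v\<close>, which is all that membership in a
    two-sided ideal requires.\<close>
  define v where "v = inv' c \<otimes> (inv' b \<otimes> inv' a)"
  have u [simp]: "u \<in> carrier A" and v [simp]: "v \<in> carrier A"
    by (simp_all add: u_def v_def)
  have "z \<otimes> inv' z = \<one>" if "z \<in> {a, b, c}" for z
    using inv'[OF that, of \<one>] that by auto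
  then have uv: "u \<otimes> v = \<one>"
    unfolding u_def v_def by (simp add: m_assoc inv')
  have ua: "u \<otimes> a = b \<otimes> u"
  proof -
    have "u \<otimes> a = (a \<otimes> (b \<otimes> a)) \<otimes> c" using ac by (simp add: u_def m_assoc)
    then show ?thesis unfolding ab by (simp add: u_def m_assoc)
  qed
  have ub: "u \<otimes> b = c \<otimes> u"
  proof -
    have "u \<otimes> b = a \<otimes> (b \<otimes> (c \<otimes> b))" by (simp add: u_def m_assoc)
    also have "\<dots> = (c \<otimes> a) \<otimes> (b \<otimes> c)" unfolding bc ac by (simp add: m_assoc)
    finally show ?thesis by (simp add: u_def m_assoc)
  qed
  have ua': "u \<otimes> (a \<otimes> z) = b \<otimes> (u \<otimes> z)" and ub': "u \<otimes> (b \<otimes> z) = c \<otimes> (u \<otimes> z)"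
    if "z \<in> carrier A" for z
    using ua ub that by (metis m_assoc u \<open>a \<in> carrier A\<close> \<open>b \<in> carrier A\<close> \<open>c \<in> carrier A\<close>)+
  have "u \<otimes> sym3 i (i + 1) = sym3 (i + 1) (i + 2) \<otimes> u"
    unfolding sym3_def abc[symmetric] by (simp add: r_distr l_distr m_assoc ua ub ua' ub')
  then have "sym3 (i + 1) (i + 2) = u \<otimes> sym3 i (i + 1) \<otimes> v"
    using uv sym3_closed[OF i(2,3)] by (simp add: m_assoc)
  moreover have "sym3 i (i + 1) \<in> J" using Suc by simp
  ultimately show ?case using J.I_l_closed J.I_r_closed u v by simp
qed

end

locale hecke_tl =
  fixes n :: nat and q :: complex
  assumes q_nz: "q \<noteq> 0"
begin

sublocale H: hecke_presentation n "q\<^sup>2" .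
sublocale TL: tl_presentation n q .

abbreviation "HA \<equiv> hecke_alg n (q\<^sup>2)"
abbreviation "TA \<equiv> tl_alg n q"
abbreviation "T \<equiv> hecke_T n (q\<^sup>2)"
abbreviation "U \<equiv> tl_U n q"

sublocale TA: calgebra "tl_alg n q"
  using TL.PA.calgebra_axioms by (simp only: TL.PA_eq)

lemma U_closed: "i \<in> {1..<n} \<Longrightarrow> U i \<in> carrier TA"
  using TL.gen_closed by (simp only: TL.PA_eq TL.gen_eq)

definition "\<sigma>U i = (if i \<in> {1..<n} then U i else \<zero>\<^bsub>TA\<^esub>)"

sublocale U: calgebra_assignment "tl_alg n q" \<sigma>U
  by unfold_locales (simp add: \<sigma>U_def U_closed del: One_nat_def)

lemma U_rel: "r \<in> tl_rels n q \<Longrightarrow> TA.ncev \<sigma>U r = \<zero>\<^bsub>TA\<^esub>"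
  using TL.presented_rel[of \<sigma>U, unfolded TL.PA_eq TL.gen_eq, OF U.assignment_closed] 
  by (simp add: \<sigma>U_def del: One_nat_def)

definition "\<sigma>T i = (if i \<in> {1..<n} then T i else \<zero>\<^bsub>HA\<^esub>)"

sublocale T: calgebra_assignment "hecke_alg n (q\<^sup>2)" \<sigma>T
  by unfold_locales (simp add: \<sigma>T_def H.T_closed del: One_nat_def)

lemma T_rel: "r \<in> hecke_rels n (q\<^sup>2) \<Longrightarrow> H.ncev \<sigma>T r = \<zero>\<^bsub>HA\<^esub>"
  using H.presented_rel[of \<sigma>T, unfolded H.PA_eq H.gen_eq, OF T.assignment_closed]
  by (simp add: \<sigma>T_def del: One_nat_def)

lemma q_const:
  "ncconst q * ncconst (inverse q) = 1" "ncconst (inverse q) * ncconst q = 1"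
  "ncconst (q\<^sup>2) = ncconst q * ncconst q"
  "ncconst (q + inverse q) = ncconst q + ncconst (inverse q)"
  using q_nz by (simp_all add: ncconst_simps(1,3) power2_eq_square flip: ncconst_simps(2))

text \<open>The image of \<open>T i\<close> as a polynomial in the Temperley-Lieb generators.
  Substituting it in the free algebra turns the check of a relation into ring normalisation, before
  anything is evaluated.\<close>

definition "wT i = - (ncconst q * ncvar i) - 1"

definition "\<sigma>TU i = TA.ncev \<sigma>U (wT i)"

sublocale TU: calgebra_assignment "tl_alg n q" \<sigma>TU
  by unfold_locales (simp add: \<sigma>TU_def)

lemma \<sigma>TU: "i \<in> {1..<n} \<Longrightarrow> \<sigma>TU i = (- q) \<odot>\<^bsub>TA\<^esub> U i \<ominus>\<^bsub>TA\<^esub> \<one>\<^bsub>TA\<^esub>"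
  using U_closed[of i]
  by (simp add: \<sigma>TU_def wT_def U.ncev_simps TA.smult_mult_left TA.minus_smult \<sigma>U_def
      del: One_nat_def)

text \<open>A Hecke relation evaluated at \<sigma>TU is the same relation with \<open>wT\<close>
  substituted, evaluated at \<sigma>U; the substitution identities write the latter as a combination
  of Temperley-Lieb relations.\<close>

lemma TU_rel:
  assumes "r \<in> hecke_rels n (q\<^sup>2)"
  shows "TA.ncev \<sigma>TU r = \<zero>\<^bsub>TA\<^esub>"
proof -
  consider (quad) i where "i \<in> {1..<n}" "r = (ncvar i - ncconst (q\<^sup>2)) * (ncvar i + 1)"
    | (braid) i where "i \<in> {1..<n}" "i + 1 \<in> {1..<n}"
      "r = ncvar i * ncvar (i + 1) * ncvar i - ncvar (i + 1) * ncvar i * ncvar (i + 1)"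
    | (comm) i j where "i \<in> {1..<n}" "j \<in> {1..<n}" "j > i + 1 \<or> i > j + 1"
      "r = ncvar i * ncvar j - ncvar j * ncvar i"
    using assms unfolding hecke_rels_def by blast
  then show ?thesis
  proof cases
    case quad
    have "TA.ncev \<sigma>TU r = TA.ncev \<sigma>U ((wT i - ncconst q * ncconst q) * (wT i + 1))"
      unfolding quad by (simp add: TU.ncev_simps U.ncev_simps q_const \<sigma>TU_def)
    also have "(wT i - ncconst q * ncconst q) * (wT i + 1) =
        ncconst q * ncconst q * (ncvar i * ncvar i + ncconst (q + inverse q) * ncvar i)"
      unfolding wT_def q_const(4)
      by (rule hecke_quad_in_tl) (simp_all add: ncvar_const_comm q_const)
    also have "TA.ncev \<sigma>U \<dots> = \<zero>\<^bsub>TA\<^esub>"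
      unfolding U.ncev_mult[of "_ * ncconst q"] U_rel[OF tl_rels_mem(1)[OF quad(1)]] by simp
    finally show ?thesis .
  next
    case braid
    let ?u = "ncvar i" and ?v = "ncvar (i + 1)" and ?Q = "ncconst q"
    have "TA.ncev \<sigma>TU r = TA.ncev \<sigma>U (wT i * wT (i + 1) * wT i - wT (i + 1) * wT i * wT (i + 1))"
      unfolding braid by (simp add: TU.ncev_simps U.ncev_simps \<sigma>TU_def)
    also have "wT i * wT (i + 1) * wT i - wT (i + 1) * wT i * wT (i + 1) =
      ?Q * ?Q * ?Q * ((?v * ?u * ?v - ?v) - (?u * ?v * ?u - ?u))
      + ?Q * ?Q * ((?v * ?v + ncconst (q + inverse q) * ?v) - (?u * ?u + ncconst (q + inverse q) * ?u))"
      unfolding wT_def q_const(4)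
      by (rule hecke_braid_in_tl) (simp_all add: ncvar_const_comm q_const)
    also have "TA.ncev \<sigma>U \<dots> = \<zero>\<^bsub>TA\<^esub>"
    proof -
      have "TA.ncev \<sigma>U (?v * ?u * ?v - ?v) = \<zero>\<^bsub>TA\<^esub>" "TA.ncev \<sigma>U (?u * ?v * ?u - ?u) = \<zero>\<^bsub>TA\<^esub>"
        "TA.ncev \<sigma>U (?v * ?v + ncconst (q + inverse q) * ?v) = \<zero>\<^bsub>TA\<^esub>"
        "TA.ncev \<sigma>U (?u * ?u + ncconst (q + inverse q) * ?u) = \<zero>\<^bsub>TA\<^esub>"
        using braid by (intro U_rel tl_rels_mem; simp)+
      then show ?thesis
        by (simp only: U.ncev_add[of "?Q * ?Q * ?Q * _"] U.ncev_mult[of "?Q * ?Q * ?Q"]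
            U.ncev_mult[of "?Q * ?Q"] U.ncev_diff[of "?v * ?u * ?v - ?v"]
            U.ncev_diff[of "?v * ?v + _"]) (simp add: a_minus_def)
    qed
    finally show ?thesis .
  next
    case comm
    have "TA.ncev \<sigma>TU r = TA.ncev \<sigma>U (wT i * wT j - wT j * wT i)"
      unfolding comm by (simp add: TU.ncev_simps U.ncev_simps \<sigma>TU_def)
    also have "wT i * wT j - wT j * wT i =
        ncconst q * ncconst q * (ncvar i * ncvar j - ncvar j * ncvar i)"
      unfolding wT_def by (rule hecke_comm_in_tl) (simp_all add: ncvar_const_comm)
    also have "TA.ncev \<sigma>U \<dots> = \<zero>\<^bsub>TA\<^esub>"
    proof -
      have "TA.ncev \<sigma>U (ncvar i * ncvar j - ncvar j * ncvar i) = \<zero>\<^bsub>TA\<^esub>"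
        using comm by (intro U_rel tl_rels_mem)
      then show ?thesis by (simp only: U.ncev_mult[of "_ * ncconst q"]) simp
    qed
    finally show ?thesis .
  qed
qed

end

context hecke_tl
begin

lemma Phi_exists:
  obtains f where "f \<in> calg_hom HA TA"
    "\<And>i. i \<in> {1..<n} \<Longrightarrow> f (T i) = (- q) \<odot>\<^bsub>TA\<^esub> U i \<ominus>\<^bsub>TA\<^esub> \<one>\<^bsub>TA\<^esub>"
proof -
  obtain f where "f \<in> calg_hom HA TA" "\<And>i. i \<in> {1..<n} \<Longrightarrow> f (T i) = \<sigma>TU i"
    using H.presented_universal[OF TA.calgebra_axioms TU.assignment_closed TU_rel]
    unfolding H.PA_eq H.gen_eq by metis
  then show thesis using that \<sigma>TU by simp
qed

text \<open>\<open>hecke_to_tl\<close> is a definite description, so uniqueness is needed next to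
  existence: on the carrier a homomorphism is fixed by the generators, and outside it extensionality
  fixes the values.\<close>

lemma Phi:
  "hecke_to_tl n q \<in> calg_hom HA TA"
  "i \<in> {1..<n} \<Longrightarrow> hecke_to_tl n q (T i) = (- q) \<odot>\<^bsub>TA\<^esub> U i \<ominus>\<^bsub>TA\<^esub> \<one>\<^bsub>TA\<^esub>"
proof -
  let ?P = "\<lambda>\<Phi>. \<Phi> \<in> calg_hom HA TA \<and> \<Phi> \<in> extensional (carrier HA) \<and>
    (\<forall>i\<in>{1..<n}. \<Phi> (T i) = (- q) \<odot>\<^bsub>TA\<^esub> U i \<ominus>\<^bsub>TA\<^esub> \<one>\<^bsub>TA\<^esub>)"
  obtain f where f: "f \<in> calg_hom HA TA"
    "\<And>i. i \<in> {1..<n} \<Longrightarrow> f (T i) = (- q) \<odot>\<^bsub>TA\<^esub> U i \<ominus>\<^bsub>TA\<^esub> \<one>\<^bsub>TA\<^esub>"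
    by (rule Phi_exists) blast
  interpret f: calg_homomorphism HA TA f
    by (intro calg_homomorphismI H.calgebra_axioms TA.calgebra_axioms f)
  define g where "g = restrict f (carrier HA)"
  have g: "g \<in> calg_hom HA TA"
    by (rule calg_homI) (simp_all add: g_def f.f_simps H.smult_closed)
  moreover have "g (T i) = (- q) \<odot>\<^bsub>TA\<^esub> U i \<ominus>\<^bsub>TA\<^esub> \<one>\<^bsub>TA\<^esub>" if "i \<in> {1..<n}" for i
    using f(2)[OF that] H.T_closed[OF that] by (simp add: g_def)
  moreover have "g \<in> extensional (carrier HA)"
    by (simp add: g_def)
  ultimately have "?P g" by blast
  moreover have "h = g" if h: "?P h" for h
  proof (rule extensionalityI[of _ "carrier HA"])
    show "h \<in> extensional (carrier HA)" "g \<in> extensional (carrier HA)" using h \<open>?P g\<close> by simp_all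
    show "h x = g x" if "x \<in> carrier HA" for x
      using H.presented_hom_eqI[OF TA.calgebra_axioms, unfolded H.PA_eq H.gen_eq, of h g x]
        h \<open>?P g\<close> that by simp
  qed
  ultimately have "?P (hecke_to_tl n q)"
    unfolding hecke_to_tl_def by (rule theI[where P = ?P])
  then show "hecke_to_tl n q \<in> calg_hom HA TA"
    "i \<in> {1..<n} \<Longrightarrow> hecke_to_tl n q (T i) = (- q) \<odot>\<^bsub>TA\<^esub> U i \<ominus>\<^bsub>TA\<^esub> \<one>\<^bsub>TA\<^esub>"
    by simp_all
qed

abbreviation "\<Phi> \<equiv> hecke_to_tl n q"

sublocale Phi: calg_homomorphism "hecke_alg n (q\<^sup>2)" "tl_alg n q" "hecke_to_tl n q"
  by (intro calg_homomorphismI H.calgebra_axioms TA.calgebra_axioms Phi)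

lemma Phi_T: "i \<in> {1..<n} \<Longrightarrow> \<Phi> (T i) = \<sigma>TU i"
  using Phi(2) \<sigma>TU by simp

lemma Phi_surj: "\<Phi> ` carrier HA = carrier TA"
proof
  show "\<Phi> ` carrier HA \<subseteq> carrier TA" by auto
  have "x \<in> \<Phi> ` carrier HA" if "x \<in> carrier TL.PA" for x
    using that
  proof (induction x rule: TL.presented_induct)
    case one
    have "\<Phi> \<one>\<^bsub>HA\<^esub> = \<one>\<^bsub>TA\<^esub>" by (rule Phi.f_one)
    then show ?case unfolding TL.PA_eq by (metis H.one_closed image_eqI)
  next
    case (smult c x)
    then obtain y where "y \<in> carrier HA" "x = \<Phi> y" by blast
    then have "c \<odot>\<^bsub>TA\<^esub> x = \<Phi> (c \<odot>\<^bsub>HA\<^esub> y)" "c \<odot>\<^bsub>HA\<^esub> y \<in> carrier HA"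
      by (simp_all add: Phi.f_smult H.smult_closed)
    then show ?case unfolding TL.PA_eq by blast
  next
    case (add x y)
    then obtain x' y' where "x' \<in> carrier HA" "x = \<Phi> x'" "y' \<in> carrier HA" "y = \<Phi> y'" by blast
    then have "x \<oplus>\<^bsub>TA\<^esub> y = \<Phi> (x' \<oplus>\<^bsub>HA\<^esub> y')" "x' \<oplus>\<^bsub>HA\<^esub> y' \<in> carrier HA"
      by (simp_all add: Phi.f_add)
    then show ?case unfolding TL.PA_eq by blast
  next
    case (mult x i)
    then obtain x' where x': "x' \<in> carrier HA" "x = \<Phi> x'" by blast
    \<comment> \<open>Solves \<open>T = - q U - 1\<close> for \<open>U\<close>, which is possible by
      \<open>q_nz\<close>.\<close>
    let ?u = "(- inverse q) \<odot>\<^bsub>HA\<^esub> (T i \<oplus>\<^bsub>HA\<^esub> \<one>\<^bsub>HA\<^esub>)"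
    have T: "T i \<in> carrier HA" and U: "U i \<in> carrier TA"
      using mult H.T_closed U_closed by blast+
    have "\<Phi> (T i \<oplus>\<^bsub>HA\<^esub> \<one>\<^bsub>HA\<^esub>) = (- q) \<odot>\<^bsub>TA\<^esub> U i"
      using T U mult Phi(2)[of i]
      by (simp add: Phi.f_simps a_minus_def TA.a_assoc TA.smult_closed TA.l_neg)
    then have "\<Phi> ?u = U i"
      using T U q_nz by (simp add: Phi.f_smult TA.smult_one flip: TA.smult_assoc)
    then have "x \<otimes>\<^bsub>TA\<^esub> U i = \<Phi> (x' \<otimes>\<^bsub>HA\<^esub> ?u)" "x' \<otimes>\<^bsub>HA\<^esub> ?u \<in> carrier HA"
      using x' T by (simp_all add: Phi.f_mult H.smult_closed)
    then show ?case unfolding TL.PA_eq TL.gen_eq by blast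
  qed
  then show "carrier TA \<subseteq> \<Phi> ` carrier HA" unfolding TL.PA_eq by blast
qed

definition "sym3_poly i j = ncvar i * ncvar j * ncvar i + ncvar i * ncvar j + ncvar j * ncvar i
  + ncvar i + ncvar j + (1 :: ncpoly)"

lemma sym3_ncev: "i \<in> {1..<n} \<Longrightarrow> j \<in> {1..<n} \<Longrightarrow> H.sym3 i j = H.ncev \<sigma>T (sym3_poly i j)"
  by (simp add: H.sym3_def sym3_poly_def T.ncev_simps \<sigma>T_def del: One_nat_def)

lemma Phi_sym3:
  assumes n: "i \<in> {1..<n}" "j \<in> {1..<n}" "j = i + 1 \<or> i = j + 1"
  shows "\<Phi> (H.sym3 i j) = \<zero>\<^bsub>TA\<^esub>"
proof -
  let ?u = "ncvar i" and ?v = "ncvar j" and ?Q = "ncconst q"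
  have "\<Phi> (H.sym3 i j) = TA.ncev \<sigma>TU (sym3_poly i j)"
    using Phi_T[OF n(1)] Phi_T[OF n(2)] H.T_closed[OF n(1)] H.T_closed[OF n(2)]
    by (simp add: H.sym3_def sym3_poly_def TU.ncev_simps Phi.f_simps)
  also have "\<dots> = TA.ncev \<sigma>U (wT i * wT j * wT i + wT i * wT j + wT j * wT i + wT i + wT j + 1)"
    by (simp add: sym3_poly_def TU.ncev_simps U.ncev_simps \<sigma>TU_def)
  also have "wT i * wT j * wT i + wT i * wT j + wT j * wT i + wT i + wT j + 1 =
      - (?Q * ?Q * ?Q * (?u * ?v * ?u - ?u)) - ?Q * ?Q * (?u * ?u + ncconst (q + inverse q) * ?u)"
    unfolding wT_def q_const(4)
    by (rule hecke_sym3_in_tl) (simp_all add: ncvar_const_comm q_const)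
  also have "TA.ncev \<sigma>U \<dots> = \<zero>\<^bsub>TA\<^esub>"
    unfolding U.ncev_diff[of "- _"] U.ncev_uminus U.ncev_mult[of "_ * ?Q"]
      U_rel[OF tl_rels_mem(1)[OF n(1)]] U_rel[OF tl_rels_mem(2)[OF n]]
    by (simp add: a_minus_def)
  finally show ?thesis .
qed

text \<open>For \<open>n < 3\<close> no two generators are adjacent and no cubic relation occurs;
  the empty set then generates the zero ideal.\<close>

definition "ker_gens = (if 3 \<le> n then {H.sym3 1 2} else {})"

lemma ker_gens_closed: "ker_gens \<subseteq> carrier HA"
  using H.sym3_closed[of 1 2] by (auto simp: ker_gens_def)

definition "wU i = - (ncconst (inverse q) * (ncvar i + 1))"

text \<open>One inclusion is the vanishing of the image of \<open>sym3 1 2\<close>. For the other,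
  sending \<open>U i\<close> to the class of \<open>- q^-1 (T i + 1)\<close> defines a homomorphism
  \<open>g\<close> back to the quotient by \<open>?J\<close>, and \<open>g\<close> after \<Phi> is
  the projection; so whatever \<Phi> kills is zero in the quotient.\<close>

lemma kernel_eq: "a_kernel HA TA \<Phi> = Idl\<^bsub>HA\<^esub> ker_gens"
proof
  show "Idl\<^bsub>HA\<^esub> ker_gens \<subseteq> a_kernel HA TA \<Phi>"
  proof (intro H.genideal_minimal Phi.kernel_ideal)
    show "ker_gens \<subseteq> a_kernel HA TA \<Phi>"
      using ker_gens_closed Phi_sym3[of 1 2] by (auto simp: ker_gens_def Phi.mem_kernel)
  qed
next
  let ?J = "Idl\<^bsub>HA\<^esub> ker_gens"
  have J: "ideal ?J HA" using ker_gens_closed by (rule H.genideal_ideal)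
  interpret J: calgebra_ideal HA ?J by (intro H.calgebra_idealI J)
  let ?B = "quot_alg HA ?J" and ?p = "\<lambda>x. ?J +>\<^bsub>HA\<^esub> x"
  define \<tau> where "\<tau> i = ?p (\<sigma>T i)" for i
  interpret \<tau>: calgebra_assignment ?B \<tau>
    using J.proj.B.calgebra_axioms
    by (simp add: calgebra_assignment_def calgebra_assignment_axioms_def \<tau>_def)
  have \<tau>_ncev: "J.proj.B.ncev \<tau> r = ?p (H.ncev \<sigma>T r)" for r
    unfolding \<tau>_def by (rule J.proj.f_ncev[symmetric]) simp
  have \<tau>_rel: "J.proj.B.ncev \<tau> r = \<zero>\<^bsub>?B\<^esub>" if "r \<in> hecke_rels n (q\<^sup>2)" for r
    unfolding \<tau>_ncev T_rel[OF that] by (rule J.proj.f_zero)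
  have \<tau>_sym3: "J.proj.B.ncev \<tau> (sym3_poly i j) = \<zero>\<^bsub>?B\<^esub>"
    if "i \<in> {1..<n}" "j \<in> {1..<n}" "j = i + 1 \<or> i = j + 1" for i j
  proof -
    \<comment> \<open>Only the first adjacent pair enters the generating set; shifting the indices
      supplies the others, and the braid relation makes the order within a pair irrelevant.\<close>
    have sym: "H.sym3 k (k + 1) \<in> ?J" if "k \<in> {1..<n}" "k + 1 \<in> {1..<n}" for k
    proof (rule H.sym3_in_ideal[OF J])
      show "q\<^sup>2 \<noteq> 0" using q_nz by simp
      show "H.sym3 1 2 \<in> ?J" if "3 \<le> n"
        using H.genideal_self[OF ker_gens_closed] that by (auto simp: ker_gens_def)
    qed (use that in auto)
    have "H.sym3 i j \<in> ?J"
      using that sym[of i] sym[of j] H.sym3_commute[of j] by metis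
    moreover have "H.sym3 i j \<in> carrier HA" using that H.sym3_closed by blast
    ultimately show ?thesis
      unfolding \<tau>_ncev sym3_ncev[OF that(1,2), symmetric] by (simp add: J.proj_eq_zero_iff)
  qed
  define \<rho> where "\<rho> i = J.proj.B.ncev \<tau> (wU i)" for i
  interpret \<rho>: calgebra_assignment ?B \<rho> by unfold_locales (simp add: \<rho>_def)
  let ?Qi = "ncconst (inverse q)"
  have \<rho>_rel: "J.proj.B.ncev \<rho> r = \<zero>\<^bsub>?B\<^esub>" if r: "r \<in> tl_rels n q" for r
  proof -
    consider (quad) i where "i \<in> {1..<n}" "r = ncvar i * ncvar i + ncconst (q + inverse q) * ncvar i"
      | (cubic) i j where "i \<in> {1..<n}" "j \<in> {1..<n}" "j = i + 1 \<or> i = j + 1"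
        "r = ncvar i * ncvar j * ncvar i - ncvar i"
      | (comm) i j where "i \<in> {1..<n}" "j \<in> {1..<n}" "j > i + 1 \<or> i > j + 1"
        "r = ncvar i * ncvar j - ncvar j * ncvar i"
      using r unfolding tl_rels_def by blast
    then show ?thesis
    proof cases
      case quad
      have "J.proj.B.ncev \<rho> r = J.proj.B.ncev \<tau> (wU i * wU i + ncconst (q + inverse q) * wU i)"
        unfolding quad by (simp add: \<rho>.ncev_simps \<tau>.ncev_simps \<rho>_def)
      also have "wU i * wU i + ncconst (q + inverse q) * wU i =
          ?Qi * ?Qi * ((ncvar i - ncconst (q\<^sup>2)) * (ncvar i + 1))"
        unfolding wU_def q_const(3,4)
        by (rule tl_quad_in_hecke) (simp_all add: ncvar_const_comm q_const)
      also have "J.proj.B.ncev \<tau> \<dots> = \<zero>\<^bsub>?B\<^esub>"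
        unfolding \<tau>.ncev_mult[of "_ * ?Qi"] \<tau>_rel[OF hecke_rels_mem(1)[OF quad(1)]] by simp
      finally show ?thesis .
    next
      case cubic
      have "J.proj.B.ncev \<rho> r = J.proj.B.ncev \<tau> (wU i * wU j * wU i - wU i)"
        unfolding cubic by (simp add: \<rho>.ncev_simps \<tau>.ncev_simps \<rho>_def)
      also have "wU i * wU j * wU i - wU i =
          - (?Qi * ?Qi * ?Qi * (sym3_poly i j + (ncvar i - ncconst (q\<^sup>2)) * (ncvar i + 1)))"
        unfolding wU_def q_const(3) sym3_poly_def
        by (rule tl_cubic_in_hecke) (simp_all add: ncvar_const_comm q_const)
      also have "J.proj.B.ncev \<tau> \<dots> = \<zero>\<^bsub>?B\<^esub>"
        unfolding \<tau>.ncev_uminus \<tau>.ncev_mult[of "_ * ?Qi"] \<tau>.ncev_add[of "sym3_poly i j"]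
          \<tau>_rel[OF hecke_rels_mem(1)[OF cubic(1)]] \<tau>_sym3[OF cubic(1-3)] by simp
      finally show ?thesis .
    next
      case comm
      have "J.proj.B.ncev \<rho> r = J.proj.B.ncev \<tau> (wU i * wU j - wU j * wU i)"
        unfolding comm by (simp add: \<rho>.ncev_simps \<tau>.ncev_simps \<rho>_def)
      also have "wU i * wU j - wU j * wU i = ?Qi * ?Qi * (ncvar i * ncvar j - ncvar j * ncvar i)"
        unfolding wU_def by (rule tl_comm_in_hecke) (simp_all add: ncvar_const_comm)
      also have "J.proj.B.ncev \<tau> \<dots> = \<zero>\<^bsub>?B\<^esub>"
        unfolding \<tau>.ncev_mult[of "_ * ?Qi"] \<tau>_rel[OF hecke_rels_mem(3)[OF comm(1-3)]] by simp
      finally show ?thesis .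
    qed
  qed
  obtain g where g: "g \<in> calg_hom TA ?B" "\<And>i. i \<in> {1..<n} \<Longrightarrow> g (U i) = \<rho> i"
    using TL.presented_universal[OF J.proj.B.calgebra_axioms \<rho>.assignment_closed \<rho>_rel]
    unfolding TL.PA_eq TL.gen_eq by metis
  interpret g: calg_homomorphism TA ?B g
    by (intro calg_homomorphismI TA.calgebra_axioms J.proj.B.calgebra_axioms g)
  have gT: "g (\<Phi> (T i)) = ?p (T i)" if i: "i \<in> {1..<n}" for i
  proof -
    have "g (\<Phi> (T i)) = J.proj.B.ncev \<tau> (- (ncconst q * wU i) - 1)"
      using g(2)[OF i] Phi(2)[OF i] U_closed[OF i]
      by (simp add: g.f_simps TA.smult_closed \<tau>.ncev_simps \<rho>_def J.proj.B.smult_mult_left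
          J.proj.B.minus_smult)
    also have "- (ncconst q * wU i) - 1 = ncvar i"
      by (simp add: wU_def q_const flip: mult.assoc)
    finally show ?thesis unfolding \<tau>.ncev_var using i by (simp add: \<tau>_def \<sigma>T_def)
  qed
  have "g (\<Phi> x) = ?p x" if "x \<in> carrier HA" for x
    by (rule H.presented_hom_eqI[OF J.proj.B.calgebra_axioms, unfolded H.PA_eq H.gen_eq,
          OF calg_hom_compose[OF Phi(1) g(1)] J.quot_proj_hom gT that])
  note gp = this
  show "a_kernel HA TA \<Phi> \<subseteq> ?J"
  proof
    fix x assume "x \<in> a_kernel HA TA \<Phi>"
    then have x: "x \<in> carrier HA" "\<Phi> x = \<zero>\<^bsub>TA\<^esub>" by (simp_all add: Phi.mem_kernel)
    then have "?p x = \<zero>\<^bsub>?B\<^esub>" using gp[OF x(1)] g.f_zero by simp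
    then show "x \<in> ?J" using J.proj_eq_zero_iff[OF x(1)] by blast
  qed
qed

end

section \<open>Evaluating polynomials at commuting elements\<close>

lemma power_add_mod_square:
  fixes x y :: "'a :: comm_ring_1"
  shows "\<exists>c. (x + y) ^ Suc N = y ^ Suc N + of_nat (Suc N) * x * y ^ N + c * x\<^sup>2"
proof (induction N)
  case (Suc N)
  then obtain c where c: "(x + y) ^ Suc N = y ^ Suc N + of_nat (Suc N) * x * y ^ N + c * x\<^sup>2" by blast
  have "(x + y) ^ Suc (Suc N) = (x + y) * (x + y) ^ Suc N" by simp
  also have "\<dots> = y ^ Suc (Suc N) + of_nat (Suc (Suc N)) * x * y ^ Suc N
      + (of_nat (Suc N) * y ^ N + c * (x + y)) * x\<^sup>2"
    unfolding c by (simp add: algebra_simps power2_eq_square)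
  finally show ?case by blast
qed (auto intro: exI[of _ 0])

lemma power_add_dvd:
  fixes u v :: "'a :: comm_ring_1"
  shows "\<exists>d. (u + v) ^ M = u * d + v ^ M"
proof (induction M)
  case (Suc M)
  then obtain d where "(u + v) ^ M = u * d + v ^ M" by blast
  then have "(u + v) ^ Suc M = u * (u * d + v ^ M + v * d) + v ^ Suc M"
    by (simp add: algebra_simps)
  then show ?case by blast
qed (auto intro: exI[of _ 0])

text \<open>Elements that generate the unit ideal still do so after being raised to a power. The
  remainder \<open>r\<close> carries the summands not yet treated through the induction.\<close>

lemma comaximal_powers:
  fixes f :: "'i \<Rightarrow> 'a :: comm_ring_1"
  assumes "finite F" "(\<Sum>k\<in>F. f k) + r = 1"
  shows "\<exists>b c. (\<Sum>k\<in>F. b k * f k ^ M) + c * r = 1"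
  using assms
proof (induction F arbitrary: r rule: finite_induct)
  case empty
  then show ?case by (auto intro: exI[of _ 1])
next
  case (insert k F)
  then have "(\<Sum>k\<in>F. f k) + (f k + r) = 1" by (simp add: algebra_simps)
  from insert.IH[OF this] obtain b c where bc: "(\<Sum>k\<in>F. b k * f k ^ M) + c * (f k + r) = 1" by blast
  let ?u = "(\<Sum>k\<in>F. b k * f k ^ M) + c * r"
  \<comment> \<open>Since \<open>?u + c * f k = 1\<close>, its power \<open>M\<close> writes 1 as a
    multiple of \<open>?u\<close> plus a multiple of \<open>f k ^ M\<close>.\<close>
  obtain d where "(?u + c * f k) ^ M = ?u * d + (c * f k) ^ M" using power_add_dvd by blast
  moreover have "?u + c * f k = 1" using bc by (simp add: algebra_simps)
  ultimately have "1 = ?u * d + (c * f k) ^ M" by simp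
  also have "\<dots> = (\<Sum>j\<in>F. (b j * d) * f j ^ M) + c ^ M * f k ^ M + (c * d) * r"
    by (simp add: algebra_simps power_mult_distrib sum_distrib_left sum_distrib_right)
  also have "\<dots> = (\<Sum>j\<in>insert k F. (if j = k then c ^ M else b j * d) * f j ^ M) + (c * d) * r"
  proof -
    have "(\<Sum>j\<in>F. (b j * d) * f j ^ M) = (\<Sum>j\<in>F. (if j = k then c ^ M else b j * d) * f j ^ M)"
      using insert.hyps by (intro sum.cong) auto
    then show ?thesis using insert.hyps by (simp add: algebra_simps)
  qed
  finally have "(\<Sum>j\<in>insert k F. (if j = k then c ^ M else b j * d) * f j ^ M) + (c * d) * r = 1" ..
  then show ?case by (intro exI)
qed

text \<open>Lagrange interpolation at the roots of unity settles the case of simple factors;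
  comaximality then raises the factors to the power \<open>M\<close>.\<close>

lemma root_of_unity_partition:
  fixes \<zeta> :: complex
  assumes l: "l > 0" and \<zeta>: "\<zeta> ^ l = 1" and prim: "\<And>m. 0 < m \<Longrightarrow> m < l \<Longrightarrow> \<zeta> ^ m \<noteq> 1"
  shows "\<exists>g :: nat \<Rightarrow> complex poly. (\<Sum>k<l. g k) = 1 \<and>
    (\<forall>k<l. \<exists>h. [:- (\<zeta> ^ k), 1:] ^ M * g k = h * ([:0, 1:] ^ l - 1) ^ M)"
proof -
  let ?X = "[:0, 1:] :: complex poly"
  \<comment> \<open>The quotient of \<open>X^l - 1\<close> by \<open>X - \<zeta>^k\<close> takes the
    value \<open>l \<zeta>^(-k)\<close> at \<open>\<zeta>^k\<close>; the factor in front normalises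
    this to 1.\<close>
  define f where "f k = smult (\<zeta> ^ k / of_nat l) (\<Sum>j<l. [:(\<zeta> ^ k) ^ (l - Suc j):] * ?X ^ j)" for k
  have smult_sumR: "smult c (\<Sum>j<m. h j) = (\<Sum>j<m. smult c (h j))" for c m and h :: "nat \<Rightarrow> complex poly"
    by (induction m) (simp_all add: smult_add_right)
  have X: "[:- (\<zeta> ^ k), 1:] * f k = smult (\<zeta> ^ k / of_nat l) (?X ^ l - 1)" for k
  proof -
    have "?X ^ l - [:\<zeta> ^ k:] ^ l = (?X - [:\<zeta> ^ k:]) * (\<Sum>j<l. [:\<zeta> ^ k:] ^ (l - Suc j) * ?X ^ j)"
      by (rule power_diff_sumr2)
    moreover have "[:\<zeta> ^ k:] ^ m = [:(\<zeta> ^ k) ^ m:]" for m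
      by (rule poly_const_pow)
    moreover have "(\<zeta> ^ k) ^ l = 1"
      using \<zeta> by (metis power_commutes power_mult power_one mult.commute)
    ultimately show ?thesis by (simp add: f_def one_pCons)
  qed
  \<comment> \<open>The coefficient of \<open>X^j\<close> in the sum is a geometric sum in
    \<open>\<zeta>^(l - j)\<close>, which vanishes unless \<open>j = 0\<close>.\<close>
  have "(\<Sum>k<l. f k) = (\<Sum>j<l. smult (1 / of_nat l * (\<Sum>k<l. (\<zeta> ^ (l - j)) ^ k)) (?X ^ j))"
  proof -
    have "(\<Sum>k<l. f k) = (\<Sum>k<l. \<Sum>j<l. smult (1 / of_nat l * (\<zeta> ^ (l - j)) ^ k) (?X ^ j))"
    proof (intro sum.cong refl)
      fix k assume "k \<in> {..<l}"
      have "\<zeta> ^ k / of_nat l * (\<zeta> ^ k) ^ (l - Suc j) = 1 / of_nat l * (\<zeta> ^ (l - j)) ^ k"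
        if "j < l" for j
      proof -
        have "l - j = Suc (l - Suc j)" using that by simp
        then show ?thesis by (simp add: power_mult_distrib flip: power_mult) (simp add: mult.commute)
      qed
      then show "f k = (\<Sum>j<l. smult (1 / of_nat l * (\<zeta> ^ (l - j)) ^ k) (?X ^ j))"
        by (simp add: f_def smult_sumR)
    qed
    also have "\<dots> = (\<Sum>j<l. \<Sum>k<l. smult (1 / of_nat l * (\<zeta> ^ (l - j)) ^ k) (?X ^ j))"
      by (rule sum.swap)
    finally show ?thesis by (simp add: sum_distrib_left smult_sum)
  qed
  also have "\<dots> = (\<Sum>j<l. if j = 0 then 1 else 0)"
  proof (intro sum.cong refl)
    fix j assume j: "j \<in> {..<l}"
    show "smult (1 / of_nat l * (\<Sum>k<l. (\<zeta> ^ (l - j)) ^ k)) (?X ^ j) = (if j = 0 then 1 else 0)"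
    proof (cases "j = 0")
      case True
      then show ?thesis using \<zeta> l by simp
    next
      case False
      then have "\<zeta> ^ (l - j) \<noteq> 1" using prim[of "l - j"] j by simp
      moreover have "(\<zeta> ^ (l - j)) ^ l = 1"
        using \<zeta> by (metis power_commutes power_mult power_one mult.commute)
      ultimately show ?thesis using False by (simp add: geometric_sum)
    qed
  qed
  also have "\<dots> = 1" using l by simp
  finally have "(\<Sum>k<l. f k) + 0 = 1" by simp
  from comaximal_powers[OF _ this, of M] obtain b where b: "(\<Sum>k<l. b k * f k ^ M) = 1" by auto
  have "\<exists>h. [:- (\<zeta> ^ k), 1:] ^ M * (b k * f k ^ M) = h * (?X ^ l - 1) ^ M" for k
  proof -
    have "[:- (\<zeta> ^ k), 1:] ^ M * (b k * f k ^ M) = b k * ([:- (\<zeta> ^ k), 1:] * f k) ^ M"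
      by (simp only: power_mult_distrib mult.left_commute)
    also have "\<dots> = b k * [:(\<zeta> ^ k / of_nat l) ^ M:] * (?X ^ l - 1) ^ M"
      unfolding X by (simp add: smult_power)
    finally show ?thesis by blast
  qed
  then show ?thesis using b by (intro exI[of _ "\<lambda>k. b k * f k ^ M"]) simp
qed

text \<open>Put \<open>u = b^l - 1\<close> and \<open>w = a^l - 1\<close>. As
  \<open>t^l = 1\<close>, \<open>u - w\<close> is divisible by \<open>t b - a\<close> and
  \<open>w - u\<close> by \<open>t a - b\<close>, so the square of \<open>u - w\<close> is a
  multiple of the product of these two. Expanding \<open>u^(N+1)\<close> around \<open>w\<close> to
  first order leaves a multiple of \<open>w^N\<close> and a multiple of that square; N more factors
  \<open>u\<close> turn the latter into the second term, whence the exponent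
  \<open>2 N + 1\<close>.\<close>

lemma nilpotent_certificate:
  fixes a b t :: "'a :: comm_ring_1"
  assumes t: "t ^ l = 1"
  shows "\<exists>c d. (b ^ l - 1) ^ Suc (2 * N) =
    c * (a ^ l - 1) ^ N + d * ((b ^ l - 1) ^ N * ((t * b - a) * (t * a - b)))"
proof -
  let ?u = "b ^ l - 1" and ?w = "a ^ l - 1"
  obtain s1 where s1: "(t * b) ^ l - a ^ l = (t * b - a) * s1" using power_diff_sumr2 by blast
  obtain s2 where s2: "(t * a) ^ l - b ^ l = (t * a - b) * s2" using power_diff_sumr2 by blast
  have s: "?u - ?w = (t * b - a) * s1" "?w - ?u = (t * a - b) * s2"
    using s1 s2 t by (simp_all add: power_mult_distrib)
  have "(?u - ?w)\<^sup>2 = - ((?u - ?w) * (?w - ?u))" by (simp add: power2_eq_square algebra_simps)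
  also have "\<dots> = - (s1 * s2) * ((t * b - a) * (t * a - b))"
    unfolding s by (simp add: algebra_simps)
  finally have sq: "(?u - ?w)\<^sup>2 = - (s1 * s2) * ((t * b - a) * (t * a - b))" .
  obtain c where "((?u - ?w) + ?w) ^ Suc N = ?w ^ Suc N + of_nat (Suc N) * (?u - ?w) * ?w ^ N + c * (?u - ?w)\<^sup>2"
    using power_add_mod_square by blast
  then have "?u ^ Suc N = (?w + of_nat (Suc N) * (?u - ?w)) * ?w ^ N + c * (?u - ?w)\<^sup>2"
    by (simp add: algebra_simps)
  moreover have "X = P * W + C * (S * D) \<Longrightarrow> U * X = U * P * W + C * S * (U * D)"
    for U X P W C S D :: 'a by (simp add: algebra_simps)
  ultimately have "?u ^ N * ?u ^ Suc N = ?u ^ N * (?w + of_nat (Suc N) * (?u - ?w)) * ?w ^ N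
      + (c * - (s1 * s2)) * (?u ^ N * ((t * b - a) * (t * a - b)))"
    unfolding sq by blast
  moreover have "?u ^ N * ?u ^ Suc N = ?u ^ Suc (2 * N)"
    using power_add[of ?u N "Suc N"] by (simp only: mult_2 add_Suc_right)
  ultimately show ?thesis by metis
qed

text \<open>Coefficients come from an arbitrary commutative ring through \<kappa>, so that
  evaluation can be iterated: with \<kappa> itself an evaluation at \<open>a\<close>, polynomials in
  two variables are evaluated at a commuting pair.\<close>

locale poly_eval = calgebra A for A :: "(complex, 'a) module" (structure) +
  fixes \<kappa> :: "'c :: comm_ring_1 \<Rightarrow> 'a" and x :: 'a
  assumes \<kappa>_closed [simp]: "\<kappa> c \<in> carrier A"
    and \<kappa>_add: "\<kappa> (c + d) = \<kappa> c \<oplus> \<kappa> d"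
    and \<kappa>_mult: "\<kappa> (c * d) = \<kappa> c \<otimes> \<kappa> d"
    and \<kappa>_one: "\<kappa> 1 = \<one>"
    and x_closed [simp]: "x \<in> carrier A"
    and x_comm: "x \<otimes> \<kappa> c = \<kappa> c \<otimes> x"
begin

lemma \<kappa>_zero: "\<kappa> 0 = \<zero>"
  using \<kappa>_add[of 0 0] by simp

definition pev :: "'c poly \<Rightarrow> 'a" where
  "pev p = fold_coeffs (\<lambda>c y. \<kappa> c \<oplus> x \<otimes> y) p \<zero>"

lemma pev_zero [simp]: "pev 0 = \<zero>"
  by (simp add: pev_def)

lemma pev_pCons: "pev (pCons c p) = \<kappa> c \<oplus> x \<otimes> pev p"
  by (cases "c = 0 \<and> p = 0") (auto simp: pev_def \<kappa>_zero)

lemma pev_closed [simp, intro]: "pev p \<in> carrier A"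
  by (induction p) (simp_all add: pev_pCons)

lemma pev_add: "pev (p + r) = pev p \<oplus> pev r"
  by (induction p r rule: poly_induct2) (simp_all add: pev_pCons \<kappa>_add r_distr a_ac)

lemma pev_smult: "pev (smult c p) = \<kappa> c \<otimes> pev p"
proof (induction p)
  case (pCons d p)
  have "x \<otimes> (\<kappa> c \<otimes> pev p) = \<kappa> c \<otimes> (x \<otimes> pev p)"
    using x_comm[of c] by (metis m_assoc \<kappa>_closed x_closed pev_closed)
  with pCons show ?case by (simp add: pev_pCons \<kappa>_mult r_distr)
qed simp

lemma pev_mult: "pev (p * r) = pev p \<otimes> pev r"
  by (induction p) (simp_all add: pev_add pev_smult pev_pCons \<kappa>_zero l_distr m_assoc)

lemma pev_const: "pev [:c:] = \<kappa> c"
  by (simp add: pev_pCons)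

lemma pev_one [simp]: "pev 1 = \<one>"
  by (simp add: one_pCons pev_const \<kappa>_one)

lemma pev_X [simp]: "pev [:0, 1:] = x"
  by (simp add: pev_pCons \<kappa>_zero \<kappa>_one)

lemma pev_uminus: "pev (- p) = \<ominus> pev p"
  using pev_add[of "- p" p] by (simp add: minus_equality)

lemma pev_diff: "pev (p - r) = pev p \<ominus> pev r"
  using pev_add[of p "- r"] by (simp add: pev_uminus a_minus_def)

lemma pev_power: "pev (p ^ k) = pev p [^] k"
  by (induction k) (simp_all add: pev_mult power_Suc2 del: power_Suc)

lemma pev_sum: "finite K \<Longrightarrow> pev (\<Sum>k\<in>K. f k) = (\<Oplus>k\<in>K. pev (f k))"
  by (induction K rule: finite_induct) (simp_all add: pev_add Pi_iff)

lemma pev_commute: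
  assumes "y \<in> carrier A" "y \<otimes> x = x \<otimes> y" "\<And>c. y \<otimes> \<kappa> c = \<kappa> c \<otimes> y"
  shows "y \<otimes> pev p = pev p \<otimes> y"
proof (induction p)
  case (pCons c p)
  have "y \<otimes> (x \<otimes> pev p) = (x \<otimes> pev p) \<otimes> y"
    using assms(1,2) pCons.IH by (metis m_assoc x_closed pev_closed)
  with assms show ?case by (simp add: pev_pCons r_distr l_distr)
qed (simp add: assms)

end

context calgebra
begin

lemma poly_eval_scalar: "x \<in> carrier A \<Longrightarrow> poly_eval A (\<lambda>c. c \<odot> \<one>) x"
  by unfold_locales (simp_all add: smult_closed smult_l_distr smult_mult_left
      smult_mult_right smult_one mult.commute flip: smult_assoc)

lemma nilpotent_transfer:
  assumes [simp]: "a \<in> carrier A" "b \<in> carrier A" and ab: "a \<otimes> b = b \<otimes> a" and t: "t ^ l = 1"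
    and a: "(a [^] l \<ominus> \<one>) [^] N = \<zero>"
    and b: "(b [^] l \<ominus> \<one>) [^] N \<otimes> ((t \<odot> b \<ominus> a) \<otimes> (t \<odot> a \<ominus> b)) = \<zero>"
  shows "(b [^] l \<ominus> \<one>) [^] Suc (2 * N) = \<zero>"
proof -
  interpret a: poly_eval A "\<lambda>c. c \<odot> \<one>" a by (rule poly_eval_scalar) simp
  have comm: "b \<otimes> a.pev p = a.pev p \<otimes> b" for p
    by (rule a.pev_commute) (simp_all add: ab smult_mult_left smult_mult_right)
  interpret b: poly_eval A a.pev b
    by unfold_locales (simp_all add: a.pev_add a.pev_mult comm)
  \<comment> \<open>The inner variable stands for \<open>a\<close>, the outer one for
    \<open>b\<close>; the scalar \<open>t\<close> is constant at both levels.\<close>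
  let ?a = "[:[:0, 1:]:] :: complex poly poly" and ?b = "[:0, 1:] :: complex poly poly"
    and ?t = "[:[:t:]:] :: complex poly poly"
  have "?t ^ l = 1" by (simp add: poly_const_pow t one_pCons)
  from nilpotent_certificate[OF this, of ?b N ?a] obtain c d where
    "(?b ^ l - 1) ^ Suc (2 * N) = c * (?a ^ l - 1) ^ N
      + d * ((?b ^ l - 1) ^ N * ((?t * ?b - ?a) * (?t * ?a - ?b)))" by blast
  then have "b.pev ((?b ^ l - 1) ^ Suc (2 * N)) = b.pev (c * (?a ^ l - 1) ^ N
      + d * ((?b ^ l - 1) ^ N * ((?t * ?b - ?a) * (?t * ?a - ?b))))" by simp
  moreover have "b.pev ?b = b" "b.pev ?a = a" "b.pev ?t = t \<odot> \<one>"
    by (rule b.pev_X, simp only: b.pev_const a.pev_X, simp only: b.pev_const a.pev_const)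
  ultimately show ?thesis
    using a b by (simp only: b.pev_power b.pev_diff b.pev_mult b.pev_add b.pev_one)
      (simp add: smult_mult_left smult_closed)
qed

text \<open>The root of unity partition evaluated at \<open>L\<close>. As polynomials in
  \<open>L\<close>, the \<open>g k\<close> commute with whatever commutes with \<open>L\<close>;
  this matters when several elements are treated in turn.\<close>

lemma spectral_partition:
  assumes L [simp]: "L \<in> carrier A" and nil: "(L [^] l \<ominus> \<one>) [^] (M::nat) = \<zero>"
    and \<zeta>: "l > 0" "\<zeta> ^ l = 1" "\<And>m. 0 < m \<Longrightarrow> m < l \<Longrightarrow> \<zeta> ^ m \<noteq> 1"
  obtains g where "\<And>k. g k \<in> carrier A" "\<And>k. k < l \<Longrightarrow> (L \<ominus> \<zeta> ^ k \<odot> \<one>) [^] M \<otimes> g k = \<zero>"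
    "\<And>k y. y \<in> carrier A \<Longrightarrow> y \<otimes> L = L \<otimes> y \<Longrightarrow> y \<otimes> g k = g k \<otimes> y"
    "(\<Oplus>k\<in>{..<l}. g k) = \<one>"
proof -
  interpret L: poly_eval A "\<lambda>c. c \<odot> \<one>" L by (rule poly_eval_scalar) simp
  obtain g :: "nat \<Rightarrow> complex poly" where g: "(\<Sum>k<l. g k) = 1"
    "\<And>k. k < l \<Longrightarrow> \<exists>h. [:- (\<zeta> ^ k), 1:] ^ M * g k = h * ([:0, 1:] ^ l - 1) ^ M"
    using root_of_unity_partition[OF \<zeta>, of M] by blast
  have lin: "L.pev [:- c, 1:] = L \<ominus> c \<odot> \<one>" for c
    using L.pev_diff[of "[:0, 1:]" "[:c:]"] by (simp add: L.pev_const del: L.pev_X) (simp add: L.pev_pCons smult_one scalar_zero smult_closed)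
  show thesis
  proof
    show "L.pev (g k) \<in> carrier A" for k by simp
    show "y \<otimes> L.pev (g k) = L.pev (g k) \<otimes> y" if "y \<in> carrier A" "y \<otimes> L = L \<otimes> y" for k y
      using that by (intro L.pev_commute) (simp_all add: smult_mult_left smult_mult_right)
    show "(L \<ominus> \<zeta> ^ k \<odot> \<one>) [^] M \<otimes> L.pev (g k) = \<zero>" if k: "k < l" for k
    proof -
      obtain h where h: "[:- (\<zeta> ^ k), 1:] ^ M * g k = h * ([:0, 1:] ^ l - 1) ^ M"
        using g(2)[OF k] by blast
      have "(L \<ominus> \<zeta> ^ k \<odot> \<one>) [^] M \<otimes> L.pev (g k) = L.pev ([:- (\<zeta> ^ k), 1:] ^ M * g k)"
        by (simp only: L.pev_mult L.pev_power lin)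
      also have "\<dots> = \<zero>"
        unfolding h using nil by (simp only: L.pev_mult L.pev_power L.pev_diff L.pev_X L.pev_one) simp
      finally show ?thesis .
    qed
    show "(\<Oplus>k\<in>{..<l}. L.pev (g k)) = \<one>"
      using L.pev_sum[of "{..<l}" g] g(1) by simp
  qed
qed

text \<open>\<open>X - c\<close> and \<open>X - d\<close> are comaximal, hence so are their powers;
  writing 1 as a combination of these powers in \<open>L\<close> and applying it to \<open>z\<close>
  leaves two summands, each killed by one hypothesis.\<close>

lemma distinct_weights:
  assumes [simp]: "L \<in> carrier A" "z \<in> carrier A" and neq: "c \<noteq> d"
    and c: "(L \<ominus> c \<odot> \<one>) [^] M \<otimes> z = \<zero>" and d: "(L \<ominus> d \<odot> \<one>) [^] (M::nat) \<otimes> z = \<zero>"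
  shows "z = \<zero>"
proof -
  interpret L: poly_eval A "\<lambda>c. c \<odot> \<one>" L by (rule poly_eval_scalar) simp
  have lin: "L.pev [:- c, 1:] = L \<ominus> c \<odot> \<one>" for c
    using L.pev_diff[of "[:0, 1:]" "[:c:]"] by (simp add: L.pev_const del: L.pev_X) (simp add: L.pev_pCons smult_one scalar_zero smult_closed)
  \<comment> \<open>Normalised to have sum 1, because
    \<open>(X - c) - (X - d) = d - c\<close>.\<close>
  define f where "f k = (if k then smult (1 / (d - c)) [:- c, 1:] else smult (- 1 / (d - c)) [:- d, 1:])"
    for k
  have "d / (d - c) - c / (d - c) = 1"
    using neq by (simp flip: diff_divide_distrib)
  then have "(\<Sum>k\<in>UNIV. f k) + 0 = 1"
    by (simp add: f_def UNIV_bool one_pCons)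
  from comaximal_powers[OF _ this, of M] obtain b where
    "(\<Sum>k\<in>UNIV. b k * f k ^ M) = 1" by auto
  then have "b True * f True ^ M + b False * f False ^ M = 1" by (simp add: UNIV_bool add.commute)
  then have "z = L.pev (b True * f True ^ M + b False * f False ^ M) \<otimes> z" by simp
  also have "\<dots> = L.pev (b True * [:(1 / (d - c)) ^ M:]) \<otimes> ((L \<ominus> c \<odot> \<one>) [^] M \<otimes> z)
      \<oplus> L.pev (b False * [:(- 1 / (d - c)) ^ M:]) \<otimes> ((L \<ominus> d \<odot> \<one>) [^] M \<otimes> z)"
  proof -
    have "b True * f True ^ M = b True * [:(1 / (d - c)) ^ M:] * [:- c, 1:] ^ M"
      "b False * f False ^ M = b False * [:(- 1 / (d - c)) ^ M:] * [:- d, 1:] ^ M"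
      by (simp_all add: f_def smult_power del: smult_pCons smult_minus_left)
    then show ?thesis
      by (simp only: L.pev_add L.pev_mult[of "_ * _" "_ ^ M"] L.pev_power lin)
        (simp add: l_distr m_assoc smult_closed)
  qed
  also have "\<dots> = \<zero>" unfolding c d by simp
  finally show ?thesis .
qed

end

section \<open>Jucys--Murphy elements\<close>

text \<open>Each summand on the right contains a factor that vanishes when \<open>a\<close>, \<open>b\<close>, \<open>T\<close> are specialised to
  \<open>L\<^sub>r\<close>, \<open>L\<^sub>r\<^sub>+\<^sub>1\<close>, \<open>T\<^sub>r\<close>; these are the Bernstein relations.\<close>

lemma intertwiner_certificate:
  fixes T a b t :: "'a :: ring_1"
  assumes "T * t = t * T" "a * t = t * a" "b * t = t * b"
  defines "f \<equiv> (b - a) * T - (t - 1) * b"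
  shows "f * a - b * f = (b - a) * (T * a - (b * T - (t - 1) * b))
      - (a * b - b * a) * T + (t - 1) * (a * b - b * a)" (is ?A)
    and "f * f - (t * b - a) * (t * a - b) =
      (b - a) * ((T * b - (a * T + (t - 1) * b)) - (T * a - (b * T - (t - 1) * b))) * T
      - (b - a) * (b - a) * (T * T - ((t - 1) * T + t))
      - (t - 1) * (b - a) * (T * b - (a * T + (t - 1) * b))
      - (t - 1) * (a * b - b * a) * T + (t * t - t) * (a * b - b * a)" (is ?B)
proof -
  have "T * (t * z) = t * (T * z)" "a * (t * z) = t * (a * z)" "b * (t * z) = t * (b * z)" for z
    using assms(1-3) by (metis mult.assoc)+
  with assms(1-3) show ?A ?B
    unfolding f_def by (simp_all add: algebra_simps)
qed

text \<open>For \<open>a = T_1\<close> and \<open>b = T_2\<close> the right side vanishes by the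
  quadratic and braid relations, and \<open>b a a b\<close> is \<open>t^2 L_3\<close>. What remains
  is the formula for \<open>L_3 - t^-1\<close> applied to \<open>T_1 + 1\<close>.\<close>

lemma sym3_certificate:
  fixes a b t :: "'a :: ring_1"
  assumes "a * t = t * a" "b * t = t * b"
  shows "b * a * a * b * (a + 1) - t * (a + 1)
      - t * (t - 1) * (a * b * a + a * b + b * a + a + b + 1) =
    (b * (a * a - ((t - 1) * a + t)) * b - (t - 1) * (a * b * a - b * a * b)
      + t * (b * b - ((t - 1) * b + t))) * (a + 1)
      + (t - 1) * a * b * (a * a - ((t - 1) * a + t))"
proof -
  have "a * (t * z) = t * (a * z)" "b * (t * z) = t * (b * z)" for z
    using assms by (metis mult.assoc)+
  with assms show ?thesis by (simp add: algebra_simps)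
qed

section \<open>Passing nilpotency along an intertwiner\<close>

context calgebra
begin

lemma minus_self: "x \<in> carrier A \<Longrightarrow> x \<ominus> x = \<zero>"
  by (simp add: a_minus_def r_neg)

lemma intertwine_pow:
  assumes "f \<in> carrier A" "x \<in> carrier A" "y \<in> carrier A" "f \<otimes> x = y \<otimes> f"
  shows "f \<otimes> x [^] (k::nat) = y [^] k \<otimes> f"
proof (induction k)
  case (Suc k)
  have "f \<otimes> x [^] Suc k = (f \<otimes> x [^] k) \<otimes> x" using assms by (simp add: m_assoc)
  also have "\<dots> = y [^] k \<otimes> (f \<otimes> x)" using assms by (simp add: Suc m_assoc)
  finally show ?case using assms by (simp add: m_assoc)
qed (use assms in simp)

lemma nilpotent_mono:
  assumes "x \<in> carrier A" "z \<in> carrier A" "x [^] (M::nat) \<otimes> z = \<zero>" "M \<le> N"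
  shows "x [^] N \<otimes> z = \<zero>"
proof -
  have "x [^] N = x [^] (N - M) \<otimes> x [^] M" using assms by (simp add: nat_pow_mult)
  then show ?thesis using assms by (simp add: m_assoc)
qed

text \<open>Both parts read off \<open>(z - t) (z + 1) = 0\<close>: each factor is an eigenvector
  for the root of the other.\<close>

lemma quad_eigen:
  assumes z: "z \<in> carrier A" and quad: "z \<otimes> z = (t - 1) \<odot> z \<oplus> t \<odot> \<one>"
  shows "z \<otimes> (z \<oplus> \<one>) = t \<odot> (z \<oplus> \<one>)"
    "z \<otimes> (t \<odot> \<one> \<ominus> z) = \<ominus> (t \<odot> \<one> \<ominus> z)"
proof -
  have 1: "(t - 1) \<odot> z \<oplus> z = t \<odot> z"
    using smult_l_distr[OF z, of "t - 1" 1] z by (simp add: smult_one)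
  have "z \<otimes> (z \<oplus> \<one>) = ((t - 1) \<odot> z \<oplus> z) \<oplus> t \<odot> \<one>"
    using z by (simp add: r_distr quad smult_closed a_ac)
  then show "z \<otimes> (z \<oplus> \<one>) = t \<odot> (z \<oplus> \<one>)"
    using z by (simp add: 1 smult_r_distr)
  have "z \<otimes> (t \<odot> \<one> \<ominus> z) = ((t - 1) \<odot> z \<oplus> z) \<ominus> ((t - 1) \<odot> z \<oplus> t \<odot> \<one>)"
    using z by (simp add: 1 a_minus_def r_distr r_minus quad smult_mult_right smult_closed)
  also have "\<dots> = \<ominus> (t \<odot> \<one> \<ominus> z)"
    using z by (simp add: a_minus_def minus_add smult_closed a_ac r_neg1 r_neg2 r_neg)
  finally show "z \<otimes> (t \<odot> \<one> \<ominus> z) = \<ominus> (t \<odot> \<one> \<ominus> z)" .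
qed

text \<open>An intertwiner \<open>f\<close> with \<open>f a = b f\<close> gives
  \<open>(b^l - 1)^N f^2 = f (a^l - 1)^N f = 0\<close>, and \<open>f^2\<close> is the product
  occurring in \<open>nilpotent_transfer\<close>. The hypotheses are modelled on \<open>T r\<close>,
  \<open>jm r\<close> and \<open>jm (Suc r)\<close>.\<close>

lemma bernstein_nilpotent:
  assumes [simp]: "T \<in> carrier A" "a \<in> carrier A" "b \<in> carrier A"
    and ab: "a \<otimes> b = b \<otimes> a"
    and quad: "T \<otimes> T = (t - 1) \<odot> T \<oplus> t \<odot> \<one>" and TaT: "T \<otimes> a \<otimes> T = t \<odot> b"
    and t0: "t \<noteq> 0" and t: "t ^ l = 1" and nil: "(a [^] l \<ominus> \<one>) [^] (N::nat) = \<zero>"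
  shows "(b [^] l \<ominus> \<one>) [^] Suc (2 * N) = \<zero>"
proof -
  have t_cancel: "x = y" if "t \<odot> x = t \<odot> y" "x \<in> carrier A" "y \<in> carrier A" for x y
    using arg_cong[OF that(1), of "\<lambda>z. inverse t \<odot> z"] that(2,3) t0
    by (simp add: smult_one flip: smult_assoc)
  \<comment> \<open>The two Bernstein relations: multiply \<open>T a T = t b\<close> by
    \<open>T\<close> on the right or on the left, reduce by the quadratic relation and cancel
    \<open>t\<close>.\<close>
  have Ta: "b \<otimes> T = T \<otimes> a \<oplus> (t - 1) \<odot> b"
  proof (rule t_cancel)
    have "t \<odot> (b \<otimes> T) = T \<otimes> a \<otimes> T \<otimes> T" unfolding TaT by (simp add: smult_mult_left)
    also have "\<dots> = T \<otimes> a \<otimes> (T \<otimes> T)" by (simp add: m_assoc)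
    also have "\<dots> = (t - 1) \<odot> (T \<otimes> a \<otimes> T) \<oplus> t \<odot> (T \<otimes> a)"
      unfolding quad by (simp add: r_distr smult_mult_right smult_closed)
    also have "\<dots> = t \<odot> (T \<otimes> a \<oplus> (t - 1) \<odot> b)"
      unfolding TaT by (simp add: smult_r_distr smult_closed a_comm mult.commute flip: smult_assoc)
    finally show "t \<odot> (b \<otimes> T) = t \<odot> (T \<otimes> a \<oplus> (t - 1) \<odot> b)" .
  qed (simp_all add: smult_closed)
  have Tb: "T \<otimes> b = a \<otimes> T \<oplus> (t - 1) \<odot> b"
  proof (rule t_cancel)
    have "t \<odot> (T \<otimes> b) = T \<otimes> (T \<otimes> a \<otimes> T)" unfolding TaT by (simp add: smult_mult_right)
    also have "\<dots> = (T \<otimes> T) \<otimes> (a \<otimes> T)" by (simp add: m_assoc)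
    also have "\<dots> = (t - 1) \<odot> (T \<otimes> a \<otimes> T) \<oplus> t \<odot> (a \<otimes> T)"
      unfolding quad by (simp add: l_distr smult_mult_left smult_closed m_assoc)
    also have "\<dots> = t \<odot> (a \<otimes> T \<oplus> (t - 1) \<odot> b)"
      unfolding TaT by (simp add: smult_r_distr smult_closed a_comm mult.commute flip: smult_assoc)
    finally show "t \<odot> (T \<otimes> b) = t \<odot> (a \<otimes> T \<oplus> (t - 1) \<odot> b)" .
  qed (simp_all add: smult_closed)
  define \<sigma> where "\<sigma> i = (if i = 0 then T else if i = 1 then a else b)" for i :: nat
  interpret \<sigma>: calgebra_assignment A \<sigma> by unfold_locales (simp add: \<sigma>_def)
  let ?T = "ncvar 0" and ?a = "ncvar 1" and ?b = "ncvar 2" and ?t = "ncconst t"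
  have \<sigma>: "\<sigma> 0 = T" "\<sigma> 1 = a" "\<sigma> (Suc 0) = a" "\<sigma> 2 = b" by (simp_all add: \<sigma>_def)
  have t1: "?t - 1 = ncconst (t - 1)" by (simp add: ncconst_diff ncconst_simps)
  have R1: "ncev \<sigma> (?T * ?b - (?a * ?T + (?t - 1) * ?b)) = \<zero>"
    unfolding t1 by (simp add: \<sigma>.ncev_simps \<sigma> Tb smult_mult_left smult_closed minus_self)
  have R2: "ncev \<sigma> (?T * ?a - (?b * ?T - (?t - 1) * ?b)) = \<zero>"
    unfolding t1 by (simp add: \<sigma>.ncev_simps \<sigma> Ta smult_mult_left smult_closed a_minus_def
        a_assoc r_neg minus_add)
  have R3: "ncev \<sigma> (?T * ?T - ((?t - 1) * ?T + ?t)) = \<zero>"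
    unfolding t1 by (simp add: \<sigma>.ncev_simps \<sigma> quad smult_mult_left smult_closed minus_self)
  have R4: "ncev \<sigma> (?a * ?b - ?b * ?a) = \<zero>"
    by (simp add: \<sigma>.ncev_simps \<sigma> ab minus_self)
  \<comment> \<open>The intertwiner \<open>T - (t - 1) b / (b - a)\<close>, multiplied by
    \<open>b - a\<close> to clear the denominator.\<close>
  let ?f = "(?b - ?a) * ?T - (?t - 1) * ?b"
  define f where "f = ncev \<sigma> ?f"
  have [simp]: "f \<in> carrier A" by (simp add: f_def)
  note cert = intertwiner_certificate[where T = ?T and a = ?a and b = ?b and t = ?t,
      OF ncvar_const_comm(1) ncvar_const_comm(1) ncvar_const_comm(1)]
  have fa: "f \<otimes> a = b \<otimes> f"
  proof (rule eq_of_minus_eq_zero)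
    have "f \<otimes> a \<ominus> b \<otimes> f = ncev \<sigma> (?f * ?a - ?b * ?f)"
      unfolding f_def by (simp only: \<sigma>.ncev_diff[of "_ * ?a"] \<sigma>.ncev_mult[of _ ?a] \<sigma>.ncev_mult[of ?b]
          \<sigma>.ncev_var \<sigma>)
    also have "\<dots> = \<zero>"
      unfolding cert(1) \<sigma>.ncev_add[of "_ - _"] \<sigma>.ncev_diff[of "_ * (_ - (_ - _))"]
        \<sigma>.ncev_mult[of "?b - ?a"] \<sigma>.ncev_mult[of "?t - 1"] \<sigma>.ncev_mult[of "?a * ?b - ?b * ?a"] R2 R4
      by (simp add: a_minus_def)
    finally show "f \<otimes> a \<ominus> b \<otimes> f = \<zero>" .
  qed simp_all
  have ff: "f \<otimes> f = (t \<odot> b \<ominus> a) \<otimes> (t \<odot> a \<ominus> b)"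
  proof (rule eq_of_minus_eq_zero)
    have "f \<otimes> f \<ominus> (t \<odot> b \<ominus> a) \<otimes> (t \<odot> a \<ominus> b) = ncev \<sigma> (?f * ?f - (?t * ?b - ?a) * (?t * ?a - ?b))"
      unfolding f_def \<sigma>.ncev_diff[of "?f * ?f"] \<sigma>.ncev_mult[of ?f]
      by (simp add: \<sigma>.ncev_diff[of "?t * _"] \<sigma>.ncev_mult \<sigma>.ncev_const smult_mult_left \<sigma>)
    also have "\<dots> = \<zero>"
    proof -
      \<comment> \<open>The shape of the certificate with its vanishing factors \<open>Y\<close>,
        \<open>Z\<close>, \<open>W\<close>, \<open>V\<close> abstracted, so that evaluation does not
        unfold them.\<close>
      have "ncev \<sigma> ((X * (Y - Z)) * U - X * X * W - S * X * Y - S * V * U + R * V) = \<zero>"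
        if "ncev \<sigma> Y = \<zero>" "ncev \<sigma> Z = \<zero>" "ncev \<sigma> W = \<zero>" "ncev \<sigma> V = \<zero>" for X Y Z U W S V R
        using that by (simp add: \<sigma>.ncev_simps a_minus_def)
      then show ?thesis unfolding cert(2) using R1 R2 R3 R4 by blast
    qed
    finally show "f \<otimes> f \<ominus> (t \<odot> b \<ominus> a) \<otimes> (t \<odot> a \<ominus> b) = \<zero>" .
  qed (simp_all add: smult_closed)
  have "f \<otimes> (a [^] l \<ominus> \<one>) = (b [^] l \<ominus> \<one>) \<otimes> f"
    using intertwine_pow[of f a b l] fa
    by (simp add: a_minus_def r_distr l_distr r_minus l_minus)
  then have "f \<otimes> (a [^] l \<ominus> \<one>) [^] N = (b [^] l \<ominus> \<one>) [^] N \<otimes> f"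
    by (intro intertwine_pow) simp_all
  moreover have "(b [^] l \<ominus> \<one>) [^] N \<otimes> (f \<otimes> f) = ((b [^] l \<ominus> \<one>) [^] N \<otimes> f) \<otimes> f"
    by (simp add: m_assoc)
  ultimately have "(b [^] l \<ominus> \<one>) [^] N \<otimes> (f \<otimes> f) = (f \<otimes> \<zero>) \<otimes> f"
    using nil by metis
  then have "(b [^] l \<ominus> \<one>) [^] N \<otimes> (f \<otimes> f) = \<zero>" by simp
  then show ?thesis
    unfolding ff by (intro nilpotent_transfer[of a b t l N] ab t nil) simp_all
qed

end

section \<open>Commutation, nilpotency and first eigenvalues of the Jucys-Murphy elements\<close>

context hecke
begin

primrec jm :: "nat \<Rightarrow> 'a" where
  "jm 0 = \<one>"
| "jm (Suc r) = (if r = 0 then \<one> else inverse t \<odot> (T r \<otimes> jm r \<otimes> T r))"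

lemma jm_closed [simp]: "r \<le> n \<Longrightarrow> jm r \<in> carrier A"
  by (induction r) (simp_all add: smult_closed)

text \<open>\<open>jm r\<close> is a scalar multiple of a word in the \<open>T i\<close> with
  \<open>i < r\<close>.\<close>

lemma commute_jm:
  assumes y: "y \<in> carrier A" "\<And>i. 0 < i \<Longrightarrow> i < r \<Longrightarrow> y \<otimes> T i = T i \<otimes> y" and "r \<le> n"
  shows "y \<otimes> jm r = jm r \<otimes> y"
  using assms(2,3)
proof (induction r)
  case (Suc r)
  show ?case
  proof (cases "r = 0")
    case False
    then have [simp]: "T r \<in> carrier A" using Suc.prems by (intro T_closed) simp
    have "y \<otimes> jm r = jm r \<otimes> y" "y \<otimes> T r = T r \<otimes> y" using Suc False by simp_all
    then have "y \<otimes> (T r \<otimes> jm r \<otimes> T r) = (T r \<otimes> jm r \<otimes> T r) \<otimes> y"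
      using y(1) Suc.prems by (intro commute_mult) simp_all
    then show ?thesis using False y(1) Suc.prems
      by (simp add: smult_mult_left smult_mult_right)
  qed (use y in simp)
qed (use y in simp)

text \<open>Far generators pass by commutation; the case that needs the braid relation is
  \<open>i = r - 2\<close>, where \<open>T i\<close> occurs inside \<open>jm r\<close>.\<close>

lemma T_jm_commute:
  assumes "i \<in> {1..<n}" "0 < r" "r \<le> n" "i \<noteq> r" "i + 1 \<noteq> r"
  shows "T i \<otimes> jm r = jm r \<otimes> T i"
  using assms
proof (induction r arbitrary: i rule: less_induct)
  case (less r)
  note Ti [simp] = T_closed[OF less.prems(1)]
  show ?case
  proof (cases "r = 1")
    case False
    then obtain s where s: "r = s + 1" "0 < s" using less.prems(2) by (metis Suc_eq_plus1 gr0_conv_Suc less_one not_less_eq One_nat_def)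
    have sn: "s \<in> {1..<n}" using s less.prems by simp
    note [simp] = T_closed[OF sn]
    have [simp]: "jm s \<in> carrier A" using sn by simp
    have "T i \<otimes> (T s \<otimes> jm s \<otimes> T s) = (T s \<otimes> jm s \<otimes> T s) \<otimes> T i"
    proof (cases "i + 1 = s")
      case False
      have "T i \<otimes> T s = T s \<otimes> T i" using less.prems s False by (intro far_comm sn) auto
      moreover have "T i \<otimes> jm s = jm s \<otimes> T i"
        using less.prems s False by (intro less.IH) auto
      ultimately show ?thesis by (intro commute_mult) simp_all
    next
      case True
      \<comment> \<open>Up to a scalar \<open>jm r\<close> is \<open>b a L a b\<close> with
        \<open>b L = L b\<close>, and
        \<open>a b a L a b = b a b L a b = b a L b a b = b a L a b a\<close>.\<close>
      define a b L where abL: "a = T i" "b = T s" "L = jm i"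
      have [simp]: "a \<in> carrier A" "b \<in> carrier A" "L \<in> carrier A"
        using less.prems by (simp_all add: abL)
      have aba: "a \<otimes> (b \<otimes> a) = b \<otimes> (a \<otimes> b)"
        using braid[OF less.prems(1)] sn by (simp add: True[symmetric] abL m_assoc)
      have aba': "a \<otimes> (b \<otimes> (a \<otimes> z)) = b \<otimes> (a \<otimes> (b \<otimes> z))" if "z \<in> carrier A" for z
        using arg_cong[OF aba, of "\<lambda>x. x \<otimes> z"] that by (simp add: m_assoc)
      have bL: "b \<otimes> L = L \<otimes> b"
        using less.IH[of i s] less.prems s sn True unfolding abL by simp
      have bL': "b \<otimes> (L \<otimes> z) = L \<otimes> (b \<otimes> z)" if "z \<in> carrier A" for z
        using arg_cong[OF bL, of "\<lambda>x. x \<otimes> z"] that by (simp add: m_assoc)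
      have "jm s = inverse t \<odot> (a \<otimes> L \<otimes> a)"
        using less.prems by (simp add: True[symmetric] abL)
      moreover have "a \<otimes> (b \<otimes> (a \<otimes> L \<otimes> a) \<otimes> b) = (b \<otimes> (a \<otimes> L \<otimes> a) \<otimes> b) \<otimes> a"
        by (simp add: m_assoc aba aba' bL bL')
      ultimately show ?thesis
        unfolding abL(1,2)[symmetric] by (simp add: smult_mult_left smult_mult_right)
    qed
    then show ?thesis using s by (simp add: smult_mult_left smult_mult_right)
  qed (use less.prems in simp)
qed

text \<open>For \<open>r < s\<close>, \<open>jm s\<close> commutes with every \<open>T i\<close>,
  \<open>i < r\<close>, and these are the letters of \<open>jm r\<close>.\<close>

lemma jm_commute:
  assumes "r \<le> n" "s \<le> n"
  shows "jm r \<otimes> jm s = jm s \<otimes> jm r"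
proof -
  have "jm s \<otimes> jm r = jm r \<otimes> jm s" if "r < s" "s \<le> n" for r s
    using that by (intro commute_jm) (auto intro!: T_jm_commute[symmetric])
  then show ?thesis using assms by (metis linorder_cases)
qed

text \<open>The exponent \<open>2^r - 1\<close> solves the recursion from N to
  \<open>2 N + 1\<close> of \<open>bernstein_nilpotent\<close>, starting with 1 at
  \<open>jm 1 = 1\<close>. It is finally relaxed to \<open>2^n\<close>, one bound for all
  \<open>r\<close>.\<close>

lemma jm_nilpotent:
  assumes t0: "t \<noteq> 0" and t: "t ^ l = 1" and r: "0 < r" "r \<le> n"
  shows "(jm r [^] l \<ominus> \<one>) [^] ((2::nat) ^ n) = \<zero>"
proof -
  have "(jm r [^] l \<ominus> \<one>) [^] ((2::nat) ^ r - 1) = \<zero>"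
    using r
  proof (induction r)
    case (Suc r)
    show ?case
    proof (cases "r = 0")
      case True
      then show ?thesis by (simp add: minus_self)
    next
      case False
      then have rn: "r \<in> {1..<n}" using Suc.prems by simp
      note [simp] = T_closed[OF rn]
      have [simp]: "jm r \<in> carrier A" using rn by simp
      have TaT: "T r \<otimes> jm r \<otimes> T r = t \<odot> jm (Suc r)"
        using False t0 by (simp add: smult_one flip: smult_assoc)
      have IH: "(jm r [^] l \<ominus> \<one>) [^] ((2::nat) ^ r - 1) = \<zero>" using Suc False by simp
      have "(jm (Suc r) [^] l \<ominus> \<one>) [^] Suc (2 * (2 ^ r - 1)) = \<zero>"
        by (rule bernstein_nilpotent[OF _ _ _ jm_commute quad[OF rn] TaT t0 t IH])
          (use Suc.prems in \<open>simp_all del: jm.simps\<close>)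
      moreover have "Suc (2 * (2 ^ r - 1)) = 2 ^ Suc r - 1"
      proof -
        have "(1::nat) \<le> 2 ^ r" by simp
        then show ?thesis unfolding power_Suc by arith
      qed
      ultimately show ?thesis by metis
    qed
  qed simp
  then have "(jm r [^] l \<ominus> \<one>) [^] ((2::nat) ^ r - 1) \<otimes> \<one> = \<zero>" using r by simp
  moreover have "(2::nat) ^ r - 1 \<le> 2 ^ n" using r power_increasing[of r n "2::nat"] by linarith
  ultimately show ?thesis using nilpotent_mono[of "jm r [^] l \<ominus> \<one>" \<one>] r by simp
qed

lemma jm_2: "1 < n \<Longrightarrow> jm 2 = inverse t \<odot> (T 1 \<otimes> T 1)"
  by (simp add: numeral_2_eq_2)

text \<open>\<open>jm 2\<close> is \<open>t^-1 T_1^2\<close>, and \<open>T_1\<close> acts on the two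
  elements by t and by -1.\<close>

lemma jm_2_eigen:
  assumes t0: "t \<noteq> 0" and n: "1 < n"
  shows "jm 2 \<otimes> (T 1 \<oplus> \<one>) = t \<odot> (T 1 \<oplus> \<one>)"
    "jm 2 \<otimes> (t \<odot> \<one> \<ominus> T 1) = inverse t \<odot> (t \<odot> \<one> \<ominus> T 1)"
proof -
  have T1: "1 \<in> {1..<n}" using n by simp
  note [simp] = T_closed[OF T1, simplified]
  have t3: "inverse t * (t * t) = t" using t0 by simp
  note 1 = quad_eigen[OF T_closed[OF T1] quad[OF T1]]
  show "jm 2 \<otimes> (T 1 \<oplus> \<one>) = t \<odot> (T 1 \<oplus> \<one>)"
    using 1(1) n by (simp add: t3 jm_2 smult_mult_left m_assoc smult_mult_right smult_closed smult_one flip: smult_assoc)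
  show "jm 2 \<otimes> (t \<odot> \<one> \<ominus> T 1) = inverse t \<odot> (t \<odot> \<one> \<ominus> T 1)"
    using 1(2) n by (simp add: jm_2 smult_mult_left m_assoc smult_closed r_minus)
qed

lemma jm_3_eigen:
  assumes t0: "t \<noteq> 0" and n: "2 < n"
  shows "(jm 3 \<ominus> inverse t \<odot> \<one>) \<otimes> (T 1 \<oplus> \<one>) = (inverse t * (t - 1)) \<odot> sym3 1 2"
    "jm 3 \<otimes> sym3 1 2 = t\<^sup>2 \<odot> sym3 1 2"
proof -
  define a b where ab: "a = T 1" "b = T 2"
  have mem: "1 \<in> {1..<n}" "2 \<in> {1..<n}" using n by simp_all
  have [simp]: "a \<in> carrier A" "b \<in> carrier A" using T_closed[OF mem(1)] T_closed[OF mem(2)] by (simp_all add: ab)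
  have qa: "a \<otimes> a = (t - 1) \<odot> a \<oplus> t \<odot> \<one>" and qb: "b \<otimes> b = (t - 1) \<odot> b \<oplus> t \<odot> \<one>"
    using quad[OF mem(1)] quad[OF mem(2)] by (simp_all add: ab)
  have br: "a \<otimes> b \<otimes> a = b \<otimes> a \<otimes> b"
    using braid[OF mem(1)] mem(2) by (simp add: ab numeral_2_eq_2)
  have s: "sym3 1 2 = a \<otimes> b \<otimes> a \<oplus> a \<otimes> b \<oplus> b \<otimes> a \<oplus> a \<oplus> b \<oplus> \<one>"
    by (simp add: sym3_def ab)
  have [simp]: "sym3 (Suc 0) 2 \<in> carrier A" using s by simp
  have t3: "inverse t * inverse t * t = inverse t" using t0 by simp
  have jm3: "jm 3 = (inverse t * inverse t) \<odot> (b \<otimes> a \<otimes> a \<otimes> b)"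
    using n by (simp add: numeral_3_eq_3 ab numeral_2_eq_2 smult_mult_left smult_mult_right m_assoc smult_assoc)
  define \<sigma> where "\<sigma> i = (if i = 0 then a else b)" for i :: nat
  interpret \<sigma>: calgebra_assignment A \<sigma> by unfold_locales (simp add: \<sigma>_def)
  have \<sigma>: "\<sigma> 0 = a" "\<sigma> 1 = b" "\<sigma> (Suc 0) = b" by (simp_all add: \<sigma>_def)
  let ?a = "ncvar 0" and ?b = "ncvar 1" and ?t = "ncconst t"
  have t1: "?t - 1 = ncconst (t - 1)" by (simp add: ncconst_diff ncconst_simps)
  have Ra: "ncev \<sigma> (?a * ?a - ((?t - 1) * ?a + ?t)) = \<zero>"
    and Rb: "ncev \<sigma> (?b * ?b - ((?t - 1) * ?b + ?t)) = \<zero>"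
    unfolding t1 by (simp_all add: \<sigma>.ncev_simps \<sigma> qa qb smult_mult_left smult_closed minus_self)
  have Rbr: "ncev \<sigma> (?a * ?b * ?a - ?b * ?a * ?b) = \<zero>"
    by (simp add: \<sigma>.ncev_simps \<sigma> br minus_self)
  have key: "b \<otimes> a \<otimes> a \<otimes> b \<otimes> (a \<oplus> \<one>) \<ominus> t \<odot> (a \<oplus> \<one>) = (t * (t - 1)) \<odot> sym3 1 2"
  proof (rule eq_of_minus_eq_zero)
    have "b \<otimes> a \<otimes> a \<otimes> b \<otimes> (a \<oplus> \<one>) \<ominus> t \<odot> (a \<oplus> \<one>) \<ominus> (t * (t - 1)) \<odot> sym3 1 2 =
      ncev \<sigma> (?b * ?a * ?a * ?b * (?a + 1) - ?t * (?a + 1)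
      - ?t * (?t - 1) * (?a * ?b * ?a + ?a * ?b + ?b * ?a + ?a + ?b + 1))"
      unfolding s t1 ncconst_simps(2)[symmetric]
      by (simp add: \<sigma>.ncev_add \<sigma>.ncev_diff \<sigma>.ncev_mult \<sigma>.ncev_const \<sigma> smult_mult_left)
    also have "\<dots> = \<zero>"
    proof -
      have "ncev \<sigma> ((X * Y * U - S * V + R * W) * Z + P * Y) = \<zero>"
        if "ncev \<sigma> Y = \<zero>" "ncev \<sigma> V = \<zero>" "ncev \<sigma> W = \<zero>" for X Y Z U W S V R P
        using that by (simp add: \<sigma>.ncev_simps a_minus_def)
      then show ?thesis
        unfolding sym3_certificate[OF ncvar_const_comm(1) ncvar_const_comm(1)]
        using Ra Rb Rbr by blast
    qed
    finally show "b \<otimes> a \<otimes> a \<otimes> b \<otimes> (a \<oplus> \<one>) \<ominus> t \<odot> (a \<oplus> \<one>) \<ominus> (t * (t - 1)) \<odot> sym3 1 2 = \<zero>" .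
  qed (simp_all add: s smult_closed)
  have "(jm 3 \<ominus> inverse t \<odot> \<one>) \<otimes> (a \<oplus> \<one>) =
      (inverse t * inverse t) \<odot> (b \<otimes> a \<otimes> a \<otimes> b \<otimes> (a \<oplus> \<one>) \<ominus> t \<odot> (a \<oplus> \<one>))"
    unfolding jm3
    by (simp add: t3 a_minus_def l_distr smult_mult_left smult_r_distr smult_minus l_minus
        smult_closed flip: smult_assoc)
  also have "\<dots> = (inverse t * (t - 1)) \<odot> sym3 1 2"
  proof -
    have "inverse t * inverse t * (t * (t - 1)) = inverse t * (t - 1)" using t0 by simp
    moreover have "sym3 1 2 \<in> carrier A" by simp
    ultimately show ?thesis unfolding key by (metis smult_assoc)
  qed
  finally show "(jm 3 \<ominus> inverse t \<odot> \<one>) \<otimes> (T 1 \<oplus> \<one>) = (inverse t * (t - 1)) \<odot> sym3 1 2"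
    by (simp add: ab)
  \<comment> \<open>Both \<open>T_1 + 1\<close> and \<open>T_2 + 1\<close> are left factors of
    \<open>sym3 1 2\<close>, so \<open>T_1\<close> and \<open>T_2\<close> act on it by
    \<open>t\<close>. The four letters of \<open>jm 3\<close> and its scalar \<open>t^-2\<close>
    together give \<open>t^2\<close>.\<close>
  have sa: "sym3 1 2 = (a \<oplus> \<one>) \<otimes> (b \<otimes> a \<oplus> b \<oplus> \<one>)"
    unfolding s by (simp add: l_distr r_distr m_assoc a_ac)
  have sb: "sym3 1 2 = (b \<oplus> \<one>) \<otimes> (a \<otimes> b \<oplus> a \<oplus> \<one>)"
    unfolding s br by (simp add: l_distr r_distr m_assoc a_ac)
  have "a \<otimes> sym3 1 2 = t \<odot> sym3 1 2"
    unfolding sa using quad_eigen(1)[OF _ qa] by (simp add: smult_mult_left flip: m_assoc)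
  moreover have "b \<otimes> sym3 1 2 = t \<odot> sym3 1 2"
    unfolding sb using quad_eigen(1)[OF _ qb] by (simp add: smult_mult_left flip: m_assoc)
  ultimately have "b \<otimes> a \<otimes> a \<otimes> b \<otimes> sym3 1 2 = (t * t * t * t) \<odot> sym3 1 2"
    by (simp add: m_assoc smult_mult_right smult_closed smult_assoc)
  then show "jm 3 \<otimes> sym3 1 2 = t\<^sup>2 \<odot> sym3 1 2"
    using t0 unfolding jm3 by (simp add: smult_mult_left power2_eq_square field_simps flip: smult_assoc)
qed

end

section \<open>Faithful matrix representations\<close>

lemma module_mat_homI:
  fixes f :: "'a \<Rightarrow> complex mat" and A (structure)
  assumes "\<And>x. x \<in> carrier A \<Longrightarrow> f x \<in> carrier_mat d d"
    "\<And>x y. x \<in> carrier A \<Longrightarrow> y \<in> carrier A \<Longrightarrow> f (x \<oplus> y) = f x + f y"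
    "\<And>x y. x \<in> carrier A \<Longrightarrow> y \<in> carrier A \<Longrightarrow> f (x \<otimes> y) = f x * f y"
    "f \<one> = 1\<^sub>m d"
    "\<And>x a. x \<in> carrier A \<Longrightarrow> f (a \<odot> x) = a \<cdot>\<^sub>m f x"
  shows "f \<in> calg_hom A (module_mat TYPE(complex) d d)"
  by (rule calg_homI) (simp_all add: module_mat_simps assms)

context calgebra
begin

definition cspan :: "'a set \<Rightarrow> 'a set" where
  "cspan B = {x. \<exists>c. x = (\<Oplus>b\<in>B. c b \<odot> b)}"

lemma cspan_csubspace:
  assumes B: "B \<subseteq> carrier A"
  shows "csubspace_of A (cspan B)"
proof (rule csubspaceI)
  have cl: "c b \<odot> b \<in> carrier A" if "b \<in> B" for c :: "'a \<Rightarrow> complex" and b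
    using B that by (auto simp: smult_closed)
  show "cspan B \<subseteq> carrier A" unfolding cspan_def using cl by (auto intro!: finsum_closed)
  have "(\<Oplus>b\<in>B. 0 \<odot> b) = (\<Oplus>b\<in>B. \<zero>)"
    using B by (intro finsum_cong') (auto simp: scalar_zero)
  then show "\<zero> \<in> cspan B" unfolding cspan_def by (auto intro!: exI[of _ "\<lambda>_. 0"])
  fix x assume "x \<in> cspan B"
  then obtain c where c: "x = (\<Oplus>b\<in>B. c b \<odot> b)" by (auto simp: cspan_def)
  have "a \<odot> x = (\<Oplus>b\<in>B. (a * c b) \<odot> b)" for a
  proof -
    have "a \<odot> x = (\<Oplus>b\<in>B. a \<odot> (c b \<odot> b))" unfolding c using cl by (intro smult_finsum) auto
    also have "\<dots> = (\<Oplus>b\<in>B. (a * c b) \<odot> b)"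
      using B by (intro finsum_cong') (auto simp: smult_assoc smult_closed)
    finally show ?thesis .
  qed
  then show "a \<odot> x \<in> cspan B" for a unfolding cspan_def by (intro CollectI exI)
  fix y assume "y \<in> cspan B"
  then obtain d where d: "y = (\<Oplus>b\<in>B. d b \<odot> b)" by (auto simp: cspan_def)
  have "x \<oplus> y = (\<Oplus>b\<in>B. c b \<odot> b \<oplus> d b \<odot> b)"
    unfolding c d using cl by (intro finsum_addf[symmetric]) auto
  also have "\<dots> = (\<Oplus>b\<in>B. (c b + d b) \<odot> b)"
    using B by (intro finsum_cong') (auto simp: smult_l_distr smult_closed)
  finally show "x \<oplus> y \<in> cspan B" unfolding cspan_def by (intro CollectI exI)
qed

lemma cspan_base:
  assumes "finite B" "B \<subseteq> carrier A" "b \<in> B"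
  shows "b \<in> cspan B"
proof -
  have b: "b \<in> carrier A" using assms by blast
  have "(\<Oplus>b'\<in>B. (if b' = b then 1 else 0) \<odot> b') = (\<Oplus>b'\<in>B. if b = b' then b' else \<zero>)"
    using assms by (intro finsum_cong') (auto simp: scalar_zero smult_one)
  also have "\<dots> = b"
    using add.finprod_singleton[of b B "\<lambda>b. b"] assms by auto
  finally have "b = (\<Oplus>b'\<in>B. (if b' = b then 1 else 0) \<odot> b')" ..
  then show ?thesis unfolding cspan_def by (intro CollectI exI)
qed

lemma cspan_image:
  assumes B: "B \<subseteq> carrier A" and y: "y \<in> carrier A" and W: "csubspace_of A W"
    and "\<And>b. b \<in> B \<Longrightarrow> b \<otimes> y \<in> W" and fin: "finite B" and "x \<in> cspan B"
  shows "x \<otimes> y \<in> W"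
proof -
  from assms obtain c where c: "x = (\<Oplus>b\<in>B. c b \<odot> b)" by (auto simp: cspan_def)
  have cl: "c b \<odot> b \<in> carrier A" if "b \<in> B" for b
    using B that by (auto simp: smult_closed)
  have "x \<otimes> y = (\<Oplus>b\<in>B. (c b \<odot> b) \<otimes> y)"
    unfolding c using cl y fin by (intro finsum_ldistr) auto
  moreover have "(c b \<odot> b) \<otimes> y \<in> W" if "b \<in> B" for b
  proof -
    have "(c b \<odot> b) \<otimes> y = c b \<odot> (b \<otimes> y)" using that B y by (intro smult_mult_left) auto
    then show ?thesis using csubspaceD(4)[OF W] assms(4)[OF that] by simp
  qed
  ultimately show ?thesis using csubspace_finsum[OF W, of B "\<lambda>b. (c b \<odot> b) \<otimes> y"] by simp
qed

lemma cspan_minimal: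
  assumes W: "csubspace_of A W" and "B \<subseteq> W"
  shows "cspan B \<subseteq> W"
proof
  fix x assume "x \<in> cspan B"
  then obtain c where "x = (\<Oplus>b\<in>B. c b \<odot> b)" by (auto simp: cspan_def)
  moreover have "c b \<odot> b \<in> W" if "b \<in> B" for b using csubspaceD(4)[OF W] that assms(2) by blast
  ultimately show "x \<in> W" using csubspace_finsum[OF W, of B "\<lambda>b. c b \<odot> b"] by simp
qed

definition coordinate_basis :: "(nat \<Rightarrow> 'a) \<Rightarrow> nat \<Rightarrow> bool" where
  "coordinate_basis h d \<longleftrightarrow> (\<forall>i<d. h i \<in> carrier A) \<and>
    (\<forall>x\<in>carrier A. \<exists>c. x = (\<Oplus>i\<in>{..<d}. c i \<odot> h i)) \<and>
    (\<forall>c. (\<Oplus>i\<in>{..<d}. c i \<odot> h i) = \<zero> \<longrightarrow> (\<forall>i<d. c i = 0))"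

text \<open>A spanning set of least cardinality is independent, since a nontrivial relation would
  allow one element to be removed.\<close>

lemma finite_basis:
  assumes "finite B0" "B0 \<subseteq> carrier A" "carrier A \<subseteq> cspan B0"
  shows "\<exists>h d. coordinate_basis h d"
proof -
  let ?P = "\<lambda>B. finite B \<and> B \<subseteq> carrier A \<and> carrier A \<subseteq> cspan B"
  obtain B where B: "finite B" "B \<subseteq> carrier A" "carrier A \<subseteq> cspan B"
    and min: "\<And>C. ?P C \<Longrightarrow> card B \<le> card C"
    using ex_has_least_nat[of ?P B0 card] assms by blast
  have indep: "c b = 0" if c: "(\<Oplus>b\<in>B. c b \<odot> b) = \<zero>" and b: "b \<in> B" for c b
  proof (rule ccontr)
    assume nz: "c b \<noteq> 0"
    let ?C = "B - {b}"
    have C: "finite ?C" "?C \<subseteq> carrier A" using B by auto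
    have W: "csubspace_of A (cspan ?C)" by (rule cspan_csubspace[OF C(2)])
    have cl: "c b \<odot> b \<in> carrier A" if "b \<in> B" for b using B that by (auto simp: smult_closed)
    define s where "s = (\<Oplus>b\<in>?C. c b \<odot> b)"
    have s: "s \<in> cspan ?C" unfolding s_def cspan_def by blast
    have sc: "s \<in> carrier A" using csubspaceD(1)[OF W] s by blast
    have "(\<Oplus>b\<in>insert b ?C. c b \<odot> b) = c b \<odot> b \<oplus> s"
      unfolding s_def using C cl b by (intro finsum_insert) auto
    moreover have "insert b ?C = B" using b by blast
    ultimately have "c b \<odot> b \<oplus> s = \<zero>" using c by simp
    then have "c b \<odot> b = \<ominus> s" using cl[OF b] sc minus_equality by metis
    then have "inverse (c b) \<odot> (c b \<odot> b) \<in> cspan ?C"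
      using csubspaceD(4)[OF W csubspaceD(5)[OF W s], of "inverse (c b)"] by simp
    moreover have "inverse (c b) \<odot> (c b \<odot> b) = b"
      using nz b B(2) by (auto simp: smult_one simp flip: smult_assoc)
    ultimately have "b \<in> cspan ?C" by simp
    then have "B \<subseteq> cspan ?C" using cspan_base[OF C] by blast
    then have "carrier A \<subseteq> cspan ?C" using cspan_minimal[OF W] B(3) by blast
    then have "card B \<le> card ?C" using min C by blast
    moreover have "card ?C < card B" using b B(1) by (intro psubset_card_mono) auto
    ultimately show False by simp
  qed
  obtain h where h: "bij_betw h {..<card B} B"
    using ex_bij_betw_nat_finite[OF B(1)] by (auto simp: atLeast0LessThan)
  have inj: "inj_on h {..<card B}" and im: "h ` {..<card B} = B"
    using h by (auto simp: bij_betw_def)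
  have hcl: "h i \<in> carrier A" if "i < card B" for i using that im B(2) by blast
  have reindex: "(\<Oplus>b\<in>B. c b \<odot> b) = (\<Oplus>i\<in>{..<card B}. c (h i) \<odot> h i)" for c
  proof -
    have "(\<lambda>b. c b \<odot> b) \<in> h ` {..<card B} \<rightarrow> carrier A"
      unfolding im using B(2) by (auto simp: smult_closed)
    from add.finprod_reindex[OF this inj] show ?thesis unfolding im by simp
  qed
  have "coordinate_basis h (card B)"
    unfolding coordinate_basis_def
  proof (intro conjI allI ballI impI)
    show "h i \<in> carrier A" if "i < card B" for i by (rule hcl[OF that])
    show "\<exists>c. x = (\<Oplus>i\<in>{..<card B}. c i \<odot> h i)" if "x \<in> carrier A" for x
    proof -
      obtain c where "x = (\<Oplus>b\<in>B. c b \<odot> b)" using B(3) \<open>x \<in> carrier A\<close> by (auto simp: cspan_def)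
      then show ?thesis unfolding reindex by (intro exI[of _ "\<lambda>i. c (h i)"])
    qed
    show "c i = 0" if z: "(\<Oplus>i\<in>{..<card B}. c i \<odot> h i) = \<zero>" and i: "i < card B" for c i
    proof -
      let ?c = "\<lambda>b. c (inv_into {..<card B} h b)"
      have "(\<Oplus>b\<in>B. ?c b \<odot> b) = (\<Oplus>i\<in>{..<card B}. ?c (h i) \<odot> h i)" by (rule reindex)
      also have "\<dots> = (\<Oplus>i\<in>{..<card B}. c i \<odot> h i)"
        using inj hcl by (intro finsum_cong') (auto simp: smult_closed)
      finally have "?c (h i) = 0" using indep[of ?c "h i"] z i im by auto
      then show ?thesis using inj i by simp
    qed
  qed
  then show ?thesis by blast
qed

text \<open>The left regular representation in coordinates. It is faithful because the algebra is
  unital: \<open>x\<close> is recovered from the products \<open>x \<otimes> h k\<close> by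
  expanding the unit in the basis.\<close>

lemma faithful_matrix_rep:
  assumes basis: "coordinate_basis h d"
  shows "\<exists>\<rho>\<in>calg_hom A (module_mat TYPE(complex) d d). \<forall>x\<in>carrier A. \<forall>y\<in>carrier A.
    (\<forall>v\<in>carrier_vec d. \<rho> x *\<^sub>v v = \<rho> y *\<^sub>v v) \<longrightarrow> x = y"
proof -
  note basis' = basis[unfolded coordinate_basis_def]
  have h_all: "\<forall>i<d. h i \<in> carrier A" by (rule conjunct1[OF basis'])
  have span_all: "\<forall>x\<in>carrier A. \<exists>c. x = (\<Oplus>i\<in>{..<d}. c i \<odot> h i)"
    by (rule conjunct1[OF conjunct2[OF basis']])
  have indep_all: "\<forall>c. (\<Oplus>i\<in>{..<d}. c i \<odot> h i) = \<zero> \<longrightarrow> (\<forall>i<d. c i = 0)"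
    by (rule conjunct2[OF conjunct2[OF basis']])
  have h: "h i \<in> carrier A" if "i < d" for i
    by (rule mp[OF spec[OF h_all] that])
  have span: "\<exists>c. x = (\<Oplus>i\<in>{..<d}. c i \<odot> h i)" if "x \<in> carrier A" for x
    by (rule bspec[OF span_all that])
  have indep: "c i = 0" if "(\<Oplus>i\<in>{..<d}. c i \<odot> h i) = \<zero>" "i < d" for c i
    by (rule mp[OF spec[OF mp[OF spec[OF indep_all] that(1)]] that(2)])
  define L where "L c = (\<Oplus>i\<in>{..<d}. c i \<odot> h i)" for c
  have hc: "c i \<odot> h i \<in> carrier A" if "i < d" for c :: "nat \<Rightarrow> complex" and i
    using h[OF that] by (rule smult_closed)
  have L_closed: "L c \<in> carrier A" for c
    unfolding L_def using hc by (intro finsum_closed) auto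
  have L_add: "L (\<lambda>i. c i + c' i) = L c \<oplus> L c'" for c c'
  proof -
    have "L (\<lambda>i. c i + c' i) = (\<Oplus>i\<in>{..<d}. c i \<odot> h i \<oplus> c' i \<odot> h i)"
      unfolding L_def using h by (intro finsum_cong') (auto simp: smult_l_distr smult_closed)
    also have "\<dots> = L c \<oplus> L c'" unfolding L_def using hc by (intro finsum_addf) auto
    finally show ?thesis .
  qed
  have L_smult: "L (\<lambda>i. a * c i) = a \<odot> L c" for a c
  proof -
    have "L (\<lambda>i. a * c i) = (\<Oplus>i\<in>{..<d}. a \<odot> (c i \<odot> h i))"
      unfolding L_def using h by (intro finsum_cong') (auto simp: smult_assoc smult_closed)
    also have "\<dots> = a \<odot> L c" unfolding L_def using hc by (intro smult_finsum[symmetric]) auto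
    finally show ?thesis .
  qed
  have L_inj: "c i = c' i" if "L c = L c'" "i < d" for c c' i
  proof -
    have "L (\<lambda>i. c i + (-1) * c' i) = \<zero>"
      unfolding L_add L_smult using that L_closed by (simp add: scalar_minus_one r_neg)
    then show ?thesis using indep[of "\<lambda>i. c i + (-1) * c' i" i] that(2) by (simp add: L_def)
  qed
  define co where "co x = (SOME c. x = L c)" for x
  have co: "L (co x) = x" if "x \<in> carrier A" for x
    using someI_ex[OF span[OF that, folded L_def]] by (simp add: co_def)
  have coL: "co (L c) i = c i" if "i < d" for c i
    using L_inj[of "co (L c)" c i] co[OF L_closed[of c]] that by simp
  have co_add: "co (x \<oplus> y) i = co x i + co y i" if "x \<in> carrier A" "y \<in> carrier A" "i < d" for x y i
  proof -
    have "x \<oplus> y = L (\<lambda>i. co x i + co y i)" unfolding L_add by (simp add: co that)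
    then show ?thesis using coL[OF that(3)] by simp
  qed
  have co_smult: "co (a \<odot> x) i = a * co x i" if "x \<in> carrier A" "i < d" for a x i
  proof -
    have "a \<odot> x = L (\<lambda>i. a * co x i)" unfolding L_smult by (simp add: co that)
    then show ?thesis using coL[OF that(2)] by simp
  qed
  have co_zero: "co \<zero> i = 0" if "i < d" for i
    using co_smult[of \<zero> i 0] that by (simp add: smult_zero)
  have co_sum: "co (\<Oplus>k\<in>K. z k) i = (\<Sum>k\<in>K. co (z k) i)"
    if "finite K" "z \<in> K \<rightarrow> carrier A" "i < d" for K :: "nat set" and z i
    using that by (induction K rule: finite_induct) (simp_all add: co_zero co_add Pi_iff)
  define \<rho> where "\<rho> x = mat d d (\<lambda>(i, j). co (x \<otimes> h j) i)" for x
  have dims [simp]: "dim_row (\<rho> x) = d" "dim_col (\<rho> x) = d" for x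
    by (simp_all add: \<rho>_def)
  have entry: "\<rho> x $$ (i, j) = co (x \<otimes> h j) i" if "i < d" "j < d" for x i j
    using that by (simp add: \<rho>_def)
  have \<rho>_smult: "\<rho> (a \<odot> x) = a \<cdot>\<^sub>m \<rho> x" if x: "x \<in> carrier A" for a x
  proof (rule eq_matI)
    fix i j assume "i < dim_row (a \<cdot>\<^sub>m \<rho> x)" "j < dim_col (a \<cdot>\<^sub>m \<rho> x)"
    then have ij: "i < d" "j < d" by simp_all
    have "co ((a \<odot> x) \<otimes> h j) i = a * co (x \<otimes> h j) i"
      using x h[OF ij(2)] ij(1) by (simp add: smult_mult_left co_smult)
    then show "\<rho> (a \<odot> x) $$ (i, j) = (a \<cdot>\<^sub>m \<rho> x) $$ (i, j)" using ij by (simp add: entry)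
  qed simp_all
  have \<rho>_add: "\<rho> (x \<oplus> y) = \<rho> x + \<rho> y" if x: "x \<in> carrier A" and y: "y \<in> carrier A" for x y
  proof (rule eq_matI)
    fix i j assume "i < dim_row (\<rho> x + \<rho> y)" "j < dim_col (\<rho> x + \<rho> y)"
    then have ij: "i < d" "j < d" by simp_all
    have "co ((x \<oplus> y) \<otimes> h j) i = co (x \<otimes> h j) i + co (y \<otimes> h j) i"
      using x y h[OF ij(2)] ij(1) by (simp add: l_distr co_add)
    then show "\<rho> (x \<oplus> y) $$ (i, j) = (\<rho> x + \<rho> y) $$ (i, j)" using ij by (simp add: entry)
  qed simp_all
  have \<rho>_mult: "\<rho> (x \<otimes> y) = \<rho> x * \<rho> y" if x: "x \<in> carrier A" and y: "y \<in> carrier A" for x y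
  proof (rule eq_matI)
    fix i j assume "i < dim_row (\<rho> x * \<rho> y)" "j < dim_col (\<rho> x * \<rho> y)"
    then have ij: "i < d" "j < d" by simp_all
    note hj = h[OF ij(2)]
    have "x \<otimes> y \<otimes> h j = x \<otimes> L (co (y \<otimes> h j))"
      using x y hj by (simp add: co m_assoc)
    also have "\<dots> = (\<Oplus>k\<in>{..<d}. x \<otimes> (co (y \<otimes> h j) k \<odot> h k))"
      unfolding L_def using x hc by (intro finsum_rdistr) auto
    also have "\<dots> = (\<Oplus>k\<in>{..<d}. co (y \<otimes> h j) k \<odot> (x \<otimes> h k))"
      using x h by (intro finsum_cong') (auto simp: smult_mult_right smult_closed)
    finally have "co (x \<otimes> y \<otimes> h j) i = (\<Sum>k<d. co (co (y \<otimes> h j) k \<odot> (x \<otimes> h k)) i)"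
      using x h ij(1) co_sum[of "{..<d}" "\<lambda>k. co (y \<otimes> h j) k \<odot> (x \<otimes> h k)" i]
      by (simp add: smult_closed Pi_iff)
    also have "\<dots> = (\<Sum>k<d. co (x \<otimes> h k) i * co (y \<otimes> h j) k)"
      using x h ij(1) by (intro sum.cong) (simp_all add: co_smult)
    also have "\<dots> = (\<rho> x * \<rho> y) $$ (i, j)"
      using ij by (simp add: scalar_prod_def atLeast0LessThan entry)
    finally show "\<rho> (x \<otimes> y) $$ (i, j) = (\<rho> x * \<rho> y) $$ (i, j)"
      using ij by (simp add: entry)
  qed simp_all
  have \<rho>_one: "\<rho> \<one> = 1\<^sub>m d"
  proof (rule eq_matI)
    fix i j assume "i < dim_row (1\<^sub>m d :: complex mat)" "j < dim_col (1\<^sub>m d :: complex mat)"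
    then have ij: "i < d" "j < d" by simp_all
    have "h j = (\<Oplus>i\<in>{..<d}. if j = i then h i else \<zero>)"
      using add.finprod_singleton[of j "{..<d}" h] ij h by auto
    also have "\<dots> = L (\<lambda>i. if i = j then 1 else 0)"
      unfolding L_def using h by (intro finsum_cong') (auto simp: smult_one scalar_zero)
    finally have "co (h j) i = (if i = j then 1 else 0)" using coL[OF ij(1)] by simp
    then show "\<rho> \<one> $$ (i, j) = 1\<^sub>m d $$ (i, j)" using ij h[OF ij(2)] by (simp add: entry)
  qed simp_all
  have \<rho>: "\<rho> \<in> calg_hom A (module_mat TYPE(complex) d d)"
    by (rule module_mat_homI[OF _ \<rho>_add \<rho>_mult \<rho>_one \<rho>_smult]) (rule carrier_matI[OF dims])
  have inj: "x = y" if xy: "x \<in> carrier A" "y \<in> carrier A"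
    and eq: "\<And>v. v \<in> carrier_vec d \<Longrightarrow> \<rho> x *\<^sub>v v = \<rho> y *\<^sub>v v" for x y
  proof -
    have xh: "x \<otimes> h j = y \<otimes> h j" if j: "j < d" for j
    proof -
      have col_entry: "(\<rho> z *\<^sub>v unit_vec d j) $ i = co (z \<otimes> h j) i" if "i < d" for z i
        using that j by (simp add: entry)
      have "co (x \<otimes> h j) i = co (y \<otimes> h j) i" if "i < d" for i
        using col_entry[OF that, of x] col_entry[OF that, of y] eq[of "unit_vec d j"] by simp
      then have "L (co (x \<otimes> h j)) = L (co (y \<otimes> h j))"
        unfolding L_def using h by (intro finsum_cong') (auto simp: smult_closed)
      then show ?thesis using co h[OF j] xy by simp
    qed
    have "z = (\<Oplus>k\<in>{..<d}. co \<one> k \<odot> (z \<otimes> h k))" if z: "z \<in> carrier A" for z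
    proof -
      have "z = z \<otimes> L (co \<one>)" using z by (simp add: co)
      also have "\<dots> = (\<Oplus>k\<in>{..<d}. z \<otimes> (co \<one> k \<odot> h k))"
        unfolding L_def using z hc by (intro finsum_rdistr) auto
      also have "\<dots> = (\<Oplus>k\<in>{..<d}. co \<one> k \<odot> (z \<otimes> h k))"
        using z h by (intro finsum_cong') (auto simp: smult_mult_right smult_closed)
      finally show ?thesis .
    qed
    moreover have "(\<Oplus>k\<in>{..<d}. co \<one> k \<odot> (x \<otimes> h k)) = (\<Oplus>k\<in>{..<d}. co \<one> k \<odot> (y \<otimes> h k))"
      using xh xy h by (intro finsum_cong') (auto simp: smult_closed)
    ultimately show ?thesis using xy by metis
  qed
  show ?thesis
  proof (intro bexI[OF _ \<rho>] ballI impI)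
    fix x y assume "x \<in> carrier A" "y \<in> carrier A" "\<forall>v\<in>carrier_vec d. \<rho> x *\<^sub>v v = \<rho> y *\<^sub>v v"
    then show "x = y" by (intro inj[of x y]) simp_all
  qed
qed

end

section \<open>Finite dimensionality of the Hecke algebra\<close>

context hecke
begin

text \<open>The descending word \<open>T_k T_(k-1) ... T_(k-m+1)\<close> with \<open>m\<close>
  letters. For \<open>m \<le> k\<close> these words belong to the shortest coset representatives of
  the symmetric group on \<open>k + 1\<close> letters modulo the one on \<open>k\<close>
  letters.\<close>

primrec desc :: "nat \<Rightarrow> nat \<Rightarrow> 'a" where
  "desc k 0 = \<one>"
| "desc k (Suc m) = desc k m \<otimes> T (k - m)"

lemma desc_closed [simp]: "k < n \<Longrightarrow> m \<le> k \<Longrightarrow> desc k m \<in> carrier A"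
proof (induction m)
  case (Suc m)
  then have "T (k - m) \<in> carrier A" by (intro T_closed) auto
  with Suc show ?case by simp
qed simp

lemma desc_T_far:
  assumes "k < n" "m \<le> k" "0 < i" "i < k - m"
  shows "desc k m \<otimes> T i = T i \<otimes> desc k m"
  using assms
proof (induction m)
  case 0
  then have "T i \<in> carrier A" by (intro T_closed) auto
  then show ?case by simp
next
  case (Suc m)
  then have c: "T i \<in> carrier A" "T (k - m) \<in> carrier A" "desc k m \<in> carrier A"
    by (auto intro!: T_closed)
  have "T (k - m) \<otimes> T i = T i \<otimes> T (k - m)" using Suc.prems by (intro far_comm) auto
  moreover have "desc k m \<otimes> T i = T i \<otimes> desc k m" using Suc by simp
  ultimately show ?case using c commute_mult[of "T i" "desc k m" "T (k - m)"] by simp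
qed

text \<open>Coming from the right, \<open>T i\<close> passes the low letters by commutation until it
  meets \<open>T_i T_(i-1)\<close>. The braid relation turns it into \<open>T_(i-1)\<close>, which
  commutes with the letters further left.\<close>

lemma desc_T_shift:
  assumes "k < n" "m \<le> k" "k - m + 1 < i" "i \<le> k"
  shows "desc k m \<otimes> T i = T (i - 1) \<otimes> desc k m"
  using assms
proof (induction m)
  case (Suc m)
  have mem: "i \<in> {1..<n}" "i - 1 \<in> {1..<n}" "k - m \<in> {1..<n}" using Suc.prems by auto
  note [simp] = T_closed[OF mem(1)] T_closed[OF mem(2), unfolded One_nat_def] T_closed[OF mem(3)]
  have [simp]: "desc k m \<in> carrier A" using Suc.prems by simp
  show ?case
  proof (cases "k - m + 1 < i")
    case True
    have "T (k - m) \<otimes> T i = T i \<otimes> T (k - m)" using True by (intro far_comm mem) auto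
    then have "desc k (Suc m) \<otimes> T i = (desc k m \<otimes> T i) \<otimes> T (k - m)" by (simp add: m_assoc)
    also have "\<dots> = T (i - 1) \<otimes> desc k (Suc m)" using Suc True by (simp add: m_assoc)
    finally show ?thesis .
  next
    case False
    have e: "k - m + 1 = i" using False Suc.prems by linarith
    then have "m \<noteq> 0" using Suc.prems by linarith
    then obtain p where m: "m = Suc p" using not0_implies_Suc by blast
    have p: "m = Suc p" "i = k - p" "k - m = i - 1" using e m Suc.prems by linarith+
    have [simp]: "desc k p \<in> carrier A" using Suc.prems p by simp
    have br: "T i \<otimes> T (i - 1) \<otimes> T i = T (i - 1) \<otimes> T i \<otimes> T (i - 1)"
      using braid[OF mem(2)] mem by simp
    have far: "desc k p \<otimes> T (i - 1) = T (i - 1) \<otimes> desc k p"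
      using Suc.prems p by (intro desc_T_far) auto
    have d: "desc k (Suc m) = desc k p \<otimes> T i \<otimes> T (i - 1)" using p by simp
    have "desc k (Suc m) \<otimes> T i = desc k p \<otimes> (T i \<otimes> T (i - 1) \<otimes> T i)" unfolding d by (simp add: m_assoc)
    also have "\<dots> = (desc k p \<otimes> T (i - 1)) \<otimes> T i \<otimes> T (i - 1)" unfolding br by (simp add: m_assoc)
    also have "\<dots> = T (i - 1) \<otimes> desc k (Suc m)" unfolding far d by (simp add: m_assoc)
    finally show ?thesis .
  qed
qed simp

text \<open>The subalgebra generated by \<open>T\<^sub>1, \<dots>, T\<^sub>k\<close> is spanned by the products of elements of the
  previous one with the words \<open>T\<^sub>k T\<^sub>k\<^sub>-\<^sub>1 \<dots> T\<^sub>j\<close>.\<close>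

lemma finite_spanning_step:
  assumes "k < n"
  shows "\<exists>B. finite B \<and> B \<subseteq> carrier A \<and> \<one> \<in> cspan B \<and>
    (\<forall>i x. 0 < i \<longrightarrow> i \<le> k \<longrightarrow> x \<in> cspan B \<longrightarrow> x \<otimes> T i \<in> cspan B)"
  using assms
proof (induction k)
  case 0
  show ?case by (intro exI[of _ "{\<one>}"]) (auto intro: cspan_base)
next
  case (Suc k)
  then obtain B where B: "finite B" "B \<subseteq> carrier A" "\<one> \<in> cspan B"
    and BT: "\<And>i x. 0 < i \<Longrightarrow> i \<le> k \<Longrightarrow> x \<in> cspan B \<Longrightarrow> x \<otimes> T i \<in> cspan B" by auto
  let ?k = "Suc k"
  define C where "C = (\<lambda>(b, m). b \<otimes> desc ?k m) ` (B \<times> {..?k})"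
  have C: "finite C" "C \<subseteq> carrier A" using B Suc.prems by (auto simp: C_def)
  have W: "csubspace_of A (cspan C)" by (rule cspan_csubspace[OF C(2)])
  have spanC: "x \<otimes> desc ?k m \<in> cspan C" if "x \<in> cspan B" "m \<le> ?k" for x m
  proof (rule cspan_image[OF B(2) _ W _ B(1) that(1)])
    show "desc ?k m \<in> carrier A" using that(2) Suc.prems by simp
    show "b \<otimes> desc ?k m \<in> cspan C" if "b \<in> B" for b
      using that \<open>m \<le> ?k\<close> by (intro cspan_base[OF C]) (auto simp: C_def)
  qed
  have bB: "b \<in> carrier A" "b \<in> cspan B" if "b \<in> B" for b
    using that B cspan_base[OF B(1,2)] by auto
  have "b \<otimes> desc ?k m \<otimes> T i \<in> cspan C" if b: "b \<in> B" and m: "m \<le> ?k" and i: "0 < i" "i \<le> ?k" for b m i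
  proof -
    have mem: "i \<in> {1..<n}" using i Suc.prems by simp
    note [simp] = T_closed[OF mem] bB(1)[OF b]
    have [simp]: "desc ?k m \<in> carrier A" using m Suc.prems by simp
    \<comment> \<open>A nonempty word ends in \<open>T (?k - m + 1)\<close>. Accordingly
      \<open>T i\<close> passes to the left of the word, lengthens it, is absorbed into its last
      letter by the quadratic relation, or crosses it as \<open>T (i - 1)\<close>.\<close>
    consider "i < ?k - m" | "i = ?k - m" | "i = ?k - m + 1" | "?k - m + 1 < i" by linarith
    then show ?thesis
    proof cases
      case 1
      then have "desc ?k m \<otimes> T i = T i \<otimes> desc ?k m" using m i Suc.prems by (intro desc_T_far)
      then have "b \<otimes> desc ?k m \<otimes> T i = (b \<otimes> T i) \<otimes> desc ?k m" by (simp add: m_assoc)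
      then show ?thesis using spanC[OF BT[OF i(1) _ bB(2)[OF b]] m] 1 by simp
    next
      case 2
      then have "desc ?k (Suc m) = desc ?k m \<otimes> T i" by simp
      then have "b \<otimes> desc ?k m \<otimes> T i = b \<otimes> desc ?k (Suc m)" by (simp only: m_assoc) (simp add: m_assoc)
      moreover have "Suc m \<le> ?k" using 2 i m by simp
      ultimately show ?thesis using spanC[OF bB(2)[OF b]] by metis
    next
      case 3
      then obtain p where p: "m = Suc p" using i by (cases m) auto
      have ip: "i = ?k - p" using 3 p m by simp
      have [simp]: "desc ?k p \<in> carrier A" using m p Suc.prems by simp
      have "b \<otimes> desc ?k m \<otimes> T i = b \<otimes> (desc ?k p \<otimes> (T i \<otimes> T i))"
        unfolding p by (simp add: m_assoc flip: ip)
      also have "\<dots> = (t - 1) \<odot> (b \<otimes> desc ?k m) \<oplus> t \<odot> (b \<otimes> desc ?k p)"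
        unfolding quad[OF mem] p by (simp add: r_distr smult_mult_right smult_closed flip: ip)
      also have "\<dots> \<in> cspan C"
        by (intro csubspaceD(3,4)[OF W] spanC[OF bB(2)[OF b]]) (use m p in simp_all)
      finally show ?thesis .
    next
      case 4
      then have "desc ?k m \<otimes> T i = T (i - 1) \<otimes> desc ?k m"
        using m i Suc.prems by (intro desc_T_shift)
      moreover have "T (i - 1) \<in> carrier A" using 4 i Suc.prems by (intro T_closed) auto
      ultimately have "b \<otimes> desc ?k m \<otimes> T i = (b \<otimes> T (i - 1)) \<otimes> desc ?k m" by (simp add: m_assoc)
      then show ?thesis using spanC[OF BT[OF _ _ bB(2)[OF b]] m, of "i - 1"] 4 i by simp
    qed
  qed
  then have CT: "c \<otimes> T i \<in> cspan C" if "c \<in> C" "0 < i" "i \<le> ?k" for c i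
    using that by (auto simp: C_def)
  have "x \<otimes> T i \<in> cspan C" if "0 < i" "i \<le> ?k" "x \<in> cspan C" for x i
  proof (rule cspan_image[OF C(2) _ W _ C(1) that(3)])
    show "T i \<in> carrier A" using that Suc.prems by (intro T_closed) auto
  qed (use CT that in blast)
  moreover have "\<one> \<in> cspan C" using spanC[OF B(3), of 0] by simp
  ultimately show ?case using C by blast
qed

lemma finite_spanning:
  obtains B where "finite B" "B \<subseteq> carrier A" "carrier A \<subseteq> cspan B"
proof -
  have "\<exists>B. finite B \<and> B \<subseteq> carrier A \<and> \<one> \<in> cspan B \<and>
    (\<forall>i x. i \<in> {1..<n} \<longrightarrow> x \<in> cspan B \<longrightarrow> x \<otimes> T i \<in> cspan B)"
  proof (cases n)
    case 0
    then show ?thesis by (intro exI[of _ "{\<one>}"]) (auto intro: cspan_base)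
  next
    case (Suc k)
    then obtain B where "finite B \<and> B \<subseteq> carrier A \<and> \<one> \<in> cspan B \<and>
      (\<forall>i x. 0 < i \<longrightarrow> i \<le> k \<longrightarrow> x \<in> cspan B \<longrightarrow> x \<otimes> T i \<in> cspan B)"
      using finite_spanning_step[of k] by auto
    with Suc show ?thesis by (intro exI[of _ B]) auto
  qed
  then obtain B where B: "finite B" "B \<subseteq> carrier A" "\<one> \<in> cspan B"
    and BT: "\<And>i x. i \<in> {1..<n} \<Longrightarrow> x \<in> cspan B \<Longrightarrow> x \<otimes> T i \<in> cspan B" by blast
  note W = cspan_csubspace[OF B(2)]
  have "x \<in> cspan B" if "x \<in> carrier A" for x
    using that
  proof (rule generated[of x "\<lambda>x. x \<in> cspan B"])
  qed (use B BT csubspaceD[OF W] in auto)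
  then show thesis using that B by blast
qed

end

section \<open>Weight idempotents\<close>

lemma primitive_root_power:
  assumes "l > 0" "0 < k" "k < l"
  shows "exp (2 * of_real pi * \<i> / of_nat l) ^ k \<noteq> 1"
proof
  let ?f = "\<lambda>k. cis (2 * pi * real k / real l)"
  assume eq: "exp (2 * of_real pi * \<i> / of_nat l) ^ k = 1"
  have "exp (2 * of_real pi * \<i> / of_nat l) = cis (2 * pi / real l)"
    by (simp add: cis_conv_exp mult.commute)
  with eq have "cis (2 * pi / real l) ^ k = 1" by simp
  then have "cis (real k * (2 * pi / real l)) = 1" unfolding DeMoivre .
  then have "?f k = ?f 0" by (simp add: mult.commute)
  moreover have "inj_on ?f {..<l}"
    using bij_betw_roots_unity[OF assms(1)] by (simp add: bij_betw_def)
  ultimately have "k = 0" using assms by (elim inj_onD) simp_all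
  with assms show False by simp
qed

lemma root_of_unity_power:
  assumes "l > 0"
  shows "exp (2 * of_real pi * \<i> / of_nat l) ^ l = 1"
proof -
  have "exp (2 * of_real pi * \<i> / of_nat l) ^ l = exp (of_nat l * (2 * of_real pi * \<i> / of_nat l))"
    by (rule exp_of_nat_mult[symmetric])
  also have "of_nat l * (2 * of_real pi * \<i> / of_nat l) = 2 * of_real pi * \<i>" using assms by simp
  also have "exp \<dots> = 1" by (rule exp_two_pi_i)
  finally show ?thesis .
qed

section \<open>Joint weight vectors of commuting elements\<close>

context calgebra
begin

lemma pow_mult_commute:
  assumes "x \<in> carrier A" "y \<in> carrier A" "y \<otimes> x = x \<otimes> y"
  shows "y \<otimes> x [^] (k::nat) = x [^] k \<otimes> y"
  using intertwine_pow[of y x x k] assms by simp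

lemma minus_scalar_commute:
  assumes "x \<in> carrier A" "y \<in> carrier A" "y \<otimes> x = x \<otimes> y"
  shows "y \<otimes> (x \<ominus> c \<odot> \<one>) = (x \<ominus> c \<odot> \<one>) \<otimes> y"
  using assms
  by (simp add: a_minus_def r_distr l_distr r_minus l_minus smult_mult_left smult_mult_right smult_closed)

text \<open>The elements \<open>L r\<close> are treated in turn, from the last to the first, each
  time splitting a summand by the spectral partition of the next one.\<close>

lemma joint_partition:
  fixes L :: "nat \<Rightarrow> 'a"
  assumes L: "\<And>r. r \<in> {1..n} \<Longrightarrow> L r \<in> carrier A"
    and comm: "\<And>r s. r \<in> {1..n} \<Longrightarrow> s \<in> {1..n} \<Longrightarrow> L r \<otimes> L s = L s \<otimes> L r"
    and nil: "\<And>r. r \<in> {1..n} \<Longrightarrow> (L r [^] l \<ominus> \<one>) [^] (M::nat) = \<zero>"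
    and \<zeta>: "l > 0" "\<zeta> ^ l = 1" "\<And>m. 0 < m \<Longrightarrow> m < l \<Longrightarrow> \<zeta> ^ m \<noteq> 1"
  shows "\<exists>z. (\<forall>i\<in>residue_seqs l n. z i \<in> carrier A \<and>
      (\<forall>r\<in>{1..n}. (L r \<ominus> \<zeta> ^ i r \<odot> \<one>) [^] M \<otimes> z i = \<zero>)) \<and>
    \<one> = (\<Oplus>i\<in>residue_seqs l n. z i)"
proof -
  let ?R = "residue_seqs l n"
  have fin: "finite ?R" by (simp add: residue_seqs_def finite_PiE)
  define kill where "kill r k h \<longleftrightarrow> (L r \<ominus> \<zeta> ^ k \<odot> \<one>) [^] M \<otimes> h = \<zero>" for r k h
  have D: "L r \<ominus> \<zeta> ^ k \<odot> \<one> \<in> carrier A" if "r \<in> {1..n}" for r k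
    using L[OF that] by (simp add: smult_closed)
  define fam where "fam z \<longleftrightarrow> (\<forall>i\<in>?R. z i \<in> carrier A \<and> (\<forall>r\<in>{1..n}. kill r (i r) (z i)))" for z
  \<comment> \<open>Sums with one weight vector for each residue sequence. That they form a subspace
    allows the pieces of a splitting to be recombined.\<close>
  define Z where "Z = {h. \<exists>z. fam z \<and> h = (\<Oplus>i\<in>?R. z i)}"
  have Z: "csubspace_of A Z"
  proof (rule csubspaceI)
    show "Z \<subseteq> carrier A" by (auto simp: Z_def fam_def intro!: finsum_closed)
    have "fam (\<lambda>_. \<zero>)" using D by (simp add: fam_def kill_def)
    then show "\<zero> \<in> Z" unfolding Z_def by (intro CollectI exI[of _ "\<lambda>_. \<zero>"]) simp
  next
    fix x y assume "x \<in> Z" "y \<in> Z"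
    then obtain z w where z: "fam z" "x = (\<Oplus>i\<in>?R. z i)" and w: "fam w" "y = (\<Oplus>i\<in>?R. w i)"
      by (auto simp: Z_def)
    have "fam (\<lambda>i. z i \<oplus> w i)" using z(1) w(1) D by (simp add: fam_def kill_def r_distr)
    moreover have "x \<oplus> y = (\<Oplus>i\<in>?R. z i \<oplus> w i)"
      using z w by (simp add: fam_def finsum_addf Pi_iff)
    ultimately show "x \<oplus> y \<in> Z" unfolding Z_def by (intro CollectI exI conjI)
  next
    fix x c assume "x \<in> Z"
    then obtain z where z: "fam z" "x = (\<Oplus>i\<in>?R. z i)" by (auto simp: Z_def)
    have "fam (\<lambda>i. c \<odot> z i)"
      using z(1) D by (simp add: fam_def kill_def smult_closed smult_mult_right smult_zero)
    moreover have "c \<odot> x = (\<Oplus>i\<in>?R. c \<odot> z i)"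
      using z by (simp add: fam_def smult_finsum Pi_iff)
    ultimately show "c \<odot> x \<in> Z" unfolding Z_def by (intro CollectI exI conjI)
  qed
  \<comment> \<open>\<open>m\<close> counts the elements still to be treated: for
    \<open>s > m\<close> the vector \<open>h\<close> already has a definite residue.\<close>
  have S: "h \<in> Z" if "m \<le> n" "h \<in> carrier A" "\<And>s. m < s \<Longrightarrow> s \<le> n \<Longrightarrow> \<exists>k<l. kill s k h" for m h
    using that
  proof (induction m arbitrary: h)
    case 0
    have "\<forall>s\<in>{1..n}. \<exists>k<l. kill s k h" using "0.prems"(3) by auto
    then obtain k where k: "\<And>s. s \<in> {1..n} \<Longrightarrow> k s < l \<and> kill s (k s) h" by metis
    define i where "i = restrict k {1..n}"
    have i: "i \<in> ?R" using k by (auto simp: i_def residue_seqs_def)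
    define z where "z j = (if i = j then h else \<zero>)" for j
    have "kill r (i r) h" if "r \<in> {1..n}" for r using k[OF that] that by (simp add: i_def)
    then have "fam z" using D "0.prems"(2) by (auto simp: fam_def z_def kill_def)
    moreover have "h = (\<Oplus>j\<in>?R. z j)"
      using add.finprod_singleton[OF i fin, of "\<lambda>_. h"] "0.prems"(2) by (simp add: z_def)
    ultimately show ?case unfolding Z_def by (intro CollectI exI conjI)
  next
    case (Suc m)
    let ?r = "Suc m"
    have r: "?r \<in> {1..n}" using Suc.prems by simp
    obtain g where g: "\<And>k. g k \<in> carrier A" "\<And>k. k < l \<Longrightarrow> (L ?r \<ominus> \<zeta> ^ k \<odot> \<one>) [^] M \<otimes> g k = \<zero>"
      "\<And>k y. y \<in> carrier A \<Longrightarrow> y \<otimes> L ?r = L ?r \<otimes> y \<Longrightarrow> y \<otimes> g k = g k \<otimes> y"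
      "(\<Oplus>k\<in>{..<l}. g k) = \<one>"
      by (rule spectral_partition[OF L[OF r] nil[OF r] \<zeta>(1,2)], erule (1) \<zeta>(3)) (rule that)
    have h: "h \<in> carrier A" by (rule Suc.prems(2))
    have gk: "g k \<otimes> h \<in> Z" if k: "k < l" for k
    proof (rule Suc.IH)
      show "m \<le> n" "g k \<otimes> h \<in> carrier A" using Suc.prems g(1) by simp_all
      fix s assume s: "m < s" "s \<le> n"
      show "\<exists>k'<l. kill s k' (g k \<otimes> h)"
      proof (cases "s = ?r")
        case True
        have "kill s k (g k \<otimes> h)"
          using g(2)[OF k] g(1) h D[OF r] unfolding kill_def True by (simp flip: m_assoc)
        then show ?thesis using k by blast
      next
        case False
        then have s': "s \<in> {1..n}" "?r < s" using s by simp_all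
        then obtain k' where k': "k' < l" "kill s k' h" using Suc.prems(3) s by blast
        let ?D = "(L s \<ominus> \<zeta> ^ k' \<odot> \<one>) [^] M"
        have Dc: "?D \<in> carrier A" using D[OF s'(1)] by simp
        \<comment> \<open>Residues obtained earlier survive multiplication by \<open>g k\<close>,
          because \<open>g k\<close> commutes with all that commutes with
          \<open>L ?r\<close>.\<close>
        have "L ?r \<otimes> ?D = ?D \<otimes> L ?r"
          using L[OF r] L[OF s'(1)] D[OF s'(1)] comm[OF r s'(1)]
          by (intro pow_mult_commute minus_scalar_commute)
        then have "?D \<otimes> g k = g k \<otimes> ?D" using g(3)[OF Dc] by simp
        then have "?D \<otimes> (g k \<otimes> h) = g k \<otimes> (?D \<otimes> h)" using g(1) h Dc by (metis m_assoc)
        also have "\<dots> = \<zero>" using k'(2) g(1) by (simp add: kill_def)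
        finally show ?thesis using k'(1) by (auto simp: kill_def)
      qed
    qed
    have "(\<Oplus>k\<in>{..<l}. g k \<otimes> h) = \<one> \<otimes> h"
      unfolding g(4)[symmetric] using g(1) h by (intro finsum_ldistr[symmetric]) auto
    then have "h = (\<Oplus>k\<in>{..<l}. g k \<otimes> h)" using h by simp
    also have "\<dots> \<in> Z" using gk by (intro csubspace_finsum[OF Z]) simp
    finally show ?case .
  qed
  have "\<one> \<in> Z" by (rule S[of n]) simp_all
  then show ?thesis by (simp add: Z_def fam_def kill_def)
qed

end

text \<open>\<open>e_fixes\<close> is the module condition on the idempotents read in the left
  regular module; the exponent is the uniform bound of \<open>jm_nilpotent\<close>.\<close>

locale hecke_weights = hecke +
  fixes l :: nat and e :: "(nat \<Rightarrow> nat) \<Rightarrow> 'a"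
  assumes l_odd: "odd l" and l_ge: "l \<ge> 3"
    and t_pow: "t ^ l = 1" and t_prim: "0 < m \<Longrightarrow> m < l \<Longrightarrow> t ^ m \<noteq> 1"
    and e_closed: "i \<in> residue_seqs l n \<Longrightarrow> e i \<in> carrier A"
    and e_mult: "i \<in> residue_seqs l n \<Longrightarrow> j \<in> residue_seqs l n \<Longrightarrow>
      e i \<otimes> e j = (if i = j then e i else \<zero>)"
    and e_fixes: "i \<in> residue_seqs l n \<Longrightarrow> z \<in> carrier A \<Longrightarrow>
      (\<And>r. r \<in> {1..n} \<Longrightarrow> (jm r \<ominus> t ^ i r \<odot> \<one>) [^] ((2::nat) ^ n) \<otimes> z = \<zero>) \<Longrightarrow> e i \<otimes> z = z"
begin

abbreviation "R \<equiv> residue_seqs l n"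

lemma finite_R: "finite R" by (simp add: residue_seqs_def finite_PiE)

lemma t_nz: "t \<noteq> 0"
  using t_pow l_ge by (auto simp: power_0_left)

lemma t_inj: "j < l \<Longrightarrow> k < l \<Longrightarrow> t ^ j = t ^ k \<Longrightarrow> j = k"
proof -
  have "j = k" if "j \<le> k" "k < l" "t ^ j = t ^ k" for j k
  proof -
    have "t ^ k = t ^ j * t ^ (k - j)" using that(1) power_add[of t j "k - j"] by simp
    then have "t ^ (k - j) = 1" using that(3) t_nz by simp
    then show ?thesis using t_prim[of "k - j"] that by (cases "k = j") auto
  qed
  then show "j < l \<Longrightarrow> k < l \<Longrightarrow> t ^ j = t ^ k \<Longrightarrow> j = k" by (metis nat_le_linear)
qed

lemma t_last: "inverse t = t ^ (l - 1)"
proof (rule inverse_unique)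
  have "t * t ^ (l - 1) = t ^ Suc (l - 1)" by simp
  also have "Suc (l - 1) = l" using l_ge by simp
  finally show "t * t ^ (l - 1) = 1" using t_pow by simp
qed

definition kill :: "nat \<Rightarrow> nat \<Rightarrow> 'a \<Rightarrow> bool" where
  "kill r k z \<longleftrightarrow> (jm r \<ominus> t ^ k \<odot> \<one>) [^] ((2::nat) ^ n) \<otimes> z = \<zero>"

lemma D_closed: "r \<le> n \<Longrightarrow> jm r \<ominus> c \<odot> \<one> \<in> carrier A"
  by (simp add: smult_closed)

lemma e_fixes_weight:
  "i \<in> R \<Longrightarrow> z \<in> carrier A \<Longrightarrow> (\<And>r. r \<in> {1..n} \<Longrightarrow> kill r (i r) z) \<Longrightarrow> e i \<otimes> z = z"
  unfolding kill_def by (rule e_fixes)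

text \<open>The summands \<open>g i\<close> of a joint partition of 1 must be the given idempotents:
  by \<open>e_fixes\<close> and orthogonality \<open>e i\<close> fixes \<open>g i\<close> and kills
  every other \<open>g j\<close>, so multiplying the partition by \<open>e i\<close> yields
  \<open>e i = g i\<close>.\<close>

lemma e_weight_and_sum:
  shows "\<And>i r. i \<in> R \<Longrightarrow> r \<in> {1..n} \<Longrightarrow> kill r (i r) (e i)" and "(\<Oplus>i\<in>R. e i) = \<one>"
proof -
  have "\<exists>z. (\<forall>i\<in>R. z i \<in> carrier A \<and> (\<forall>r\<in>{1..n}. kill r (i r) (z i))) \<and> \<one> = (\<Oplus>i\<in>R. z i)"
    unfolding kill_def
  proof (rule joint_partition)
    fix r s assume r: "r \<in> {1..n}"
    then show "jm r \<in> carrier A" by simp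
    show "(jm r [^] l \<ominus> \<one>) [^] ((2::nat) ^ n) = \<zero>"
      using r by (intro jm_nilpotent t_nz t_pow) simp_all
    assume "s \<in> {1..n}"
    with r show "jm r \<otimes> jm s = jm s \<otimes> jm r" by (intro jm_commute) simp_all
  qed (use l_ge t_pow t_prim in simp_all)
  then obtain g where g: "\<And>i. i \<in> R \<Longrightarrow> g i \<in> carrier A" "\<And>i r. i \<in> R \<Longrightarrow> r \<in> {1..n} \<Longrightarrow> kill r (i r) (g i)"
    "\<one> = (\<Oplus>i\<in>R. g i)" by blast
  have eg: "e i = g i" if i: "i \<in> R" for i
  proof -
    have *: "e i \<otimes> g j = (if i = j then g j else \<zero>)" if j: "j \<in> R" for j
    proof -
      have "e j \<otimes> g j = g j" by (rule e_fixes_weight[OF j g(1)[OF j] g(2)[OF j]])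
      then have "e i \<otimes> g j = (e i \<otimes> e j) \<otimes> g j"
        using m_assoc[OF e_closed[OF i] e_closed[OF j] g(1)[OF j]] by simp
      then show ?thesis using e_mult[OF i j] g(1)[OF j] \<open>e j \<otimes> g j = g j\<close> by auto
    qed
    have "e i = e i \<otimes> (\<Oplus>j\<in>R. g j)" using e_closed[OF i] g(3)[symmetric] by simp
    also have "\<dots> = (\<Oplus>j\<in>R. e i \<otimes> g j)"
      using finite_R e_closed[OF i] g(1) by (intro finsum_rdistr) auto
    also have "\<dots> = (\<Oplus>j\<in>R. if i = j then g j else \<zero>)"
      using g(1) by (intro finsum_cong') (auto simp: *)
    also have "\<dots> = g i"
      using g(1) by (intro add.finprod_singleton[OF i finite_R]) auto
    finally show ?thesis .
  qed
  show "kill r (i r) (e i)" if "i \<in> R" "r \<in> {1..n}" for i r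
    using g(2)[OF that] eg[OF that(1)] by simp
  have "(\<Oplus>i\<in>R. e i) = (\<Oplus>i\<in>R. g i)"
    using g(1) eg by (intro finsum_cong') auto
  then show "(\<Oplus>i\<in>R. e i) = \<one>" using g(3)[symmetric] by simp
qed

lemma decompose:
  assumes z: "z \<in> carrier A"
  shows "z = (\<Oplus>i\<in>R. e i \<otimes> z)" "z = (\<Oplus>i\<in>R. z \<otimes> e i)"
proof -
  have "(\<Oplus>i\<in>R. e i \<otimes> z) = (\<Oplus>i\<in>R. e i) \<otimes> z"
    using finite_R z e_closed by (intro finsum_ldistr[symmetric]) auto
  then show "z = (\<Oplus>i\<in>R. e i \<otimes> z)" using z e_weight_and_sum(2) by simp
  have "(\<Oplus>i\<in>R. z \<otimes> e i) = z \<otimes> (\<Oplus>i\<in>R. e i)"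
    using finite_R z e_closed by (intro finsum_rdistr[symmetric]) auto
  then show "z = (\<Oplus>i\<in>R. z \<otimes> e i)" using z e_weight_and_sum(2) by simp
qed

text \<open>Since the \<open>L_s\<close> commute, \<open>jm r \<otimes> e j\<close> is again of
  weight \<open>j\<close>, hence fixed by \<open>e j\<close> and killed by the other idempotents.
  Summing \<open>e i \<otimes> jm r \<otimes> e j\<close> over \<open>j\<close> leaves only the term
  \<open>j = i\<close>.\<close>

lemma jm_e_commute:
  assumes r: "r \<in> {1..n}" and i: "i \<in> R"
  shows "e i \<otimes> jm r = jm r \<otimes> e i"
proof -
  have L: "jm r \<in> carrier A" using r by simp
  have Le: "e j \<otimes> (jm r \<otimes> e j) = jm r \<otimes> e j" if j: "j \<in> R" for j
  proof (rule e_fixes_weight[OF j])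
    show "jm r \<otimes> e j \<in> carrier A" using L e_closed[OF j] by simp
    fix s assume s: "s \<in> {1..n}"
    let ?D = "(jm s \<ominus> t ^ j s \<odot> \<one>) [^] ((2::nat) ^ n)"
    have Dc: "?D \<in> carrier A" using D_closed[of s] s by simp
    have "jm r \<otimes> ?D = ?D \<otimes> jm r"
      using r s D_closed[of s]
      by (intro pow_mult_commute minus_scalar_commute jm_commute) simp_all
    then have "?D \<otimes> (jm r \<otimes> e j) = jm r \<otimes> (?D \<otimes> e j)"
      using L Dc e_closed[OF j] m_assoc by metis
    also have "\<dots> = \<zero>" using e_weight_and_sum(1)[OF j s] L by (simp add: kill_def)
    finally show "kill s (j s) (jm r \<otimes> e j)" by (simp add: kill_def)
  qed
  have *: "(e i \<otimes> jm r) \<otimes> e j = (if i = j then jm r \<otimes> e j else \<zero>)" if j: "j \<in> R" for j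
  proof -
    have "(e i \<otimes> jm r) \<otimes> e j = e i \<otimes> (e j \<otimes> (jm r \<otimes> e j))"
      unfolding Le[OF j] using L e_closed i j by (simp add: m_assoc)
    also have "\<dots> = (e i \<otimes> e j) \<otimes> (jm r \<otimes> e j)"
      using L e_closed i j by (simp add: m_assoc)
    also have "\<dots> = (if i = j then jm r \<otimes> e j else \<zero>)"
      using e_mult[OF i j] L e_closed[OF j] Le[OF j] by simp
    finally show ?thesis .
  qed
  have "e i \<otimes> jm r = (\<Oplus>j\<in>R. (e i \<otimes> jm r) \<otimes> e j)"
    using L e_closed[OF i] by (intro decompose(2)) simp
  also have "\<dots> = (\<Oplus>j\<in>R. if i = j then jm r \<otimes> e j else \<zero>)"
    using L e_closed by (intro finsum_cong') (auto simp: *)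
  also have "\<dots> = jm r \<otimes> e i"
    using L e_closed by (intro add.finprod_singleton[OF i finite_R]) auto
  finally show ?thesis .
qed

lemma R_less: "i \<in> R \<Longrightarrow> r \<in> {1..n} \<Longrightarrow> i r < l"
  by (auto simp: residue_seqs_def PiE_iff)

text \<open>The product inherits the residue \<open>i r\<close> from \<open>e i\<close> and, because
  \<open>e i\<close> commutes with \<open>jm r\<close>, the residue \<open>k\<close> from
  \<open>z\<close>; distinct residues have distinct powers of \<open>t\<close>.\<close>

lemma e_annihilates:
  assumes i: "i \<in> R" and r: "r \<in> {1..n}" and z: "z \<in> carrier A" and k: "k < l" "kill r k z" and neq: "i r \<noteq> k"
  shows "e i \<otimes> z = \<zero>"
proof (rule distinct_weights)
  have L: "jm r \<in> carrier A" using r by simp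
  have D: "(jm r \<ominus> c \<odot> \<one>) [^] (m::nat) \<in> carrier A" for c m
    using D_closed[of r] r by simp
  show "jm r \<in> carrier A" "e i \<otimes> z \<in> carrier A" using L e_closed[OF i] z by simp_all
  show "t ^ i r \<noteq> t ^ k" using t_inj[OF R_less[OF i r] k(1)] neq by blast
  show "(jm r \<ominus> t ^ i r \<odot> \<one>) [^] ((2::nat) ^ n) \<otimes> (e i \<otimes> z) = \<zero>"
    using e_weight_and_sum(1)[OF i r] D e_closed[OF i] z by (simp add: kill_def flip: m_assoc)
  have "e i \<otimes> (jm r \<ominus> t ^ k \<odot> \<one>) [^] ((2::nat) ^ n) =
      (jm r \<ominus> t ^ k \<odot> \<one>) [^] ((2::nat) ^ n) \<otimes> e i"
    using L e_closed[OF i] D_closed[of r] r jm_e_commute[OF r i]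
    by (intro pow_mult_commute minus_scalar_commute) simp_all
  then have "(jm r \<ominus> t ^ k \<odot> \<one>) [^] ((2::nat) ^ n) \<otimes> (e i \<otimes> z) =
      e i \<otimes> ((jm r \<ominus> t ^ k \<odot> \<one>) [^] ((2::nat) ^ n) \<otimes> z)"
    using D e_closed[OF i] z m_assoc by metis
  also have "\<dots> = \<zero>" using k(2) e_closed[OF i] by (simp add: kill_def)
  finally show "(jm r \<ominus> t ^ k \<odot> \<one>) [^] ((2::nat) ^ n) \<otimes> (e i \<otimes> z) = \<zero>" .
qed

end

section \<open>The theorem\<close>

lemma (in calgebra) nat_pow_two: "x \<in> carrier A \<Longrightarrow> x [^] (2::nat) = x \<otimes> x"
  by (simp add: numeral_2_eq_2)

text \<open>The sum in \<open>y_in_G\<close> is the nilpotent element y_3 of the Brundan-Kleshchev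
  generators.\<close>

locale hecke_weights_graded = hecke_weights +
  fixes G :: "int \<Rightarrow> 'a set"
  assumes G_graded: "graded_algebra A G"
    and e_in_G: "i \<in> residue_seqs l n \<Longrightarrow> e i \<in> G 0"
    and y_in_G: "3 \<le> n \<Longrightarrow>
      (\<Oplus>i\<in>residue_seqs l n. (\<one> \<ominus> inverse (t ^ i 3) \<odot> jm 3) \<otimes> e i) \<in> G 2"
begin

lemma G_subspace: "csubspace_of A (G k)"
  using G_graded unfolding graded_algebra_def is_direct_sum_iff by blast

lemma G_mult: "x \<in> G j \<Longrightarrow> y \<in> G k \<Longrightarrow> x \<otimes> y \<in> G (j + k)"
  using G_graded unfolding graded_algebra_def by blast

lemma kill_eigen:
  assumes r: "r \<in> {1..n}" and z: "z \<in> carrier A"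
    and eigen: "jm r \<otimes> z = t ^ k \<odot> z"
  shows "kill r k z"
  unfolding kill_def
proof (rule nilpotent_mono[OF D_closed z])
  show "r \<le> n" using r by simp
  have "(jm r \<ominus> t ^ k \<odot> \<one>) \<otimes> z = jm r \<otimes> z \<ominus> t ^ k \<odot> z"
    using r z by (simp add: a_minus_def l_distr l_minus smult_mult_left smult_closed)
  then show "(jm r \<ominus> t ^ k \<odot> \<one>) [^] (1::nat) \<otimes> z = \<zero>"
    using eigen z D_closed[of r] r by (simp add: minus_self smult_closed)
qed simp

lemma sym3_homogeneous:
  assumes n: "3 \<le> n"
  shows "\<exists>k. sym3 1 2 \<in> G k"
proof -
  have mem: "1 \<in> {1..<n}" "2 \<in> {1..<n}" using n by simp_all
  define x where "x = sym3 1 2"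
  define p where "p = T 1 \<oplus> \<one>"
  define p' where "p' = t \<odot> \<one> \<ominus> T 1"
  define L where "L = jm 3"
  have T1: "T 1 \<in> carrier A" by (rule T_closed[OF mem(1)])
  have x [simp]: "x \<in> carrier A" unfolding x_def by (rule sym3_closed[OF mem])
  have p [simp]: "p \<in> carrier A" using T1 by (simp add: p_def)
  have p' [simp]: "p' \<in> carrier A" using T1 by (simp add: p'_def smult_closed)
  have L [simp]: "L \<in> carrier A" unfolding L_def using n by simp
  \<comment> \<open>\<open>p + p'\<close> is the scalar \<open>1 + t\<close>, and for
    \<open>jm 2\<close> the two have residues 1 and \<open>l - 1\<close>, which differ as
    \<open>l \<ge> 3\<close>. Hence each \<open>e i\<close> kills \<open>p\<close> or
    \<open>p'\<close>.\<close>
  have p_eq: "p = (1 + t) \<odot> \<one> \<ominus> p'"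
    using T1 by (simp add: p_def p'_def a_minus_def minus_add smult_l_distr smult_one smult_closed
        a_ac r_neg1 r_neg2 r_neg)
  have k2p: "kill 2 1 p"
    using n jm_2_eigen(1)[OF t_nz] by (intro kill_eigen) (simp_all add: p_def[symmetric, unfolded One_nat_def])
  have k2p': "kill 2 (l - 1) p'"
    using n jm_2_eigen(2)[OF t_nz] t_last by (intro kill_eigen) (simp_all add: p'_def[symmetric, unfolded One_nat_def])
  have ep: "e i \<otimes> p = (if i 2 = 1 then (1 + t) \<odot> e i else \<zero>)" if i: "i \<in> R" for i
  proof (cases "i 2 = 1")
    case True
    have "e i \<otimes> p' = \<zero>"
      using True n l_ge l_odd by (intro e_annihilates[OF i _ p' _ k2p']) auto
    then have "e i \<otimes> p = (1 + t) \<odot> e i"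
      unfolding p_eq using e_closed[OF i]
      by (simp add: a_minus_def r_distr r_minus smult_mult_right smult_closed)
    then show ?thesis using True by simp
  next
    case False
    then have "e i \<otimes> p = \<zero>"
      using n l_ge by (intro e_annihilates[OF i _ p _ k2p]) auto
    then show ?thesis using False by simp
  qed
  have "p = (\<Oplus>i\<in>R. e i \<otimes> p)" by (rule decompose(1)[OF p])
  also have "\<dots> \<in> G 0"
    using ep e_in_G csubspaceD(2,4)[OF G_subspace]
    by (intro csubspace_finsum[OF G_subspace]) simp
  finally have pG: "p \<in> G 0" .
  define a where "a = inverse t * (t - 1)"
  have t1: "t \<noteq> 1" using t_prim[of 1] l_ge by simp
  then have a: "a \<noteq> 0" using t_nz by (simp add: a_def)
  have Lp: "(L \<ominus> inverse t \<odot> \<one>) \<otimes> p = a \<odot> x"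
    using jm_3_eigen(1)[OF t_nz] n by (simp only: L_def p_def a_def x_def)
  have Lx: "L \<otimes> x = t\<^sup>2 \<odot> x"
    using jm_3_eigen(2)[OF t_nz] n by (simp only: L_def x_def)
  have x_of: "x \<in> G k" if "c \<odot> x \<in> G k" "c \<noteq> 0" for c k
  proof -
    have "inverse c \<odot> (c \<odot> x) \<in> G k" by (rule csubspaceD(4)[OF G_subspace that(1)])
    then show ?thesis using that(2) by (simp add: smult_one flip: smult_assoc)
  qed
  show ?thesis
  proof (cases "l = 3")
    case False
    \<comment> \<open>An odd \<open>l \<ge> 3\<close> other than 3 is at least 5, so the residues 2
      and \<open>l - 1\<close> of \<open>jm 3\<close> differ.\<close>
    then have l5: "2 < l - 1" using l_ge l_odd by presburger
    have k3x: "kill 3 2 x"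
      using Lx n by (intro kill_eigen) (simp_all add: L_def)
    have ne: "t\<^sup>2 - inverse t \<noteq> 0"
      unfolding t_last using t_inj[of 2 "l - 1"] l5 by auto
    \<comment> \<open>Chosen to make \<open>w = p - \<kappa> x\<close> an eigenvector of
      \<open>L\<close>: from \<open>L p = t^-1 p + a x\<close> and \<open>L x = t^2 x\<close> the
      condition is \<open>a - \<kappa> t^2 = - \<kappa> t^-1\<close>. Thus
      \<open>p = w + \<kappa> x\<close> separates the two weights, and \<open>e i\<close> with
      \<open>i 3 = 2\<close> keeps only the second part.\<close>
    define \<kappa> where "\<kappa> = a / (t\<^sup>2 - inverse t)"
    have \<kappa>: "\<kappa> \<noteq> 0" "a - \<kappa> * t\<^sup>2 = - (inverse t * \<kappa>)"
      using a ne by (simp_all add: \<kappa>_def field_simps)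
    define w where "w = p \<ominus> \<kappa> \<odot> x"
    have w [simp]: "w \<in> carrier A" by (simp add: w_def smult_closed)
    have "(L \<ominus> inverse t \<odot> \<one>) \<otimes> p = L \<otimes> p \<ominus> inverse t \<odot> p"
      by (simp add: a_minus_def l_distr l_minus smult_mult_left smult_closed)
    with Lp have "L \<otimes> p \<ominus> inverse t \<odot> p = a \<odot> x" by simp
    then have "L \<otimes> p = a \<odot> x \<oplus> inverse t \<odot> p"
      by (metis add.inv_solve_right' m_closed smult_closed L p x a_minus_def a_comm)
    then have "L \<otimes> w = inverse t \<odot> p \<oplus> (a \<odot> x \<ominus> \<kappa> \<odot> (t\<^sup>2 \<odot> x))"
      using Lx by (simp add: w_def a_minus_def r_distr r_minus smult_mult_right smult_closed a_ac)
    also have "a \<odot> x \<ominus> \<kappa> \<odot> (t\<^sup>2 \<odot> x) = (a - \<kappa> * t\<^sup>2) \<odot> x"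
      using smult_l_distr[OF x, of a "- (\<kappa> * t\<^sup>2)"] minus_smult[OF x, of "\<kappa> * t\<^sup>2"]
      by (simp add: a_minus_def flip: smult_assoc)
    also have "\<dots> = \<ominus> (inverse t \<odot> (\<kappa> \<odot> x))"
      unfolding \<kappa>(2) by (simp add: minus_smult flip: smult_assoc)
    finally have "L \<otimes> w = inverse t \<odot> w"
      by (simp add: w_def a_minus_def smult_r_distr smult_minus smult_closed)
    then have k3w: "kill 3 (l - 1) w"
      using n unfolding t_last L_def by (intro kill_eigen) simp_all
    have ex: "e i \<otimes> (\<kappa> \<odot> x) \<in> G 0" if i: "i \<in> R" for i
    proof (cases "i 3 = 2")
      case True
      have "e i \<otimes> w = \<zero>"
        using True n l5 by (intro e_annihilates[OF i _ w _ k3w]) auto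
      then have "e i \<otimes> p \<ominus> e i \<otimes> (\<kappa> \<odot> x) = \<zero>"
        using e_closed[OF i] by (simp add: w_def a_minus_def r_distr r_minus smult_closed)
      then have "e i \<otimes> p = e i \<otimes> (\<kappa> \<odot> x)"
        using e_closed[OF i] by (intro eq_of_minus_eq_zero[of "e i \<otimes> p"]) (simp_all add: smult_closed)
      then show ?thesis using G_mult[OF e_in_G[OF i] pG] by simp
    next
      case False
      have "e i \<otimes> x = \<zero>"
        using False n l_ge by (intro e_annihilates[OF i _ x _ k3x]) auto
      then show ?thesis
        using e_closed[OF i] csubspaceD(2)[OF G_subspace] by (simp add: smult_mult_right smult_zero)
    qed
    have "\<kappa> \<odot> x = (\<Oplus>i\<in>R. e i \<otimes> (\<kappa> \<odot> x))"
      by (rule decompose(1)) (simp add: smult_closed)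
    also have "\<dots> \<in> G 0" using ex by (rule csubspace_finsum[OF G_subspace])
    finally show ?thesis using x_of \<kappa>(1) unfolding x_def by blast
  next
    case True
    \<comment> \<open>The two eigenvalues of \<open>L\<close> merge and leave a Jordan block:
      \<open>?D p = a x\<close> and \<open>?D x = 0\<close>. So all of \<open>p\<close> has residue
      2 for \<open>jm 3\<close>.\<close>
    have inv: "inverse t = t ^ 2" using t_last True by simp
    let ?D = "L \<ominus> t ^ 2 \<odot> \<one>"
    have D [simp]: "?D \<in> carrier A" by (simp add: smult_closed)
    have Dp: "?D \<otimes> p = a \<odot> x" using Lp unfolding inv .
    have "?D \<otimes> x = \<zero>"
      using Lx by (simp add: a_minus_def l_distr l_minus smult_mult_left smult_closed r_neg)
    then have "?D \<otimes> (?D \<otimes> p) = \<zero>"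
      unfolding Dp smult_mult_right[OF D x] by (simp add: smult_zero)
    then have "?D [^] (2::nat) \<otimes> p = \<zero>"
      unfolding nat_pow_two[OF D] using m_assoc[OF D D p] by simp
    then have k3p: "kill 3 2 p"
      unfolding kill_def L_def[symmetric]
    proof (rule nilpotent_mono[OF D p])
      show "(2::nat) \<le> 2 ^ n" using n power_increasing[of 1 n "2::nat"] by simp
    qed
    let ?c = "inverse (t ^ 2)"
    \<comment> \<open>This is y_3. On \<open>p\<close> only the summands with \<open>i 3 = 2\<close>
      survive, so \<open>?y p = (1 - t^-2 L) p = - t^-2 (?D p)\<close>, a nonzero multiple of
      \<open>x\<close>.\<close>
    let ?y = "\<Oplus>i\<in>R. (\<one> \<ominus> inverse (t ^ i 3) \<odot> jm 3) \<otimes> e i"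
    have "?y = (\<Oplus>i\<in>R. (\<one> \<ominus> inverse (t ^ i 3) \<odot> L) \<otimes> e i)"
      by (simp only: L_def)
    then have "?y \<otimes> p = (\<Oplus>i\<in>R. ((\<one> \<ominus> inverse (t ^ i 3) \<odot> L) \<otimes> e i) \<otimes> p)"
      using finite_R e_closed by (simp add: finsum_ldistr Pi_iff smult_closed)
    also have "\<dots> = (\<Oplus>i\<in>R. (\<one> \<ominus> ?c \<odot> L) \<otimes> (e i \<otimes> p))"
    proof (rule finsum_cong')
      fix i assume i: "i \<in> R"
      show "((\<one> \<ominus> inverse (t ^ i 3) \<odot> L) \<otimes> e i) \<otimes> p =
          (\<one> \<ominus> ?c \<odot> L) \<otimes> (e i \<otimes> p)"
      proof (cases "i 3 = 2")
        case True
        then show ?thesis using e_closed[OF i] by (simp add: m_assoc smult_closed)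
      next
        case False
        have "e i \<otimes> p = \<zero>"
          using False n l_ge by (intro e_annihilates[OF i _ p _ k3p]) auto
        then show ?thesis using e_closed[OF i] by (simp add: m_assoc smult_closed)
      qed
    qed (use e_closed in \<open>auto simp: smult_closed\<close>)
    also have "\<dots> = (\<one> \<ominus> ?c \<odot> L) \<otimes> (\<Oplus>i\<in>R. e i \<otimes> p)"
      using finite_R e_closed by (intro finsum_rdistr[symmetric]) (auto simp: smult_closed)
    also have "\<dots> = (\<one> \<ominus> ?c \<odot> L) \<otimes> p"
      by (simp only: decompose(1)[OF p, symmetric])
    also have "\<one> \<ominus> ?c \<odot> L = (- ?c) \<odot> ?D"
    proof -
      have "?c \<odot> (t ^ 2 \<odot> \<one>) = \<one>"
        using t_nz by (simp add: smult_one flip: smult_assoc)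
      then show ?thesis
        by (simp add: minus_smult a_minus_def smult_r_distr smult_minus smult_closed minus_add a_comm)
    qed
    also have "((- ?c) \<odot> ?D) \<otimes> p = (- ?c * a) \<odot> x"
      using smult_mult_left[OF D p, of "- ?c"] Dp smult_assoc[OF x, of "- ?c" a] by simp
    finally have eq: "(- ?c * a) \<odot> x = ?y \<otimes> p" ..
    have "?y \<in> G 2" using n by (rule y_in_G)
    from G_mult[OF this pG] have "(- ?c * a) \<odot> x \<in> G (2 + 0)" unfolding eq .
    moreover have "- ?c * a \<noteq> 0" using a t_nz by simp
    ultimately show ?thesis using x_of unfolding x_def by blast
  qed
qed

end

locale hecke_tl_graded = hecke_tl +
  fixes l :: nat and e :: "(nat \<Rightarrow> nat) \<Rightarrow> ncpoly set" and G :: "int \<Rightarrow> ncpoly set set"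
  assumes l_odd: "odd l" and l_ge: "l \<ge> 3"
    and q_def: "q = exp (2 * of_real pi * \<i> / of_nat l)"
    and e: "weight_idempotents q l n e"
    and G: "bk_grading q l n e G"
begin

lemma t_pow: "(q\<^sup>2) ^ l = 1"
  using root_of_unity_power[of l] l_ge by (metis q_def power_commutes power_mult power_one mult.commute less_le_trans zero_less_numeral)

text \<open>Oddness of \<open>l\<close> excludes \<open>2 m = l\<close>, and \<open>2 m > l\<close>
  is reduced by one period to the exponent \<open>2 m - l < l\<close> of the primitive root
  \<open>q\<close>.\<close>

lemma t_prim:
  assumes "0 < m" "m < l"
  shows "(q\<^sup>2) ^ m \<noteq> 1"
proof
  have l0: "l > 0" using l_ge by simp
  assume "(q\<^sup>2) ^ m = 1"
  then have qm: "q ^ (2 * m) = 1" by (simp add: power_mult)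
  have ql: "q ^ l = 1" unfolding q_def by (rule root_of_unity_power[OF l0])
  have prim: "q ^ k \<noteq> 1" if "0 < k" "k < l" for k
    unfolding q_def by (rule primitive_root_power[OF l0 that])
  consider "2 * m < l" | "2 * m = l" | "l < 2 * m" by linarith
  then show False
  proof cases
    case 1
    then show False using prim[of "2 * m"] qm assms by simp
  next
    case 2
    then show False using l_odd by auto
  next
    case 3
    have "q ^ (2 * m) = q ^ l * q ^ (2 * m - l)" using 3 by (simp flip: power_add)
    then have "q ^ (2 * m - l) = 1" using qm ql by simp
    then show False using prim[of "2 * m - l"] 3 assms by simp
  qed
qed

lemma jucys_murphy_eq: "jucys_murphy n q r = H.jm r"
proof (induction r)
  case (Suc r)
  then show ?case by (cases r) simp_all
qed simp

lemma e_closed: "i \<in> residue_seqs l n \<Longrightarrow> e i \<in> carrier HA"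
  using e by (simp add: weight_idempotents_def)

lemma e_mult: "i \<in> residue_seqs l n \<Longrightarrow> j \<in> residue_seqs l n \<Longrightarrow> e i \<otimes>\<^bsub>HA\<^esub> e j = (if i = j then e i else \<zero>\<^bsub>HA\<^esub>)"
  using e by (simp add: weight_idempotents_def)

text \<open>In a faithful matrix representation \<rho> every \<open>\<rho> z *\<^sub>v v\<close> is
  a weight vector, hence in the image of the idempotent \<open>\<rho> (e i)\<close> and fixed by it.
  Faithfulness carries this back to the algebra.\<close>

lemma e_fixes_weight:
  assumes i: "i \<in> residue_seqs l n" and z: "z \<in> carrier HA" and k: "\<And>r. r \<in> {1..n} \<Longrightarrow>
      (H.jm r \<ominus>\<^bsub>HA\<^esub> (q\<^sup>2) ^ i r \<odot>\<^bsub>HA\<^esub> \<one>\<^bsub>HA\<^esub>) [^]\<^bsub>HA\<^esub> ((2::nat) ^ n) \<otimes>\<^bsub>HA\<^esub> z = \<zero>\<^bsub>HA\<^esub>"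
  shows "e i \<otimes>\<^bsub>HA\<^esub> z = z"
proof -
  obtain B where "finite B" "B \<subseteq> carrier HA" "carrier HA \<subseteq> H.cspan B" by (rule H.finite_spanning)
  from H.finite_basis[OF this] obtain h d where "H.coordinate_basis h d" by (elim exE)
  from H.faithful_matrix_rep[OF this] obtain \<rho>
    where \<rho>: "\<rho> \<in> calg_hom HA (module_mat TYPE(complex) d d)"
      and inj: "\<forall>x\<in>carrier HA. \<forall>y\<in>carrier HA. (\<forall>v\<in>carrier_vec d. \<rho> x *\<^sub>v v = \<rho> y *\<^sub>v v) \<longrightarrow> x = y"
    by (elim bexE)
  have \<rho>_closed: "\<rho> x \<in> carrier_mat d d" if "x \<in> carrier HA" for x
    using \<rho> that by (auto simp: calg_hom_def Ring.ring_hom_def module_mat_simps)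
  have \<rho>_mult: "\<rho> (x \<otimes>\<^bsub>HA\<^esub> y) *\<^sub>v v = \<rho> x *\<^sub>v (\<rho> y *\<^sub>v v)"
    if "x \<in> carrier HA" "y \<in> carrier HA" "v \<in> carrier_vec d" for x y v
  proof -
    have "\<rho> (x \<otimes>\<^bsub>HA\<^esub> y) = \<rho> x * \<rho> y"
      using \<rho> that by (simp add: calg_hom_def Ring.ring_hom_def module_mat_simps)
    then show ?thesis using assoc_mult_mat_vec[OF \<rho>_closed[OF that(1)] \<rho>_closed[OF that(2)] that(3)] by simp
  qed
  have \<rho>_zero: "\<rho> \<zero>\<^bsub>HA\<^esub> *\<^sub>v v = 0\<^sub>v d" if v: "v \<in> carrier_vec d" for v
  proof -
    have "\<rho> (0 \<odot>\<^bsub>HA\<^esub> \<zero>\<^bsub>HA\<^esub>) = 0 \<cdot>\<^sub>m \<rho> \<zero>\<^bsub>HA\<^esub>"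
      using \<rho> by (simp add: calg_hom_def module_mat_simps)
    then have "\<rho> \<zero>\<^bsub>HA\<^esub> = 0 \<cdot>\<^sub>m \<rho> \<zero>\<^bsub>HA\<^esub>" by (simp add: H.smult_zero)
    also have "\<dots> = 0\<^sub>m d d" using \<rho>_closed[of "\<zero>\<^bsub>HA\<^esub>"] by (intro eq_matI) auto
    finally show ?thesis using v by (intro eq_vecI) auto
  qed
  have img: "(\<lambda>v. \<rho> (e i) *\<^sub>v v) ` carrier_vec d = weight_space q n d \<rho> i"
    using e \<rho> i by (simp add: weight_idempotents_def)
  have "\<rho> (e i \<otimes>\<^bsub>HA\<^esub> z) *\<^sub>v v = \<rho> z *\<^sub>v v" if v: "v \<in> carrier_vec d" for v
  proof -
    let ?w = "\<rho> z *\<^sub>v v"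
    have w: "?w \<in> carrier_vec d" using \<rho>_closed[OF z] v by simp
    \<comment> \<open>\<open>weight_space\<close> asks for all sufficiently large powers;
      \<open>2^n\<close> serves as the threshold for every \<open>r\<close>.\<close>
    have "\<rho> ((jucys_murphy n q r \<ominus>\<^bsub>HA\<^esub> (q ^ (2 * i r)) \<odot>\<^bsub>HA\<^esub> \<one>\<^bsub>HA\<^esub>) [^]\<^bsub>HA\<^esub> N) *\<^sub>v ?w = 0\<^sub>v d"
      if "(2::nat) ^ n \<le> N" and r: "r \<in> {1..n}" for N r
    proof -
      let ?D = "H.jm r \<ominus>\<^bsub>HA\<^esub> (q\<^sup>2) ^ i r \<odot>\<^bsub>HA\<^esub> \<one>\<^bsub>HA\<^esub>"
      have D: "?D \<in> carrier HA" using r by (simp add: H.smult_closed)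
      have "\<rho> (?D [^]\<^bsub>HA\<^esub> N) *\<^sub>v ?w = \<rho> (?D [^]\<^bsub>HA\<^esub> N \<otimes>\<^bsub>HA\<^esub> z) *\<^sub>v v"
        by (rule \<rho>_mult[OF H.nat_pow_closed[OF D] z v, symmetric])
      also have "?D [^]\<^bsub>HA\<^esub> N \<otimes>\<^bsub>HA\<^esub> z = \<zero>\<^bsub>HA\<^esub>"
        by (rule H.nilpotent_mono[OF D z k[OF r] that(1)])
      finally show ?thesis using \<rho>_zero[OF v] by (simp add: jucys_murphy_eq power_mult)
    qed
    then have "?w \<in> weight_space q n d \<rho> i"
      unfolding weight_space_def using w by blast
    then obtain u where u: "u \<in> carrier_vec d" "?w = \<rho> (e i) *\<^sub>v u" unfolding img[symmetric] by blast
    have "\<rho> (e i) *\<^sub>v (\<rho> (e i) *\<^sub>v u) = \<rho> (e i) *\<^sub>v u"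
      using \<rho>_mult[OF e_closed[OF i] e_closed[OF i] u(1)] e_mult[OF i i] by simp
    then show ?thesis using \<rho>_mult[OF e_closed[OF i] z v] u(2) by simp
  qed
  then show ?thesis using inj e_closed[OF i] z by simp
qed

sublocale W: hecke_weights_graded "hecke_alg n (q\<^sup>2)" n "q\<^sup>2" "hecke_T n (q\<^sup>2)" l e G
proof
  show "(\<Oplus>\<^bsub>HA\<^esub>i\<in>residue_seqs l n.
      (\<one>\<^bsub>HA\<^esub> \<ominus>\<^bsub>HA\<^esub> inverse ((q\<^sup>2) ^ i 3) \<odot>\<^bsub>HA\<^esub> H.jm 3) \<otimes>\<^bsub>HA\<^esub> e i) \<in> G 2" if "3 \<le> n"
  proof -
    have "bk_y q l n e 3 \<in> G 2" using G that by (simp add: bk_grading_def)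
    then show ?thesis by (simp add: bk_y_def Let_def jucys_murphy_eq power_mult)
  qed
  show "e i \<otimes>\<^bsub>HA\<^esub> z = z" if "i \<in> residue_seqs l n" "z \<in> carrier HA"
    "\<And>r. r \<in> {1..n} \<Longrightarrow>
      (H.jm r \<ominus>\<^bsub>HA\<^esub> (q\<^sup>2) ^ i r \<odot>\<^bsub>HA\<^esub> \<one>\<^bsub>HA\<^esub>) [^]\<^bsub>HA\<^esub> ((2::nat) ^ n) \<otimes>\<^bsub>HA\<^esub> z = \<zero>\<^bsub>HA\<^esub>" for i z
    using that by (rule e_fixes_weight)
qed (use l_odd l_ge t_pow t_prim e_closed e_mult G in \<open>simp_all add: bk_grading_def\<close>)

lemma kernel_graded: "graded_ideal HA G (a_kernel HA TA \<Phi>)"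
  unfolding kernel_eq
proof (rule H.genideal_graded[OF W.G_graded])
  show "\<exists>k. z \<in> G k" if "z \<in> ker_gens" for z
    using that W.sym3_homogeneous by (auto simp: ker_gens_def split: if_splits)
qed

end

section \<open>The quotient by the kernel and its grading\<close>

context calg_homomorphism
begin

lemma kernel_calgebra_ideal: "calgebra_ideal A (a_kernel A B f)"
  by (intro A.calgebra_idealI kernel_ideal)

lemma first_isomorphism:
  assumes surj: "f ` carrier A = carrier B"
  shows "\<exists>g\<in>calg_iso (quot_alg A (a_kernel A B f)) B.
    \<forall>x\<in>carrier A. g (a_kernel A B f +>\<^bsub>A\<^esub> x) = f x"
proof -
  interpret K: calgebra_ideal A "a_kernel A B f" by (rule kernel_calgebra_ideal)
  obtain g where g: "g \<in> calg_hom (quot_alg A (a_kernel A B f)) B"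
    "\<And>x. x \<in> carrier A \<Longrightarrow> g (a_kernel A B f +>\<^bsub>A\<^esub> x) = f x"
    using K.quot_factor[OF B.calgebra_axioms hom] mem_kernel by metis
  have "inj_on g (carrier (quot_alg A (a_kernel A B f)))"
  proof (rule inj_onI, unfold K.quot_carrier)
    fix X Y assume "X \<in> (+>\<^bsub>A\<^esub>) (a_kernel A B f) ` carrier A" "Y \<in> (+>\<^bsub>A\<^esub>) (a_kernel A B f) ` carrier A"
      and eq: "g X = g Y"
    then obtain x y where xy: "x \<in> carrier A" "X = a_kernel A B f +>\<^bsub>A\<^esub> x"
      "y \<in> carrier A" "Y = a_kernel A B f +>\<^bsub>A\<^esub> y" by blast
    then have "f (x \<ominus>\<^bsub>A\<^esub> y) = \<zero>\<^bsub>B\<^esub>" using eq g(2) by (simp add: f_diff B.minus_self)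
    then have "x \<ominus>\<^bsub>A\<^esub> y \<in> a_kernel A B f" using xy by (simp add: mem_kernel)
    then show "X = Y" using xy K.coset_eq_iff by simp
  qed
  moreover have "g ` carrier (quot_alg A (a_kernel A B f)) = carrier B"
    unfolding K.quot_carrier surj[symmetric] image_image using g(2) by (intro image_cong) auto
  ultimately show ?thesis using g by (auto simp: calg_iso_def bij_betw_def)
qed

text \<open>The projection to the quotient is a surjection with the same kernel as \<open>f\<close>,
  so \<open>graded_image\<close> applies to it.\<close>

lemma quotient_graded:
  assumes G: "graded_algebra A G" and J: "graded_ideal A G (a_kernel A B f)"
  shows "graded_algebra (quot_alg A (a_kernel A B f)) (quot_grading A (a_kernel A B f) G)"
proof -
  interpret K: calgebra_ideal A "a_kernel A B f" by (rule kernel_calgebra_ideal)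
  have "a_kernel A (quot_alg A (a_kernel A B f)) (\<lambda>x. a_kernel A B f +>\<^bsub>A\<^esub> x) = a_kernel A B f"
    using K.proj_eq_zero_iff K.a_subset by (auto simp: K.proj.mem_kernel)
  with J show ?thesis
    unfolding quot_grading_def by (intro K.proj.graded_image[OF K.quot_carrier[symmetric] G]) simp
qed

end

theorem theorem3p2:
  fixes l n :: nat and q :: complex
    and e :: "(nat \<Rightarrow> nat) \<Rightarrow> ncpoly set"
    and G :: "int \<Rightarrow> ncpoly set set"
  assumes l: "odd l" "l \<ge> 3"
    and q: "q = exp (2 * of_real pi * \<i> / of_nat l)"
    and e: "weight_idempotents q l n e"
    and G: "bk_grading q l n e G"
  shows "let H = hecke_alg n (q\<^sup>2); TL = tl_alg n q; \<Phi> = hecke_to_tl n q; J = a_kernel H TL \<Phi> in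
    \<Phi> \<in> calg_hom H TL \<and>
    (\<forall>i\<in>{1..<n}. \<Phi> (hecke_T n (q\<^sup>2) i) = (- q) \<odot>\<^bsub>TL\<^esub> tl_U n q i \<ominus>\<^bsub>TL\<^esub> \<one>\<^bsub>TL\<^esub>) \<and>
    \<Phi> ` carrier H = carrier TL \<and>
    graded_ideal H G J \<and>
    graded_algebra (quot_alg H J) (quot_grading H J G) \<and>
    (\<exists>\<Psi>\<in>calg_iso (quot_alg H J) TL. \<forall>x\<in>carrier H. \<Psi> (J +>\<^bsub>H\<^esub> x) = \<Phi> x) \<and>
    graded_algebra TL (\<lambda>k. \<Phi> ` G k)"
proof -
  have "q \<noteq> 0" unfolding q by simp
  then interpret hecke_tl_graded n q l e G
    using l q e G by unfold_locales
  show ?thesis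
    unfolding Let_def
    using Phi Phi_surj kernel_graded Phi.quotient_graded[OF W.G_graded kernel_graded]
      Phi.first_isomorphism[OF Phi_surj] Phi.graded_image[OF Phi_surj W.G_graded kernel_graded]
    by (intro conjI ballI)
qed

end
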